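(* Let $R$ be a finite local commutative ring other than a field, with residue field $\mathbb F$, and let $K\le R^\times$ be strongly pure. Then $\mathcal C=\mathrm{Cyc}(K,R)$ is normal. Moreover, the natural mapping $\mathrm{Aut}_{\mathcal C}(R)\to\mathrm{Aut}_{\mathcal C}(\mathbb F)$ is a monomorphism.
   Context: All rings have an identity; $\mathrm{rad}(R)$ is the maximal ideal of the local ring $R$ and $\mathbb F=R/\mathrm{rad}(R)$, $\pi:R\to\mathbb F$ the natural epimorphism. $\mathrm{Cyc}(K,R)$ is the pair $(R,\mathrm{Rel}(K,R))$ with $\mathrm{Rel}(K,R)$ the relations $\{(x,y): y-x\in rK\}$, $r\in R$; $\mathrm{Aut}(\mathcal C)$ is the group of permutations of $R$ fixing each such relation. $\mathrm{A\Gamma L}_1(R)$ is the group of permutations $x\mapsto ax^\sigma+b$, $a\in R^\times$, $b\in R$, $\sigma\in\mathrm{Aut}(R)$; $\mathcal C$ is normal if $\mathrm{Aut}(\mathcal C)\le\mathrm{A\Gamma L}_1(R)$. $K$ is pure if the only ideal $I$ with $1+I\subseteq K$ is $\{0\}$. With $I_0=\{x\in\mathrm{rad}(R):x\,\mathrm{rad}(R)=\{0\}\}$ and $\pi_0:R\to R/I_0$, a group $K\le R^\times$ is strongly pure if it is pure and, unless $R$ is a field, $\pi_0(K)$ is a strongly pure subgroup of $(R/I_0)^\times$ (recursive definition). $\mathrm{Aut}_{\mathcal C}(R)=\mathrm{Aut}(\mathcal C)\cap\mathrm{Aut}(R)$, and $\mathrm{Aut}_{\mathcal C}(\mathbb F)=\mathrm{Aut}(\mathrm{Cyc}(\pi(K),\mathbb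 F))\cap\mathrm{Aut}(\mathbb F)$ (here $\mathrm{Cyc}(\pi(K),\mathbb F)$ is the quotient scheme of $\mathcal C$ modulo the equivalence with classes the cosets of $\mathrm{rad}(R)$). The natural mapping sends a ring automorphism of $R$ to the automorphism it induces on $\mathbb F$. *)

theory Defs
  imports "HOL-Algebra.Algebra"
begin

definition local_ring :: "('a, 'b) ring_scheme \<Rightarrow> bool" where
  "local_ring R \<longleftrightarrow> (\<exists>!M. maximalideal M R)"

definition rad :: "('a, 'b) ring_scheme \<Rightarrow> 'a set" where
  "rad R = (THE M. maximalideal M R)"

definition res_map :: "('a, 'b) ring_scheme \<Rightarrow> 'a \<Rightarrow> 'a set" where
  "res_map R x = rad R +>\<^bsub>R\<^esub> x"

definition res_field :: "('a, 'b) ring_scheme \<Rightarrow> 'a set ring" where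
  "res_field R = R Quot rad R"

definition cyc_rel :: "('a, 'b) ring_scheme \<Rightarrow> 'a set \<Rightarrow> 'a \<Rightarrow> ('a \<times> 'a) set" where
  "cyc_rel R K r = {(x, y). x \<in> carrier R \<and> y \<in> carrier R \<and>
      y \<ominus>\<^bsub>R\<^esub> x \<in> (\<lambda>k. r \<otimes>\<^bsub>R\<^esub> k) ` K}"

definition cyc_aut :: "('a, 'b) ring_scheme \<Rightarrow> 'a set \<Rightarrow> ('a \<Rightarrow> 'a) set" where
  "cyc_aut R K = {f. bij_betw f (carrier R) (carrier R) \<and>
      (\<forall>r \<in> carrier R. (\<lambda>(x, y). (f x, f y)) ` cyc_rel R K r = cyc_rel R K r)}"

definition AGammaL1 :: "('a, 'b) ring_scheme \<Rightarrow> ('a \<Rightarrow> 'a) set" where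
  "AGammaL1 R = {f. \<exists>a \<in> Units R. \<exists>\<sigma> \<in> ring_iso R R. \<exists>b \<in> carrier R.
      \<forall>x \<in> carrier R. f x = a \<otimes>\<^bsub>R\<^esub> \<sigma> x \<oplus>\<^bsub>R\<^esub> b}"

definition cyc_normal :: "('a, 'b) ring_scheme \<Rightarrow> 'a set \<Rightarrow> bool" where
  "cyc_normal R K \<longleftrightarrow> cyc_aut R K \<subseteq> AGammaL1 R"

definition pure :: "('a, 'b) ring_scheme \<Rightarrow> 'a set \<Rightarrow> bool" where
  "pure R K \<longleftrightarrow> (\<forall>I. ideal I R \<and> (\<forall>x \<in> I. \<one>\<^bsub>R\<^esub> \<oplus>\<^bsub>R\<^esub> x \<in> K) \<longrightarrow> I = {\<zero>\<^bsub>R\<^esub>})"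

definition I0 :: "('a, 'b) ring_scheme \<Rightarrow> 'a set" where
  "I0 R = {x \<in> rad R. \<forall>y \<in> rad R. x \<otimes>\<^bsub>R\<^esub> y = \<zero>\<^bsub>R\<^esub>}"

text \<open>The recursion R, R/I_0(R), (R/I_0(R))/I_0(R/I_0(R)), ... realised inside R:
  J k is the ideal of R with R/J k the k-th ring in the recursion; J (Suc k) is the
  preimage of I_0(R/J k) under R \<rightarrow> R/J k.\<close>
fun pure_chain :: "('a, 'b) ring_scheme \<Rightarrow> nat \<Rightarrow> 'a set" where
  "pure_chain R 0 = {\<zero>\<^bsub>R\<^esub>}"
| "pure_chain R (Suc k) =
     {x \<in> carrier R. pure_chain R k +>\<^bsub>R\<^esub> x \<in> I0 (R Quot pure_chain R k)}"

text \<open>Strongly pure: the image of K in every ring of the recursion is pure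
  (once a field is reached the recursion becomes stationary and purity is automatic).\<close>
definition strongly_pure :: "('a, 'b) ring_scheme \<Rightarrow> 'a set \<Rightarrow> bool" where
  "strongly_pure R K \<longleftrightarrow>
     (\<forall>k. pure (R Quot pure_chain R k) ((\<lambda>x. pure_chain R k +>\<^bsub>R\<^esub> x) ` K))"

definition autC_ring :: "('a, 'b) ring_scheme \<Rightarrow> 'a set \<Rightarrow> ('a \<Rightarrow> 'a) set" where
  "autC_ring R K = cyc_aut R K \<inter> ring_iso R R"

definition autC_field :: "('a, 'b) ring_scheme \<Rightarrow> 'a set \<Rightarrow> ('a set \<Rightarrow> 'a set) set" where
  "autC_field R K = cyc_aut (res_field R) (res_map R ` K) \<inter> ring_iso (res_field R) (res_field R)"

text \<open>Natural mapping: a ring automorphism induces C \<mapsto> sigma(C) on cosets of rad(R).\<close>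
definition induced_aut :: "('a \<Rightarrow> 'a) \<Rightarrow> 'a set \<Rightarrow> 'a set" where
  "induced_aut \<sigma> C = \<sigma> ` C"

end

theory Submission
  imports Defs
begin

text \<open>
  Write \<open>M\<close> for the maximal ideal, \<open>V\<close> for \<open>I0 R\<close>, an \<open>R/M\<close>-space, and \<open>U\<close> for the set of \<open>v\<close> in \<open>V\<close>
  with \<open>1 + v\<close> in \<open>K\<close>; this is an additive group, and purity says that it contains no line of \<open>V\<close>.
  An automorphism of the scheme satisfies \<open>f x - f y \<in> (x - y) K\<close>, and one may assume \<open>f 0 = 0\<close>, \<open>f 1 = 1\<close>.
  If two elements of the same \<open>K\<close>-orbit of units agree modulo \<open>V\<close>, their quotient lies in \<open>1 + U\<close>.
  Every conclusion has the same pattern: a vector is shown to lie in \<open>c U\<close> for all units \<open>c\<close>, hence vanishes.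

  Comparing \<open>f (x + v)\<close> with \<open>f (x + 1/e)\<close> for \<open>v\<close> in \<open>V\<close> shows that \<open>e \<mapsto> 1/(f (x + 1/e) - f x)\<close> is
  additive modulo \<open>M\<close>, and Hua's identity makes \<open>f\<close> a field automorphism modulo \<open>M\<close>.
  If \<open>f\<close> is a homomorphism modulo \<open>V\<close>, the same comparisons show that \<open>f\<close> is additive and semilinear on
  cosets of \<open>M\<close>. The remaining failure of additivity or multiplicativity is a function from \<open>R/M\<close> to \<open>V\<close>
  all of whose difference quotients lie in \<open>U\<close>, and such a function is affine: finite differences
  reduce this to additive functions, which are then shown to commute with a generator of the
  multiplicative group of \<open>R/M\<close>. Strong purity allows the descent from \<open>R/M\<close> to \<open>R\<close> through the
  quotients by the chain of ideals. Uniqueness of lifts is proved by the same descent.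
\<close>

section \<open>Finite local rings\<close>

text \<open>The obstacle is that \<open>U\<close> is only an additive group, not a subspace: linear
  algebra over the residue field does not apply to it, and each comparison yields one membership, at
  one scale. Purity becomes usable only when the same vector is caught at every scale. Usually the
  scales come from surjectivity of \<open>f\<close>: a base point or a factor with any prescribed
  image can be chosen. A single additive function offers no such choice, and there the scales are
  produced by iterating an operator (\<open>addv_power_defect\<close>). The two stages start at
  opposite ends of the chain. Additivity modulo \<open>M\<close> is proved at its bottom, where
  \<open>V\<close> is the annihilator of \<open>M\<close> in \<open>R\<close> and is nonzero because
  \<open>R\<close> is not a field. The descent starts at its top, where the kernel is
  \<open>M\<close>, and every step is one and the same theorem, used in \<open>R/J\<close> with
  \<open>V\<close> the annihilator of the maximal ideal of that quotient.\<close>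

lemma (in cring) Units_inv_cancel:
  assumes "a \<in> Units R" "x \<in> carrier R"
  shows "inv a \<otimes> (a \<otimes> x) = x" and "a \<otimes> (inv a \<otimes> x) = x"
  using assms by (simp_all add: m_assoc[symmetric] Units_closed)

lemma (in ideal) minus_closed: "a \<in> I \<Longrightarrow> b \<in> I \<Longrightarrow> a \<ominus> b \<in> I"
  by (simp add: a_minus_def)

text \<open>The maximal ideal is a parameter, because the quotients \<open>R Quot J\<close> enter
  this locale with the image of \<open>M\<close>; \<open>rad_eq\<close> identifies it with
  \<open>rad R\<close>.\<close>

locale finite_local_ring = cring R for R (structure) +
  fixes M
  assumes finite_carrier: "finite (carrier R)"
    and M_ideal: "ideal M R"
    and one_notin_M: "\<one> \<notin> M"
    and UnitsI: "x \<in> carrier R \<Longrightarrow> x \<notin> M \<Longrightarrow> x \<in> Units R"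
begin

sublocale M: ideal M R by (rule M_ideal)

lemma Units_iff: "x \<in> Units R \<longleftrightarrow> x \<in> carrier R \<and> x \<notin> M"
proof
  assume x: "x \<in> Units R"
  have "x \<notin> M"
  proof
    assume "x \<in> M"
    then have "inv x \<otimes> x \<in> M" using x by (blast intro: M.I_l_closed)
    then show False using x one_notin_M by simp
  qed
  then show "x \<in> carrier R \<and> x \<notin> M" using x by auto
qed (use UnitsI in auto)

lemma Units_or_M: "x \<in> carrier R \<Longrightarrow> x \<in> Units R \<or> x \<in> M"
  using UnitsI by blast

lemma not_Units_M: "x \<in> M \<Longrightarrow> x \<notin> Units R"
  by (simp add: Units_iff)

lemma Units_add_M:
  assumes "a \<in> Units R" "r \<in> M"
  shows "a \<oplus> r \<in> Units R"
proof -
  have c: "a \<in> carrier R" "r \<in> carrier R" using assms by (auto simp: M.Icarr)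
  have "a \<oplus> r \<notin> M"
  proof
    assume "a \<oplus> r \<in> M"
    then have "(a \<oplus> r) \<ominus> r \<in> M" using assms by (simp add: M.minus_closed)
    moreover have "(a \<oplus> r) \<ominus> r = a" using c by algebra
    ultimately show False using assms by (simp add: Units_iff)
  qed
  then show ?thesis using c by (simp add: Units_iff)
qed

lemma Units_cong_M:
  assumes "a \<in> Units R" "b \<in> carrier R" "b \<ominus> a \<in> M"
  shows "b \<in> Units R"
proof -
  have "a \<oplus> (b \<ominus> a) = b" using Units_closed[OF assms(1)] assms(2) by algebra
  then show ?thesis using Units_add_M[OF assms(1,3)] by simp
qed

lemma maximalideal_M: "maximalideal M R"
proof (rule maximalidealI)
  show "carrier R \<noteq> M" using one_notin_M by auto
  fix J assume J: "ideal J R" "M \<subseteq> J" "J \<subseteq> carrier R"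
  interpret J: ideal J R by (rule J)
  show "J = M \<or> J = carrier R"
  proof (cases "J \<subseteq> M")
    case False
    then obtain x where x: "x \<in> J" "x \<in> Units R" using J UnitsI by blast
    then have "inv x \<otimes> x \<in> J" by (blast intro: J.I_l_closed)
    then show ?thesis using x J.one_imp_carrier by simp
  qed (use J in auto)
qed (rule M_ideal)

abbreviation "F \<equiv> R Quot M"
abbreviation "\<pi> x \<equiv> M +> x"

lemma field_F: "field F"
  using maximalideal.quotient_is_field[OF maximalideal_M] by (simp add: is_cring)

lemma pi_hom: "ring_hom_cring R F ((+>) M)"
  using M.rcos_ring_hom_cring by (simp add: is_cring)

lemma pi_eq: "a \<in> carrier R \<Longrightarrow> b \<in> carrier R \<Longrightarrow> \<pi> a = \<pi> b \<longleftrightarrow> a \<ominus> b \<in> M"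
  using quotient_eq_iff_same_a_r_cos[OF M_ideal] by blast

lemma carrier_F: "carrier F = (\<lambda>x. \<pi> x) ` carrier R"
  by (auto simp: FactRing_simps)

lemma finite_F: "finite (carrier F)"
  unfolding carrier_F using finite_carrier by simp

lemma pi_zero: "x \<in> carrier R \<Longrightarrow> \<pi> x = \<zero>\<^bsub>F\<^esub> \<longleftrightarrow> x \<in> M"
proof -
  assume x: "x \<in> carrier R"
  interpret h: ring_hom_cring R F "(+>) M" by (rule pi_hom)
  have "\<pi> x = \<zero>\<^bsub>F\<^esub> \<longleftrightarrow> \<pi> x = \<pi> \<zero>" by simp
  also have "\<dots> \<longleftrightarrow> x \<in> M" using x by (simp only: pi_eq zero_closed) (simp add: a_minus_def)
  finally show ?thesis .
qed

lemma pi_pow: "x \<in> carrier R \<Longrightarrow> \<pi> (x [^] (n::nat)) = \<pi> x [^]\<^bsub>F\<^esub> n"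
proof -
  assume x: "x \<in> carrier R"
  interpret h: ring_hom_cring R F "(+>) M" by (rule pi_hom)
  show ?thesis using x by (induction n) simp_all
qed

lemma pi_add_pow: "x \<in> carrier R \<Longrightarrow> \<pi> (add_pow R n x) = add_pow F (n::nat) (\<pi> x)"
proof -
  assume x: "x \<in> carrier R"
  interpret h: ring_hom_cring R F "(+>) M" by (rule pi_hom)
  show ?thesis using x by (induction n) simp_all
qed

text \<open>The multiplicative group of the finite residue field is cyclic. The common bound
  \<open>N\<close> on the exponents tells \<open>addv_linear\<close> how often the defect operator
  must be applied.\<close>

lemma unit_generator:
  obtains g and N :: nat where "g \<in> Units R" "\<And>c. c \<in> Units R \<Longrightarrow> \<exists>i\<le>N. c \<ominus> g [^] i \<in> M"
proof -
  interpret F: field F by (rule field_F)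
  obtain G where G: "G \<in> carrier (Multiplicative_Group.mult_of F)" "carrier (Multiplicative_Group.mult_of F) = {G [^]\<^bsub>F\<^esub> i | i::nat. i \<in> UNIV}"
    using F.finite_field_mult_group_has_gen[OF finite_F] by blast
  obtain g where g: "g \<in> carrier R" "G = \<pi> g" using G(1) by (auto simp: carrier_F)
  have gu: "g \<in> Units R" using G(1) g by (auto simp: Units_iff pi_zero)
  have ex: "\<exists>i. c \<ominus> g [^] (i::nat) \<in> M" if "c \<in> Units R" for c
  proof -
    have c: "c \<in> carrier R" "c \<notin> M" using that by (auto simp: Units_iff)
    then have "\<pi> c \<in> carrier (Multiplicative_Group.mult_of F)" by (auto simp: carrier_F pi_zero)
    then obtain i :: nat where "\<pi> c = G [^]\<^bsub>F\<^esub> i" using G(2) by blast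
    then show ?thesis using g c by (metis pi_pow pi_eq nat_pow_closed)
  qed
  then obtain e where e: "c \<ominus> g [^] (e c :: nat) \<in> M" if "c \<in> Units R" for c by metis
  have "finite (Units R)" using finite_carrier by (rule finite_subset[rotated]) auto
  then have "e c \<le> Max (e ` Units R)" if "c \<in> Units R" for c using that by simp
  then show thesis using that[OF gu] e by meson
qed

text \<open>\<open>n\<close> is the order of the multiplicative group of the residue field, so
  \<open>n + 1\<close> is the order of the field and \<open>n\<close> acts as -1 modulo
  \<open>M\<close>. \<open>defect_twice\<close> needs both facts for the same
  \<open>n\<close>.\<close>

lemma unit_exponent:
  obtains n :: nat where "\<And>z. z \<in> Units R \<Longrightarrow> z [^] n \<ominus> \<one> \<in> M" "add_pow R (Suc n) \<one> \<in> M"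
proof -
  interpret F: field F by (rule field_F)
  interpret h: ring_hom_cring R F "(+>) M" by (rule pi_hom)
  interpret G: group "Multiplicative_Group.mult_of F" by (rule F.field_mult_group)
  have o: "Suc (order (Multiplicative_Group.mult_of F)) = order F"
    using F.order_mult_of[OF finite_F] finite_F by (auto simp: F.order_gt_0_iff_finite)
  have "z [^] order (Multiplicative_Group.mult_of F) \<ominus> \<one> \<in> M" if z: "z \<in> Units R" for z
  proof -
    have z': "z \<in> carrier R" "z \<notin> M" using z by (auto simp: Units_iff)
    then have "\<pi> z \<in> carrier (Multiplicative_Group.mult_of F)" by (auto simp: carrier_F pi_zero)
    from G.pow_order_eq_1[OF this] have "\<pi> z [^]\<^bsub>F\<^esub> order (Multiplicative_Group.mult_of F) = \<one>\<^bsub>F\<^esub>"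
      by (simp add: Multiplicative_Group.nat_pow_mult_of)
    then have "\<pi> (z [^] order (Multiplicative_Group.mult_of F)) = \<pi> \<one>" using z' by (simp only: pi_pow h.hom_one)
    then show ?thesis using z' by (simp only: pi_eq nat_pow_closed one_closed)
  qed
  moreover have "add_pow R (Suc (order (Multiplicative_Group.mult_of F))) \<one> \<in> M"
  proof -
    have "add_pow F (order F) \<one>\<^bsub>F\<^esub> = \<zero>\<^bsub>F\<^esub>"
      using F.add.pow_order_eq_1[of "\<one>\<^bsub>F\<^esub>"] by (simp add: order_def)
    then have "\<pi> (add_pow R (order F) \<one>) = \<zero>\<^bsub>F\<^esub>" by (simp only: pi_add_pow one_closed h.hom_one)
    then show ?thesis by (simp only: o pi_zero add.nat_pow_closed one_closed)
  qed
  ultimately show thesis using that by blast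
qed

text \<open>The least positive integer whose multiple of the identity lies in \<open>M\<close> is
  prime, because a product of two units stays outside \<open>M\<close>.\<close>

lemma residue_char:
  obtains p :: nat where "Factorial_Ring.prime p" "add_pow R p \<one> \<in> M"
proof -
  obtain n :: nat where n: "n > 0 \<and> add_pow R n \<one> \<in> M" by (metis unit_exponent zero_less_Suc)
  define p :: nat where "p = (LEAST m. m > 0 \<and> add_pow R m \<one> \<in> M)"
  have p: "p > 0 \<and> add_pow R p \<one> \<in> M" 
    unfolding p_def by (rule LeastI[where P = "\<lambda>m. m > 0 \<and> add_pow R m \<one> \<in> M"]) (use n in blast)
  have least: "p \<le> m" if "m > 0" "add_pow R m \<one> \<in> M" for m :: nat
    unfolding p_def by (rule Least_le) (use that in simp)
  have "Factorial_Ring.prime p"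
  proof (unfold prime_nat_iff, intro conjI allI impI)
    show "1 < p" using p one_notin_M by (cases "p = 1") auto
    fix a assume "a dvd p"
    then obtain b where b: "p = a * b" by blast
    have "add_pow R a \<one> \<otimes> add_pow R b \<one> = add_pow R p \<one>"
      by (simp add: add_pow_ldistr b add.nat_pow_pow mult.commute)
    then have "add_pow R a \<one> \<otimes> add_pow R b \<one> \<in> M" using p by simp
    then have "add_pow R a \<one> \<in> M \<or> add_pow R b \<one> \<in> M"
      using Units_iff Units_m_closed by (metis add.nat_pow_closed one_closed)
    moreover have "a > 0" "b > 0" using p b by auto
    ultimately have "p \<le> a \<or> p \<le> b" using least by blast
    then show "a = 1 \<or> a = p" using b \<open>a > 0\<close> \<open>b > 0\<close> by (auto simp: mult_le_cancel1)
  qed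
  then show thesis using that p by blast
qed

end

section \<open>Functions with difference quotients in a pure subgroup\<close>

text \<open>\<open>V\<close> is any ideal killed by \<open>M\<close>, so that the locale can be
  entered from every quotient of the chain. The assumption \<open>pure\<close> is purity tested on
  the principal ideal of \<open>v\<close>.\<close>

locale pure_pair = finite_local_ring +
  fixes V K
  assumes V_ideal: "ideal V R"
    and V_sub_M: "V \<subseteq> M"
    and V_M: "v \<in> V \<Longrightarrow> r \<in> M \<Longrightarrow> r \<otimes> v = \<zero>"
    and K_Units: "K \<subseteq> Units R"
    and K_one: "\<one> \<in> K"
    and K_mult: "k \<in> K \<Longrightarrow> l \<in> K \<Longrightarrow> k \<otimes> l \<in> K"
    and K_inv: "k \<in> K \<Longrightarrow> inv k \<in> K"
    and pure: "v \<in> V \<Longrightarrow> (\<And>c. c \<in> carrier R \<Longrightarrow> \<one> \<oplus> c \<otimes> v \<in> K) \<Longrightarrow> v = \<zero>"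
begin

sublocale V: ideal V R by (rule V_ideal)

lemma V_carrier: "v \<in> V \<Longrightarrow> v \<in> carrier R" by (rule V.Icarr)
lemma K_carrier: "k \<in> K \<Longrightarrow> k \<in> carrier R" using K_Units by blast
lemma V_in_M: "v \<in> V \<Longrightarrow> v \<in> M" using V_sub_M by blast

lemma V_cong:
  assumes "a \<in> carrier R" "b \<in> carrier R" "a \<ominus> b \<in> M" "v \<in> V"
  shows "a \<otimes> v = b \<otimes> v"
proof -
  have v: "v \<in> carrier R" using assms V_carrier by simp
  have "a \<otimes> v = b \<otimes> v \<oplus> (a \<ominus> b) \<otimes> v" using assms(1,2) v by algebra
  then show ?thesis using assms v by (simp add: V_M)
qed

lemma V_M': "v \<in> V \<Longrightarrow> r \<in> M \<Longrightarrow> v \<otimes> r = \<zero>"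
  using V_M V_carrier M.Icarr m_comm by metis

definition U where "U = {u \<in> V. \<one> \<oplus> u \<in> K}"

definition scaled where "scaled c = (\<lambda>u. c \<otimes> u) ` U"

lemma U_V: "u \<in> U \<Longrightarrow> u \<in> V" by (simp add: U_def)
lemma U_carrier: "u \<in> U \<Longrightarrow> u \<in> carrier R" using U_V V_carrier by blast

lemma U_zero: "\<zero> \<in> U" by (simp add: U_def K_one)

text \<open>Products of two elements of \<open>V\<close> vanish, so \<open>u\<close> to
  \<open>1 + u\<close> turns addition in \<open>V\<close> into multiplication in \<open>R\<close>;
  \<open>U\<close> is a group because \<open>K\<close> is.\<close>

lemma U_add: assumes "u \<in> U" "w \<in> U" shows "u \<oplus> w \<in> U"
proof -
  have c: "u \<in> carrier R" "w \<in> carrier R" using assms U_carrier by auto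
  have "u \<otimes> w = \<zero>" using assms U_V V_in_M V_M by blast
  moreover have "(\<one> \<oplus> u) \<otimes> (\<one> \<oplus> w) = \<one> \<oplus> (u \<oplus> w) \<oplus> u \<otimes> w" using c by algebra
  ultimately have "\<one> \<oplus> (u \<oplus> w) = (\<one> \<oplus> u) \<otimes> (\<one> \<oplus> w)" using c by simp
  then show ?thesis using assms K_mult by (simp add: U_def)
qed

lemma U_neg: assumes "u \<in> U" shows "\<ominus> u \<in> U"
proof -
  have c: "u \<in> carrier R" using assms U_carrier by auto
  have "u \<otimes> u = \<zero>" using assms U_V V_in_M V_M by blast
  moreover have "(\<one> \<oplus> u) \<otimes> (\<one> \<oplus> \<ominus> u) = \<one> \<ominus> u \<otimes> u" using c by algebra
  ultimately have e: "(\<one> \<oplus> u) \<otimes> (\<one> \<oplus> \<ominus> u) = \<one>" using c by (simp add: a_minus_def)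
  have k: "\<one> \<oplus> u \<in> K" using assms by (simp add: U_def)
  have "inv (\<one> \<oplus> u) = \<one> \<oplus> \<ominus> u"
    using e c by (intro comm_inv_char) auto
  then show ?thesis using assms K_inv[OF k] by (simp add: U_def)
qed

lemma scaledE: "v \<in> scaled c \<Longrightarrow> (\<And>u. u \<in> U \<Longrightarrow> v = c \<otimes> u \<Longrightarrow> P) \<Longrightarrow> P"
  by (auto simp: scaled_def)

lemma scaledI: "u \<in> U \<Longrightarrow> c \<otimes> u \<in> scaled c"
  by (simp add: scaled_def)

lemma scaled_zero: "c \<in> carrier R \<Longrightarrow> \<zero> \<in> scaled c"
  using scaledI[OF U_zero, of c] by simp

lemma scaled_add:
  assumes "c \<in> carrier R" "v \<in> scaled c" "w \<in> scaled c" shows "v \<oplus> w \<in> scaled c"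
proof -
  obtain a b where "a \<in> U" "v = c \<otimes> a" "b \<in> U" "w = c \<otimes> b" using assms by (auto elim!: scaledE)
  then show ?thesis using assms(1) scaledI[OF U_add, of a b c] by (simp add: U_carrier r_distr)
qed

lemma scaled_neg:
  assumes "c \<in> carrier R" "v \<in> scaled c" shows "\<ominus> v \<in> scaled c"
proof -
  obtain a where "a \<in> U" "v = c \<otimes> a" using assms by (auto elim!: scaledE)
  then show ?thesis using assms(1) scaledI[OF U_neg, of a c] by (simp add: U_carrier r_minus)
qed

lemma scaled_minus:
  "c \<in> carrier R \<Longrightarrow> v \<in> scaled c \<Longrightarrow> w \<in> scaled c \<Longrightarrow> v \<ominus> w \<in> scaled c"
  by (simp add: a_minus_def scaled_add scaled_neg)

lemma scaled_one: "scaled \<one> = U"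
  using U_carrier by (force simp: scaled_def)

lemma scaled_cong:
  assumes "a \<in> carrier R" "b \<in> carrier R" "a \<ominus> b \<in> M"
  shows "scaled a = scaled b"
  unfolding scaled_def using V_cong[OF assms] U_V by (auto intro!: image_cong)

lemma scaled_M: assumes "c \<in> M" shows "scaled c = {\<zero>}"
proof -
  have "scaled c \<subseteq> {\<zero>}" using assms by (auto elim!: scaledE dest: U_V simp: V_M)
  then show ?thesis using scaled_zero M.Icarr[OF assms] by blast
qed

lemma scaled_mult:
  assumes "a \<in> carrier R" "c \<in> carrier R" "v \<in> scaled c" shows "a \<otimes> v \<in> scaled (a \<otimes> c)"
  using assms scaledI by (auto elim!: scaledE simp: U_carrier m_assoc[symmetric])

lemma scaled_div:
  assumes "a \<in> Units R" "c \<in> carrier R" "v \<in> scaled (a \<otimes> c)" shows "inv a \<otimes> v \<in> scaled c"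
  using scaled_mult[of "inv a" "a \<otimes> c" v] assms by (auto simp: Units_inv_cancel)

lemma scaled_one_div:
  assumes "c \<in> Units R" "v \<in> scaled c" shows "inv c \<otimes> v \<in> U"
  using scaled_div[of c \<one> v] assms by (auto simp: scaled_one)

lemma scaled_iff:
  assumes "c \<in> Units R" "v \<in> carrier R" shows "v \<in> scaled c \<longleftrightarrow> inv c \<otimes> v \<in> U"
proof
  assume "inv c \<otimes> v \<in> U"
  then show "v \<in> scaled c" using scaledI[of "inv c \<otimes> v" c] assms by (simp add: Units_inv_cancel)
qed (use assms scaled_one_div in auto)

text \<open>Scalars in \<open>M\<close> cost nothing, since they kill \<open>v\<close> and
  \<open>1\<close> lies in \<open>K\<close>; testing the units is enough.\<close>

lemma pure_mult:
  assumes v: "v \<in> V" and u: "\<And>c. c \<in> Units R \<Longrightarrow> c \<otimes> v \<in> U"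
  shows "v = \<zero>"
proof (rule pure[OF v])
  fix c assume c: "c \<in> carrier R"
  show "\<one> \<oplus> c \<otimes> v \<in> K"
  proof (cases "c \<in> M")
    case True then show ?thesis using v by (simp add: V_M K_one)
  next
    case False then show ?thesis using u[OF UnitsI] c by (simp add: U_def)
  qed
qed

lemma pure_scaled:
  assumes v: "v \<in> V" and u: "\<And>c. c \<in> Units R \<Longrightarrow> v \<in> scaled c"
  shows "v = \<zero>"
proof (rule pure_mult[OF v])
  fix c assume c: "c \<in> Units R"
  then have "inv (inv c) \<otimes> v \<in> U" using u[of "inv c"] by (intro scaled_one_div) auto
  then show "c \<otimes> v \<in> U" using c by simp
qed

text \<open>Functions on the residue field are modelled as functions on \<open>R\<close>: since \<open>scaled c = {0}\<close> for \<open>c\<close>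
  in \<open>M\<close>, the condition in \<open>unif\<close> forces \<open>m\<close> to be constant on the cosets of \<open>M\<close>.\<close>

definition unif where
  "unif m \<longleftrightarrow> m \<in> carrier R \<rightarrow> V \<and>
     (\<forall>x \<in> carrier R. \<forall>y \<in> carrier R. m x \<ominus> m y \<in> scaled (x \<ominus> y))"

text \<open>For a map satisfying \<open>unif\<close>, comparing the points 1 and 0 forces the slope
  into \<open>U\<close>, so asking for \<open>u\<close> in \<open>U\<close> loses nothing.\<close>

definition aff where
  "aff m \<longleftrightarrow> (\<exists>u \<in> U. \<forall>x \<in> carrier R. m x = m \<zero> \<oplus> x \<otimes> u)"

section \<open>Additive functions with difference quotients in \<open>U\<close> are linear\<close>

definition addv where
  "addv L \<longleftrightarrow> L \<in> carrier R \<rightarrow> V \<and>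
     (\<forall>x \<in> carrier R. \<forall>y \<in> carrier R. L (x \<oplus> y) = L x \<oplus> L y) \<and>
     (\<forall>x \<in> carrier R. L x \<in> scaled x)"

lemma addv_V: "addv L \<Longrightarrow> x \<in> carrier R \<Longrightarrow> L x \<in> V"
  by (auto simp: addv_def)

lemma addv_carrier: "addv L \<Longrightarrow> x \<in> carrier R \<Longrightarrow> L x \<in> carrier R"
  using addv_V V_carrier by blast

lemma addv_add: "addv L \<Longrightarrow> x \<in> carrier R \<Longrightarrow> y \<in> carrier R \<Longrightarrow> L (x \<oplus> y) = L x \<oplus> L y"
  by (simp add: addv_def)

lemma addv_scaled: "addv L \<Longrightarrow> x \<in> carrier R \<Longrightarrow> L x \<in> scaled x"
  by (simp add: addv_def)

lemma addv_M: "addv L \<Longrightarrow> r \<in> M \<Longrightarrow> L r = \<zero>"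
  using addv_scaled[of L r] scaled_M[of r] M.Icarr by auto

lemma addv_cong:
  assumes L: "addv L" and x: "x \<in> carrier R" "y \<in> carrier R" "x \<ominus> y \<in> M"
  shows "L x = L y"
proof -
  have "y \<oplus> (x \<ominus> y) = x" using x by algebra
  then have "L x = L y \<oplus> L (x \<ominus> y)" using addv_add[OF L, of y "x \<ominus> y"] x by simp
  then show ?thesis using addv_M[OF L x(3)] addv_carrier[OF L x(2)] by simp
qed

text \<open>This is \<open>(T - 1) L\<close>, where \<open>T\<close> conjugates \<open>L\<close> by
  multiplication with \<open>z\<close>; it vanishes exactly when \<open>L\<close> commutes with
  \<open>z\<close>. Conjugation keeps the value at \<open>x\<close> inside \<open>x U\<close>, so
  the defect is again of the same kind.\<close>

definition defect where
  "defect z L = (\<lambda>x. inv z \<otimes> L (z \<otimes> x) \<ominus> L x)"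

lemma addv_defect:
  assumes z: "z \<in> Units R" and L: "addv L"
  shows "addv (defect z L)"
proof -
  have zc: "z \<in> carrier R" "inv z \<in> carrier R" using z by auto
  have V: "inv z \<otimes> L (z \<otimes> x) \<ominus> L x \<in> V" if "x \<in> carrier R" for x
    using that zc L by (intro V.minus_closed V.I_l_closed addv_V[OF L]) auto
  have add: "inv z \<otimes> L (z \<otimes> (x \<oplus> y)) \<ominus> L (x \<oplus> y) =
      (inv z \<otimes> L (z \<otimes> x) \<ominus> L x) \<oplus> (inv z \<otimes> L (z \<otimes> y) \<ominus> L y)"
    if xy: "x \<in> carrier R" "y \<in> carrier R" for x y
  proof -
    have c: "L (z \<otimes> x) \<in> carrier R" "L (z \<otimes> y) \<in> carrier R" "L x \<in> carrier R" "L y \<in> carrier R"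
      using xy zc L by (auto intro!: addv_carrier[OF L])
    have e: "L (z \<otimes> (x \<oplus> y)) = L (z \<otimes> x) \<oplus> L (z \<otimes> y)" "L (x \<oplus> y) = L x \<oplus> L y"
      using xy zc L by (auto simp: r_distr addv_add[OF L])
    show ?thesis unfolding e using c zc by algebra
  qed
  have sc: "inv z \<otimes> L (z \<otimes> x) \<ominus> L x \<in> scaled x" if "x \<in> carrier R" for x
    using that z zc L by (intro scaled_minus scaled_div addv_scaled[OF L]) auto
  show ?thesis unfolding addv_def defect_def using V add sc by auto
qed

text \<open>The values of \<open>L\<close> at \<open>x\<close>, \<open>z x\<close> and \<open>(1 + z) x\<close> lie in \<open>x U\<close>, \<open>z x U\<close> and \<open>(1 + z) x U\<close>; with
  \<open>g = z / (1 + z)\<close>, additivity of \<open>L\<close> relates the three.\<close>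

lemma addv_smult_defect:
  assumes g: "g \<in> Units R" and h: "\<one> \<ominus> g \<in> Units R" and L: "addv L"
  defines "z \<equiv> g \<otimes> inv (\<one> \<ominus> g)"
  shows "addv (\<lambda>x. g \<otimes> defect z L x)"
proof -
  have c: "g \<in> carrier R" "inv (\<one> \<ominus> g) \<in> carrier R" using g h by auto
  have z: "z \<in> Units R" "z \<in> carrier R" "inv z \<in> carrier R" using g h unfolding z_def by auto
  note D = addv_defect[OF z(1) L]
  have i: "inv (\<one> \<ominus> g) \<otimes> (\<one> \<ominus> g) = \<one>" using h by simp
  have "z \<otimes> (\<one> \<ominus> g) = g \<otimes> (inv (\<one> \<ominus> g) \<otimes> (\<one> \<ominus> g))" unfolding z_def using c h by (simp add: m_assoc)
  then have zg: "z \<otimes> (\<one> \<ominus> g) = g" using i c by simp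
  have gz: "g \<otimes> inv z = \<one> \<ominus> g"
  proof -
    have "g \<otimes> inv z = (\<one> \<ominus> g) \<otimes> (z \<otimes> inv z)" using z c zg by (metis m_assoc m_comm Units_closed h)
    then show ?thesis using z h by auto
  qed
  have one: "(\<one> \<ominus> g) \<otimes> (\<one> \<oplus> z) = \<one>"
  proof -
    have "(\<one> \<ominus> g) \<otimes> (\<one> \<oplus> z) = (\<one> \<ominus> g) \<oplus> z \<otimes> (\<one> \<ominus> g)" using z c by algebra
    then show ?thesis unfolding zg using c by algebra
  qed
  have sc: "g \<otimes> defect z L x \<in> scaled x" if x: "x \<in> carrier R" for x
  proof -
    have l: "L (z \<otimes> x) \<in> carrier R" "L x \<in> carrier R" "L ((\<one> \<oplus> z) \<otimes> x) \<in> carrier R"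
      using x z L by (auto intro!: addv_carrier[OF L])
    have s: "L ((\<one> \<oplus> z) \<otimes> x) = L x \<oplus> L (z \<otimes> x)" using x z L by (simp add: l_distr addv_add[OF L])
    \<comment> \<open>Since \<open>1 - g\<close> is the inverse of \<open>1 + z\<close>, this
      computation says that \<open>g\<close> times the defect for \<open>z\<close> is the defect for
      \<open>1 + z\<close>.\<close>
    have "g \<otimes> defect z L x = (g \<otimes> inv z) \<otimes> L (z \<otimes> x) \<ominus> g \<otimes> L x"
      unfolding defect_def using z c l by algebra
    also have "\<dots> = (\<one> \<ominus> g) \<otimes> (L x \<oplus> L (z \<otimes> x)) \<ominus> L x"
      unfolding gz using c l by algebra
    also have "\<dots> = (\<one> \<ominus> g) \<otimes> L ((\<one> \<oplus> z) \<otimes> x) \<ominus> L x" by (simp add: s)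
    finally have e: "g \<otimes> defect z L x = (\<one> \<ominus> g) \<otimes> L ((\<one> \<oplus> z) \<otimes> x) \<ominus> L x" .
    have "(\<one> \<ominus> g) \<otimes> ((\<one> \<oplus> z) \<otimes> x) = x" using one c z x by (simp add: m_assoc[symmetric])
    then have "(\<one> \<ominus> g) \<otimes> L ((\<one> \<oplus> z) \<otimes> x) \<in> scaled x"
      using scaled_mult[of "\<one> \<ominus> g" "(\<one> \<oplus> z) \<otimes> x", OF _ _ addv_scaled[OF L]] c z x by simp
    then show ?thesis unfolding e using x L by (intro scaled_minus addv_scaled[OF L]) auto
  qed
  show ?thesis unfolding addv_def
    using D c sc by (auto intro!: V.I_l_closed addv_V[OF D] simp: addv_add[OF D] addv_carrier[OF D] r_distr)
qed

lemma defect_smult: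
  assumes z: "z \<in> Units R" and L: "addv L" and c: "c \<in> carrier R" and x: "x \<in> carrier R"
  shows "defect z (\<lambda>x. c \<otimes> L x) x = c \<otimes> defect z L x"
proof -
  have "L (z \<otimes> x) \<in> carrier R" "L x \<in> carrier R" "inv z \<in> carrier R"
    using L x z by (auto intro!: addv_carrier[OF L])
  then show ?thesis unfolding defect_def using c by algebra
qed

lemma addv_ext: "addv L \<Longrightarrow> (\<And>x. x \<in> carrier R \<Longrightarrow> L' x = L x) \<Longrightarrow> addv L'"
  unfolding addv_def by (auto simp: Pi_iff)

text \<open>Each defect can absorb one factor \<open>g\<close>, and scaling commutes with taking
  defects. So \<open>k\<close> defects provide every power \<open>g^i\<close> with
  \<open>i <= k\<close> in front of the same function: this is how different scales arise from a
  single \<open>L\<close>.\<close>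

lemma addv_power_defect:
  assumes g: "g \<in> Units R" and h: "\<one> \<ominus> g \<in> Units R" and L: "addv L" and ik: "i \<le> k"
  defines "z \<equiv> g \<otimes> inv (\<one> \<ominus> g)"
  shows "addv (\<lambda>x. g [^] (i::nat) \<otimes> (defect z ^^ k) L x)"
  using ik
proof (induction k arbitrary: i)
  case 0
  then show ?case by (auto intro!: addv_ext[OF L] simp: addv_carrier[OF L])
next
  case (Suc k)
  have z: "z \<in> Units R" unfolding z_def using g h by auto
  have c: "g \<in> carrier R" using g by auto
  have D: "addv ((defect z ^^ k) L)" for k
    by (induction k) (auto intro: L addv_defect[OF z])
  show ?case
  proof (cases i)
    case 0
    with addv_carrier[OF D[of "Suc k"]] show ?thesis
      by (intro addv_ext[OF D[of "Suc k"]]) simp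
  next
    case (Suc j)
    then have j: "j \<le> k" using Suc.prems by simp
    have "addv (\<lambda>x. g \<otimes> defect z (\<lambda>x. g [^] j \<otimes> (defect z ^^ k) L x) x)"
      unfolding z_def by (rule addv_smult_defect[OF g h]) (use Suc.IH[OF j] in \<open>simp add: z_def\<close>)
    moreover have "g [^] i \<otimes> (defect z ^^ Suc k) L x = g \<otimes> defect z (\<lambda>x. g [^] j \<otimes> (defect z ^^ k) L x) x"
      if x: "x \<in> carrier R" for x
    proof -
      have d: "defect z ((defect z ^^ k) L) x \<in> carrier R"
        using addv_carrier[OF D[of "Suc k"] x] by simp
      have "defect z (\<lambda>x. g [^] j \<otimes> (defect z ^^ k) L x) x = g [^] j \<otimes> defect z ((defect z ^^ k) L) x"
        by (rule defect_smult[OF z D _ x]) (use c in simp)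
      then show ?thesis using Suc c d by (simp add: m_assoc[symmetric] m_comm)
    qed
    ultimately show ?thesis by (rule addv_ext)
  qed
qed

text \<open>A unipotent operator of order prime to the characteristic is trivial. If
  \<open>(T - 1)^2 L = 0\<close> and \<open>D = (T - 1) L\<close>, then
  \<open>T^n L = L + n D\<close>. For the \<open>n\<close> of \<open>unit_exponent\<close>,
  \<open>z^n\<close> is 1 modulo \<open>M\<close>, so \<open>n D = 0\<close>; but \<open>n\<close>
  acts as -1 on \<open>V\<close>, so \<open>D = 0\<close>.\<close>

lemma defect_twice:
  assumes z: "z \<in> Units R" and L: "addv L"
    and dd: "\<And>x. x \<in> carrier R \<Longrightarrow> defect z (defect z L) x = \<zero>"
    and x: "x \<in> carrier R"
  shows "defect z L x = \<zero>"
proof -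
  have zc: "z \<in> carrier R" "inv z \<in> carrier R" using z by auto
  define D where "D = defect z L"
  have DL: "addv D" unfolding D_def by (rule addv_defect[OF z L])
  have zi: "z \<otimes> (inv z \<otimes> y) = y" if "y \<in> carrier R" for y using z that by (simp add: Units_inv_cancel)
  have Dz: "D (z \<otimes> y) = z \<otimes> D y" if y: "y \<in> carrier R" for y
  proof -
    have c: "D (z \<otimes> y) \<in> carrier R" "D y \<in> carrier R" using y zc by (auto intro!: addv_carrier[OF DL])
    have "inv z \<otimes> D (z \<otimes> y) \<ominus> D y = \<zero>" using dd[OF y] unfolding D_def[symmetric] by (simp add: defect_def)
    then have "inv z \<otimes> D (z \<otimes> y) = D y" using c zc by simp
    then show ?thesis using zi[OF c(1)] by simp
  qed
  have Lz: "L (z \<otimes> y) = z \<otimes> (L y \<oplus> D y)" if y: "y \<in> carrier R" for y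
  proof -
    have c: "L (z \<otimes> y) \<in> carrier R" "L y \<in> carrier R" using y zc by (auto intro!: addv_carrier[OF L])
    have "L y \<oplus> D y = inv z \<otimes> L (z \<otimes> y)" unfolding D_def defect_def using c zc by algebra
    then show ?thesis using zi[OF c(1)] by simp
  qed
  have c: "L x \<in> carrier R" "D x \<in> carrier R" using x by (auto intro!: addv_carrier[OF L] addv_carrier[OF DL])
  have Dn: "D (z [^] (n::nat) \<otimes> x) = z [^] n \<otimes> D x" for n
  proof (induction n)
    case (Suc n)
    have "z [^] Suc n \<otimes> x = z \<otimes> (z [^] n \<otimes> x)" using zc x by (simp add: m_ac)
    then show ?case using Suc Dz[of "z [^] n \<otimes> x"] zc x c by (simp add: m_ac)
  qed (use x c in simp)
  have Ln: "L (z [^] (n::nat) \<otimes> x) = z [^] n \<otimes> (L x \<oplus> add_pow R n \<one> \<otimes> D x)" for n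
  proof (induction n)
    case (Suc n)
    have p: "z [^] n \<in> carrier R" "add_pow R n \<one> \<in> carrier R" using zc by auto
    have "L (z [^] Suc n \<otimes> x) = z \<otimes> (L (z [^] n \<otimes> x) \<oplus> D (z [^] n \<otimes> x))"
      using Lz[of "z [^] n \<otimes> x"] zc x by (simp add: m_ac)
    also have "\<dots> = z \<otimes> (z [^] n \<otimes> (L x \<oplus> add_pow R n \<one> \<otimes> D x) \<oplus> z [^] n \<otimes> D x)"
      by (simp add: Suc Dn)
    also have "\<dots> = z [^] n \<otimes> z \<otimes> (L x \<oplus> (add_pow R n \<one> \<oplus> \<one>) \<otimes> D x)"
      using p zc c by algebra
    finally show ?case by simp
  qed (use x c in simp)
  obtain n :: nat where n: "z [^] n \<ominus> \<one> \<in> M" "add_pow R (Suc n) \<one> \<in> M"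
    using unit_exponent z by metis
  define N where "N = add_pow R n \<one>"
  have Nc: "N \<in> carrier R" by (simp add: N_def)
  have "z [^] n \<otimes> x \<ominus> x = (z [^] n \<ominus> \<one>) \<otimes> x"
    using zc x nat_pow_closed[OF zc(1)] by (simp add: l_distr a_minus_def l_minus)
  then have "z [^] n \<otimes> x \<ominus> x \<in> M" using n x by (simp add: M.I_r_closed)
  then have "L x = L (z [^] n \<otimes> x)" using addv_cong[OF L, of "z [^] n \<otimes> x" x] zc x by simp
  also have "\<dots> = z [^] n \<otimes> (L x \<oplus> N \<otimes> D x)" by (simp add: Ln N_def)
  also have "\<dots> = \<one> \<otimes> (L x \<oplus> N \<otimes> D x)"
    using n zc x by (intro V_cong V.a_closed V.I_l_closed addv_V[OF L] addv_V[OF DL]) (auto simp: N_def)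
  finally have "L x = L x \<oplus> N \<otimes> D x" using c Nc by simp
  then have "N \<otimes> D x = \<zero>" using c Nc by simp
  moreover have "(N \<oplus> \<one>) \<otimes> D x = \<zero>"
    using n(2) x by (intro V_M addv_V[OF DL]) (auto simp: N_def)
  ultimately have "D x = \<zero>" using c Nc by (simp add: l_distr)
  then show ?thesis by (simp add: D_def)
qed

text \<open>The \<open>N\<close>-fold defect of \<open>L\<close> can be scaled by a representative
  of every unit, so purity kills it; \<open>defect_twice\<close> then reduces the number of defects
  to one. Thus \<open>L\<close> commutes with \<open>z = g / (1 - g)\<close>, hence with
  \<open>g\<close>, and is determined by its value at 1.\<close>

lemma addv_linear:
  assumes L: "addv L"
  shows "\<exists>u\<in>U. \<forall>x\<in>carrier R. L x = x \<otimes> u"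
proof -
  obtain g and N :: nat where g: "g \<in> Units R"
    and gen: "\<And>c. c \<in> Units R \<Longrightarrow> \<exists>i\<le>N. c \<ominus> g [^] i \<in> M" using unit_generator by blast
  have gc: "g \<in> carrier R" using g by auto
  have Lg: "L (g \<otimes> x) = g \<otimes> L x" if x: "x \<in> carrier R" for x
  proof (cases "\<one> \<ominus> g \<in> M")
    \<comment> \<open>Here \<open>z\<close> cannot be formed, but \<open>g\<close> is 1 modulo
      \<open>M\<close> and \<open>L\<close> ignores \<open>M\<close>.\<close>
    case True
    have "x \<ominus> g \<otimes> x = (\<one> \<ominus> g) \<otimes> x" using gc x by algebra
    then have "x \<ominus> g \<otimes> x \<in> M" using True x by (simp add: M.I_r_closed)
    then have "L (g \<otimes> x) = \<one> \<otimes> L x" using addv_cong[OF L, of x "g \<otimes> x"] addv_carrier[OF L x] gc x by simp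
    then show ?thesis using V_cong[OF one_closed gc True addv_V[OF L x]] by simp
  next
    case False
    then have h: "\<one> \<ominus> g \<in> Units R" using gc by (auto intro: UnitsI)
    define z where "z = g \<otimes> inv (\<one> \<ominus> g)"
    have z: "z \<in> Units R" "z \<in> carrier R" unfolding z_def using g h by auto
    have D: "addv ((defect z ^^ k) L)" for k
      by (induction k) (auto intro: L addv_defect[OF z(1)])
    have DN: "(defect z ^^ N) L y = \<zero>" if y: "y \<in> carrier R" for y
    proof (cases "y \<in> M")
      case True then show ?thesis by (rule addv_M[OF D])
    next
      case False
      then have yu: "y \<in> Units R" and yc: "inv y \<in> carrier R" using y UnitsI by auto
      define w where "w = (defect z ^^ N) L y"
      have w: "w \<in> V" "w \<in> carrier R" unfolding w_def using addv_V[OF D y] addv_carrier[OF D y] by auto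
      \<comment> \<open>The vector tested is \<open>w / y\<close>, because the value at
        \<open>y\<close> is only known to lie in \<open>y U\<close>. Every unit \<open>c\<close>
        agrees modulo \<open>M\<close> with some \<open>g^i\<close>, \<open>i <= N\<close>, and
        therefore acts on \<open>w\<close> as that power does.\<close>
      have "inv y \<otimes> w = \<zero>"
      proof (rule pure_mult)
        show "inv y \<otimes> w \<in> V" using w yc by (simp add: V.I_l_closed)
        fix c assume c: "c \<in> Units R"
        obtain i where i: "i \<le> N" "c \<ominus> g [^] i \<in> M" using gen[OF c] by blast
        have "addv (\<lambda>x. g [^] i \<otimes> (defect z ^^ N) L x)"
          unfolding z_def by (rule addv_power_defect[OF g h L i(1)])
        from addv_scaled[OF this y] have "inv y \<otimes> (g [^] i \<otimes> w) \<in> U"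
          using scaled_one_div[OF yu] by (simp add: w_def)
        moreover have "c \<otimes> w = g [^] i \<otimes> w" using i w c gc by (intro V_cong) auto
        moreover have "c \<otimes> (inv y \<otimes> w) = inv y \<otimes> (c \<otimes> w)" using c yc w by (simp add: m_lcomm Units_closed)
        ultimately show "c \<otimes> (inv y \<otimes> w) \<in> U" by simp
      qed
      then have "y \<otimes> (inv y \<otimes> w) = y \<otimes> \<zero>" by simp
      then show ?thesis using yu w y by (simp add: Units_inv_cancel w_def)
    qed
    have descend: "defect z L y = \<zero>"
      if "\<And>y. y \<in> carrier R \<Longrightarrow> (defect z ^^ Suc k) L y = \<zero>" "y \<in> carrier R" for k y
      using that
    proof (induction k)
      case (Suc k)
      have "(defect z ^^ Suc k) L y = \<zero>" if "y \<in> carrier R" for y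
        using defect_twice[OF z(1) D[of k] _ that] Suc.prems(1) by simp
      then show ?case using Suc.IH Suc.prems(2) by blast
    qed simp
    \<comment> \<open>\<open>descend\<close> starts from a positive number of defects, and nothing
      so far says that \<open>N\<close> is positive.\<close>
    have DS: "(defect z ^^ Suc N) L y = \<zero>" if "y \<in> carrier R" for y
      using DN[of y] DN[of "z \<otimes> y"] that z by (simp add: defect_def)
    have Lz: "L (z \<otimes> y) = z \<otimes> L y" if y: "y \<in> carrier R" for y
    proof -
      have c: "L (z \<otimes> y) \<in> carrier R" "L y \<in> carrier R" using addv_carrier[OF L] y z by auto
      have "inv z \<otimes> L (z \<otimes> y) \<ominus> L y = \<zero>" using descend[OF DS y] by (simp add: defect_def)
      then have "inv z \<otimes> L (z \<otimes> y) = L y" using c z by simp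
      then show ?thesis using Units_inv_cancel(2)[OF z(1) c(1)] by simp
    qed
    \<comment> \<open>With this \<open>y\<close> one has \<open>z y = g x\<close> and
      \<open>y + z y = x\<close>, so commuting with \<open>z\<close> at \<open>y\<close> becomes
      commuting with \<open>g\<close> at \<open>x\<close>.\<close>
    define y where "y = (\<one> \<ominus> g) \<otimes> x"
    have y: "y \<in> carrier R" unfolding y_def using gc x by simp
    have i: "(\<one> \<ominus> g) \<otimes> inv (\<one> \<ominus> g) = \<one>" using h by simp
    have ic: "inv (\<one> \<ominus> g) \<in> carrier R" using h by simp
    have zy: "z \<otimes> y = g \<otimes> x"
    proof -
      have "z \<otimes> y = g \<otimes> ((\<one> \<ominus> g) \<otimes> inv (\<one> \<ominus> g)) \<otimes> x" unfolding z_def y_def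
        using gc x ic Units_closed[OF h] by (simp add: m_ac)
      then show ?thesis unfolding i using gc x by simp
    qed
    have "y \<oplus> g \<otimes> x = x" unfolding y_def using gc x by algebra
    then have Lx: "L x = L y \<oplus> z \<otimes> L y"
      using addv_add[OF L, of y "g \<otimes> x"] Lz[OF y] zy gc x y by simp
    have c: "L y \<in> carrier R" using addv_carrier[OF L y] .
    have zg: "z \<otimes> (\<one> \<ominus> g) = g"
    proof -
      have "z \<otimes> (\<one> \<ominus> g) = g \<otimes> ((\<one> \<ominus> g) \<otimes> inv (\<one> \<ominus> g))" unfolding z_def
        using gc ic Units_closed[OF h] by (simp add: m_ac)
      then show ?thesis unfolding i using gc by simp
    qed
    have "g \<otimes> L x = g \<otimes> L y \<oplus> z \<otimes> (g \<otimes> L y)" unfolding Lx using gc z c by algebra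
    also have "\<dots> = (z \<otimes> (\<one> \<ominus> g)) \<otimes> L y \<oplus> z \<otimes> (g \<otimes> L y)" by (simp add: zg)
    also have "\<dots> = z \<otimes> L y" using z gc c by algebra
    finally show ?thesis using Lz[OF y] zy by simp
  qed
  have Lgn: "L (g [^] (i::nat)) = g [^] i \<otimes> L \<one>" for i
  proof (induction i)
    case (Suc i)
    have "L (g [^] Suc i) = g \<otimes> L (g [^] i)" using Lg[of "g [^] i"] gc by (simp add: m_comm)
    then show ?case using Suc gc addv_carrier[OF L one_closed] by (simp add: m_ac)
  qed (use addv_carrier[OF L] in simp)
  have "L x = x \<otimes> L \<one>" if x: "x \<in> carrier R" for x
  proof (cases "x \<in> M")
    case True then show ?thesis using addv_M[OF L True] addv_V[OF L one_closed] by (simp add: V_M)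
  next
    case False
    then obtain i :: nat where i: "x \<ominus> g [^] i \<in> M" using gen x UnitsI by blast
    then have "L x = g [^] i \<otimes> L \<one>" using addv_cong[OF L x _ i] gc Lgn by simp
    also have "\<dots> = x \<otimes> L \<one>" using V_cong[OF x _ i addv_V[OF L one_closed]] gc by simp
    finally show ?thesis .
  qed
  moreover have "L \<one> \<in> U" using addv_scaled[OF L one_closed] by (simp add: scaled_one)
  ultimately show ?thesis by blast
qed

section \<open>Finite differences and the reduction to additive functions\<close>

definition diff where "diff c m = (\<lambda>x. m (x \<oplus> c) \<ominus> m x)"

lemma diff_pow_closed:
  assumes "m \<in> carrier R \<rightarrow> carrier R" "c \<in> carrier R"
  shows "(diff c ^^ k) m \<in> carrier R \<rightarrow> carrier R"
  using assms by (induction k) (auto simp: diff_def)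

text \<open>Newton's forward difference formula. The induction hypothesis is used for
  \<open>m\<close> and for \<open>diff c m\<close>, which is why \<open>m\<close> is arbitrary;
  Pascal's rule joins the two sums.\<close>

lemma newton_expansion:
  assumes c: "c \<in> carrier R"
  shows "m \<in> carrier R \<rightarrow> carrier R \<Longrightarrow> x \<in> carrier R \<Longrightarrow>
    m (x \<oplus> add_pow R n c) = (\<Oplus>k\<in>{..n}. add_pow R (n choose k) ((diff c ^^ k) m x))"
proof (induction n arbitrary: m)
  case 0
  then have "m x \<in> carrier R" by auto
  then show ?case using 0 by simp
next
  case (Suc n)
  define a where "a k = (diff c ^^ k) m x" for k
  have ac: "a k \<in> carrier R" for k
    unfolding a_def using diff_pow_closed[OF Suc.prems(1) c] Suc.prems(2) by blast
  have d: "diff c m \<in> carrier R \<rightarrow> carrier R" using diff_pow_closed[OF Suc.prems(1) c, of 1] by simp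
  have y: "x \<oplus> add_pow R n c \<in> carrier R" using c Suc.prems by simp
  have my: "m (x \<oplus> add_pow R n c) \<in> carrier R" "m (x \<oplus> add_pow R n c \<oplus> c) \<in> carrier R"
    using Suc.prems y c by auto
  have "m (x \<oplus> add_pow R (Suc n) c) = m (x \<oplus> add_pow R n c \<oplus> c)"
    using c Suc.prems by (simp add: a_assoc)
  also have "\<dots> = diff c m (x \<oplus> add_pow R n c) \<oplus> m (x \<oplus> add_pow R n c)"
    unfolding diff_def using my by algebra
  also have "\<dots> = (\<Oplus>k\<in>{..n}. add_pow R (n choose k) (a (Suc k))) \<oplus> (\<Oplus>k\<in>{..n}. add_pow R (n choose k) (a k))"
    using Suc.IH[OF d Suc.prems(2)] Suc.IH[OF Suc.prems] by (simp add: a_def funpow_swap1)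
  \<comment> \<open>The added term has a zero binomial coefficient; it makes the range match after
    splitting off \<open>k = 0\<close>.\<close>
  also have "(\<Oplus>k\<in>{..n}. add_pow R (n choose k) (a k)) = (\<Oplus>k\<in>{..Suc n}. add_pow R (n choose k) (a k))"
    using ac by (simp add: binomial_eq_0)
  also have "\<dots> = (\<Oplus>k\<in>{..n}. add_pow R (n choose Suc k) (a (Suc k))) \<oplus> a 0"
    by (subst finsum_Suc2) (use ac in auto)
  also have "(\<Oplus>k\<in>{..n}. add_pow R (n choose k) (a (Suc k))) \<oplus>
      ((\<Oplus>k\<in>{..n}. add_pow R (n choose Suc k) (a (Suc k))) \<oplus> a 0) =
      ((\<Oplus>k\<in>{..n}. add_pow R (n choose k) (a (Suc k))) \<oplus>
      (\<Oplus>k\<in>{..n}. add_pow R (n choose Suc k) (a (Suc k)))) \<oplus> a 0"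
    by (subst a_assoc) (use ac in \<open>auto intro!: finsum_closed\<close>)
  also have "(\<Oplus>k\<in>{..n}. add_pow R (n choose k) (a (Suc k))) \<oplus>
      (\<Oplus>k\<in>{..n}. add_pow R (n choose Suc k) (a (Suc k))) =
      (\<Oplus>k\<in>{..n}. add_pow R (Suc n choose Suc k) (a (Suc k)))"
    by (subst finsum_addf[symmetric]) (use ac in \<open>auto simp: add.nat_pow_mult\<close>)
  also have "\<dots> \<oplus> a 0 = (\<Oplus>k\<in>{..Suc n}. add_pow R (Suc n choose k) (a k))"
    by (subst finsum_Suc2) (use ac in auto)
  finally show ?case unfolding a_def .
qed

lemma unif_V: "unif m \<Longrightarrow> x \<in> carrier R \<Longrightarrow> m x \<in> V"
  by (auto simp: unif_def)

lemma unif_carrier: "unif m \<Longrightarrow> x \<in> carrier R \<Longrightarrow> m x \<in> carrier R"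
  using unif_V V_carrier by blast

lemma unif_scaled: "unif m \<Longrightarrow> x \<in> carrier R \<Longrightarrow> y \<in> carrier R \<Longrightarrow> m x \<ominus> m y \<in> scaled (x \<ominus> y)"
  by (auto simp: unif_def)

lemma unif_cong:
  assumes "unif m" "x \<in> carrier R" "y \<in> carrier R" "x \<ominus> y \<in> M"
  shows "m x = m y"
proof -
  have "m x \<ominus> m y = \<zero>" using unif_scaled[OF assms(1-3)] scaled_M[OF assms(4)] by simp
  then show ?thesis using unif_carrier[OF assms(1)] assms by simp
qed

lemma unif_diff:
  assumes m: "unif m" and c: "c \<in> carrier R"
  shows "unif (diff c m)"
  unfolding unif_def
proof (intro conjI ballI)
  show "diff c m \<in> carrier R \<rightarrow> V" unfolding diff_def using unif_V[OF m] c by (auto intro!: V.minus_closed)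
  fix x y assume x: "x \<in> carrier R" and y: "y \<in> carrier R"
  have cl: "m x \<in> carrier R" "m y \<in> carrier R" "m (x \<oplus> c) \<in> carrier R" "m (y \<oplus> c) \<in> carrier R"
    using unif_carrier[OF m] x y c by auto
  have e: "diff c m x \<ominus> diff c m y = (m (x \<oplus> c) \<ominus> m (y \<oplus> c)) \<ominus> (m x \<ominus> m y)"
    unfolding diff_def using cl by algebra
  have e': "(x \<oplus> c) \<ominus> (y \<oplus> c) = x \<ominus> y" using x y c by algebra
  have "m (x \<oplus> c) \<ominus> m (y \<oplus> c) \<in> scaled (x \<ominus> y)" using unif_scaled[OF m, of "x \<oplus> c" "y \<oplus> c"] x y c e' by simp
  then show "diff c m x \<ominus> diff c m y \<in> scaled (x \<ominus> y)"
    unfolding e by (rule scaled_minus[OF minus_closed[OF x y] _ unif_scaled[OF m x y]])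
qed

lemma unif_diff_pow: "unif m \<Longrightarrow> c \<in> carrier R \<Longrightarrow> unif ((diff c ^^ k) m)"
  by (induction k) (auto intro: unif_diff)

text \<open>If \<open>T\<close> is translation by \<open>c\<close>, then
  \<open>(T - 1)^p = T^p - 1\<close> on functions into \<open>V\<close>, which \<open>p\<close>
  kills: the middle binomial coefficients are divisible by \<open>p\<close>. Moreover
  \<open>T^p\<close> is the identity, since \<open>p c\<close> lies in \<open>M\<close> and
  \<open>m\<close> is constant on cosets of \<open>M\<close>.\<close>

lemma diff_nilpotent:
  assumes p: "Factorial_Ring.prime p" "add_pow R p \<one> \<in> M"
    and m: "unif m" and c: "c \<in> carrier R" and x: "x \<in> carrier R"
  shows "(diff c ^^ p) m x = \<zero>"
proof -
  have mc: "m \<in> carrier R \<rightarrow> carrier R" using unif_carrier[OF m] by auto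
  define a where "a k = (diff c ^^ k) m x" for k
  have aV: "a k \<in> V" for k unfolding a_def using unif_V[OF unif_diff_pow[OF m c] x] .
  have ac: "a k \<in> carrier R" for k using aV V_carrier by blast
  have p0: "add_pow R p v = \<zero>" if v: "v \<in> V" for v
  proof -
    have "add_pow R p v = add_pow R p \<one> \<otimes> v" using V_carrier[OF v] by (simp add: add_pow_ldistr)
    then show ?thesis using V_M[OF v p(2)] by simp
  qed
  have mid: "add_pow R (p choose k) (a k) = \<zero>" if "0 < k" "k < p" for k
  proof -
    have "p dvd (p choose k)" by (rule dvd_choose_prime) (use that p(1) in auto)
    then obtain j where "p choose k = p * j" by blast
    then have "add_pow R (p choose k) (a k) = add_pow R j (add_pow R p (a k))"
      using ac by (simp add: add.nat_pow_pow mult.commute)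
    then show ?thesis using p0[OF aV] by simp
  qed
  obtain q where q: "p = Suc q" using p(1) prime_gt_0_nat by (cases p) auto
  have "m x = m (x \<oplus> add_pow R p c)"
  proof (rule unif_cong[OF m x])
    have "x \<ominus> (x \<oplus> add_pow R p c) = \<ominus> (add_pow R p \<one> \<otimes> c)"
    proof -
      have "add_pow R p c = add_pow R p \<one> \<otimes> c" using c by (simp add: add_pow_ldistr)
      moreover have "add_pow R p \<one> \<in> carrier R" by simp
      ultimately show ?thesis using c x by algebra
    qed
    then show "x \<ominus> (x \<oplus> add_pow R p c) \<in> M" using p(2) c by (simp add: M.I_r_closed)
  qed (use x c in auto)
  also have "\<dots> = (\<Oplus>k\<in>{..p}. add_pow R (p choose k) (a k))"
    unfolding a_def by (rule newton_expansion[OF c mc x])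
  also have "\<dots> = (\<Oplus>k\<in>{..p}. if k = 0 then a 0 else if k = p then a p else \<zero>)"
  proof (rule add.finprod_cong')
    fix k assume "k \<in> {..p}"
    then show "add_pow R (p choose k) (a k) = (if k = 0 then a 0 else if k = p then a p else \<zero>)"
      using mid[of k] ac q by (cases "k = 0"; cases "k = p") auto
  qed (use ac in auto)
  also have "\<dots> = a p \<oplus> (\<Oplus>k\<in>{..q}. if k = 0 then a 0 else if k = p then a p else \<zero>)"
    unfolding q by (subst finsum_Suc) (use ac in auto)
  also have "(\<Oplus>k\<in>{..q}. if k = 0 then a 0 else if k = p then a p else \<zero>) =
      (\<Oplus>k\<in>{..q}. if 0 = k then a k else \<zero>)"
    by (rule add.finprod_cong') (use ac q in auto)
  also have "\<dots> = a 0" by (subst add.finprod_singleton) (use ac in auto)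
  also have "a 0 = m x" by (simp add: a_def)
  finally have "m x = a p \<oplus> m x" .
  then have "a p = \<zero>" using ac[of p] unif_carrier[OF m x] by simp
  then show ?thesis by (simp add: a_def)
qed

lemma aff_ext: "aff m \<Longrightarrow> (\<And>x. x \<in> carrier R \<Longrightarrow> m' x = m x) \<Longrightarrow> aff m'"
  by (auto simp: aff_def)

lemma aff_diff:
  assumes m: "unif m" and a: "aff m" and c: "c \<in> carrier R"
  shows "aff (diff c m)"
proof -
  obtain u where u: "u \<in> U" "\<And>x. x \<in> carrier R \<Longrightarrow> m x = m \<zero> \<oplus> x \<otimes> u" using a by (auto simp: aff_def)
  have uc: "u \<in> carrier R" using u U_carrier by auto
  have m0: "m \<zero> \<in> carrier R" using unif_carrier[OF m] by simp
  have "diff c m x = c \<otimes> u" if x: "x \<in> carrier R" for x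
  proof -
    have "diff c m x = (m \<zero> \<oplus> (x \<oplus> c) \<otimes> u) \<ominus> (m \<zero> \<oplus> x \<otimes> u)"
      unfolding diff_def using u(2)[of x] u(2)[of "x \<oplus> c"] x c by simp
    then show ?thesis using uc m0 x c by algebra
  qed
  then show ?thesis unfolding aff_def using U_zero c uc by (intro bexI[of _ \<zero>]) auto
qed

lemma aff_diff_pow: "unif m \<Longrightarrow> aff m \<Longrightarrow> c \<in> carrier R \<Longrightarrow> aff ((diff c ^^ k) m)"
  by (induction k) (auto intro: aff_diff unif_diff_pow)

lemma diff_commute:
  assumes m: "unif m" and c: "c \<in> carrier R" and d: "d \<in> carrier R"
  shows "x \<in> carrier R \<Longrightarrow> diff d ((diff c ^^ k) m) x = (diff c ^^ k) (diff d m) x"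
proof (induction k arbitrary: x)
  case (Suc k)
  define h where "h = (diff c ^^ k) m"
  have h: "unif h" unfolding h_def by (rule unif_diff_pow[OF m c])
  have x: "x \<in> carrier R" by fact
  have cl: "h x \<in> carrier R" "h (x \<oplus> c) \<in> carrier R" "h (x \<oplus> d) \<in> carrier R" "h (x \<oplus> c \<oplus> d) \<in> carrier R"
    using unif_carrier[OF h] x c d by auto
  have "x \<oplus> d \<oplus> c = x \<oplus> c \<oplus> d" using x c d by algebra
  then have "diff d (diff c h) x = diff d h (x \<oplus> c) \<ominus> diff d h x"
    unfolding diff_def using cl by (simp only:) algebra
  also have "\<dots> = (diff c ^^ Suc k) (diff d m) x"
    using Suc.IH[of x] Suc.IH[of "x \<oplus> c"] x c
    by (simp add: h_def diff_def[of c "(diff c ^^ k) (diff d m)"])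
  finally show ?case by (simp add: h_def)
qed simp

text \<open>A minimal counterexample, built one shift at a time: apply \<open>diff c\<close> as long
  as the result is not affine, which must stop because the \<open>p\<close>-th difference is zero.
  The last non-affine function has affine difference in direction \<open>c\<close>, and differences
  in the earlier directions stay affine because difference operators commute.\<close>

lemma exists_nonaff_all_diff_aff:
  assumes "finite C" "C \<subseteq> carrier R" "unif m" "\<not> aff m"
  shows "\<exists>m'. unif m' \<and> \<not> aff m' \<and> (\<forall>c\<in>C. aff (diff c m'))"
  using assms
proof (induction C)
  case (insert c C)
  obtain m1 where m1: "unif m1" "\<not> aff m1" "\<forall>c\<in>C. aff (diff c m1)" using insert by auto
  have c: "c \<in> carrier R" using insert by simp
  obtain p :: nat where p: "Factorial_Ring.prime p" "add_pow R p \<one> \<in> M" using residue_char by blast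
  have "aff ((diff c ^^ p) m1)"
    unfolding aff_def using diff_nilpotent[OF p m1(1) c] U_zero by (intro bexI[of _ \<zero>]) auto
  then have ex: "\<exists>k. aff ((diff c ^^ k) m1)" by blast
  define k where "k = (LEAST k. aff ((diff c ^^ k) m1))"
  have k: "aff ((diff c ^^ k) m1)" unfolding k_def using ex by (rule LeastI_ex)
  then obtain j where j: "k = Suc j" using m1(2) by (cases k) auto
  have nj: "\<not> aff ((diff c ^^ j) m1)"
    using not_less_Least[of j "\<lambda>k. aff ((diff c ^^ k) m1)"] j unfolding k_def by simp
  have "aff (diff d ((diff c ^^ j) m1))" if d: "d \<in> C" for d
  proof -
    have dc: "d \<in> carrier R" using insert.prems(1) d by auto
    have "aff ((diff c ^^ j) (diff d m1))"
      using m1 d dc c by (intro aff_diff_pow unif_diff) auto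
    then show ?thesis by (rule aff_ext) (rule diff_commute[OF m1(1) c dc])
  qed
  then show ?case using nj k j unif_diff_pow[OF m1(1) c, of j]
    by (intro exI[of _ "(diff c ^^ j) m1"]) auto
qed auto

text \<open>A non-affine function all of whose differences are affine is a quadratic one, with polar
  form \<open>x B c\<close>. Purity removes the polar form, and what remains is additive, so
  \<open>addv_linear\<close> gives a contradiction.\<close>

theorem unif_imp_aff:
  assumes "unif m"
  shows "aff m"
proof (rule ccontr)
  assume "\<not> aff m"
  then obtain m' where m': "unif m'" "\<not> aff m'" "\<And>c. c \<in> carrier R \<Longrightarrow> aff (diff c m')"
    using exists_nonaff_all_diff_aff[OF finite_carrier subset_refl assms] by blast
  define L where "L x = m' x \<ominus> m' \<zero>" for x
  have m0: "m' x \<in> carrier R" if "x \<in> carrier R" for x using unif_carrier[OF m'(1) that] .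
  have Lc: "L x \<in> carrier R" if "x \<in> carrier R" for x unfolding L_def using m0 that by simp
  obtain B where B: "\<And>c. c \<in> carrier R \<Longrightarrow> B c \<in> U"
    "\<And>c x. c \<in> carrier R \<Longrightarrow> x \<in> carrier R \<Longrightarrow> diff c m' x = diff c m' \<zero> \<oplus> x \<otimes> B c"
    using m'(3) unfolding aff_def by metis
  have Bc: "B c \<in> carrier R" if "c \<in> carrier R" for c using B(1) that U_carrier by blast
  have quad: "L (x \<oplus> c) = L x \<oplus> L c \<oplus> x \<otimes> B c" if x: "x \<in> carrier R" and c: "c \<in> carrier R" for x c
  proof -
    have e: "m' (x \<oplus> c) \<ominus> m' x = m' c \<ominus> m' \<zero> \<oplus> x \<otimes> B c" using B(2)[OF c x] c by (simp add: diff_def)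
    have "L (x \<oplus> c) = (m' (x \<oplus> c) \<ominus> m' x) \<oplus> (m' x \<ominus> m' \<zero>)"
      unfolding L_def using m0[OF x] m0[of "x \<oplus> c"] m0[of \<zero>] x c by simp algebra
    then show ?thesis unfolding e L_def using m0[OF x] m0[OF c] m0[of \<zero>] Bc[OF c] x by simp algebra
  qed
  \<comment> \<open>Expanding \<open>L (x + c)\<close> in both orders makes the polar form
    symmetric, so \<open>B\<close> is a multiple of the single vector \<open>B 1\<close>.\<close>
  have sym: "x \<otimes> B c = c \<otimes> B x" if x: "x \<in> carrier R" and c: "c \<in> carrier R" for x c
  proof -
    have cl: "L x \<in> carrier R" "L c \<in> carrier R" "x \<otimes> B c \<in> carrier R" "c \<otimes> B x \<in> carrier R"
      using Lc Bc x c by auto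
    have "L x \<oplus> L c \<oplus> x \<otimes> B c = L (x \<oplus> c)" using quad[OF x c] by simp
    also have "\<dots> = L (c \<oplus> x)" using x c by (simp add: a_comm)
    also have "\<dots> = L c \<oplus> L x \<oplus> c \<otimes> B x" by (rule quad[OF c x])
    also have "\<dots> = L x \<oplus> L c \<oplus> c \<otimes> B x" using cl by (simp add: a_comm)
    finally show ?thesis using cl by simp
  qed
  have B1: "B c = c \<otimes> B \<one>" if "c \<in> carrier R" for c using sym[OF one_closed that] Bc[OF that] by simp
  \<comment> \<open>Every multiple \<open>c B 1\<close> equals the slope \<open>B c\<close>, which
    lies in \<open>U\<close>.\<close>
  have "B \<one> = \<zero>" by (rule pure_mult) (use B(1) B1 U_V Units_closed in \<open>metis one_closed\<close>)+
  then have "x \<otimes> B c = \<zero>" if "c \<in> carrier R" "x \<in> carrier R" for x c using B1[OF that(1)] that by simp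
  then have add: "L (x \<oplus> c) = L x \<oplus> L c" if "x \<in> carrier R" "c \<in> carrier R" for x c
    using quad that Lc by simp
  have "addv L" unfolding addv_def
  proof (intro conjI ballI)
    show "L \<in> carrier R \<rightarrow> V" unfolding L_def using unif_V[OF m'(1)] by (auto intro!: V.minus_closed)
    fix x assume x: "x \<in> carrier R"
    show "L x \<in> scaled x" using unif_scaled[OF m'(1) x zero_closed] x by (simp add: L_def a_minus_def)
  qed (use add in auto)
  then obtain u where u: "u \<in> U" "\<And>x. x \<in> carrier R \<Longrightarrow> L x = x \<otimes> u" using addv_linear by blast
  have "m' x = m' \<zero> \<oplus> x \<otimes> u" if x: "x \<in> carrier R" for x
  proof -
    have "m' x = m' \<zero> \<oplus> L x" unfolding L_def using m0[OF x] m0[OF zero_closed] by algebra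
    then show ?thesis using u x by simp
  qed
  then show False using m'(2) u unfolding aff_def by blast
qed

end

section \<open>Maps moving every difference inside its orbit\<close>

context pure_pair begin

definition kassoc where "kassoc a b \<longleftrightarrow> (\<exists>k\<in>K. b = a \<otimes> k)"

lemma kassoc_refl: "a \<in> carrier R \<Longrightarrow> kassoc a a"
  unfolding kassoc_def using K_one by (intro bexI[of _ \<one>]) auto

lemma kassoc_mult:
  assumes "a \<in> carrier R" "c \<in> carrier R" "kassoc a b" "kassoc c d" shows "kassoc (a \<otimes> c) (b \<otimes> d)"
proof -
  obtain k l where kl: "k \<in> K" "l \<in> K" "b = a \<otimes> k" "d = c \<otimes> l" using assms unfolding kassoc_def by blast
  then have "b \<otimes> d = (a \<otimes> c) \<otimes> (k \<otimes> l)" using assms K_carrier by (simp add: m_ac)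
  then show ?thesis unfolding kassoc_def using kl K_mult by blast
qed

lemma kassoc_Units: "a \<in> Units R \<Longrightarrow> kassoc a b \<Longrightarrow> b \<in> Units R"
  unfolding kassoc_def using K_Units by auto

lemma kassoc_ideal: "ideal I R \<Longrightarrow> a \<in> I \<Longrightarrow> kassoc a b \<Longrightarrow> b \<in> I"
  unfolding kassoc_def using K_carrier by (auto intro: ideal.I_r_closed)

lemma kassoc_inv:
  assumes "a \<in> Units R" "kassoc a b" shows "kassoc (inv a) (inv b)"
proof -
  obtain k where k: "k \<in> K" "b = a \<otimes> k" using assms unfolding kassoc_def by blast
  then have ku: "k \<in> Units R" using K_Units by blast
  have e: "(a \<otimes> k) \<otimes> (inv a \<otimes> inv k) = (a \<otimes> inv a) \<otimes> (k \<otimes> inv k)"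
    using assms(1) ku Units_closed Units_inv_closed by (simp add: m_ac del: Units_r_inv Units_l_inv)
  have "inv b = inv a \<otimes> inv k" unfolding k(2)
    by (rule comm_inv_char) (use assms(1) ku Units_closed e in auto)
  then show ?thesis unfolding kassoc_def using k K_inv by blast
qed

text \<open>Cancelling the unit \<open>a\<close> puts \<open>b'/b\<close> in \<open>K\<close>, and
  \<open>b'/b - 1 = (b' - b)/b\<close> lies in \<open>V\<close>. The conclusion is multiplied back
  by \<open>b\<close> so that results for different points can be added.\<close>

lemma kassoc_diff_scaled:
  assumes a: "a \<in> Units R" and b: "kassoc a b" and b': "kassoc a b'" and V: "b' \<ominus> b \<in> V"
  shows "b' \<ominus> b \<in> scaled b"
proof -
  have bu: "b \<in> Units R" "b' \<in> Units R" using kassoc_Units a b b' by auto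
  obtain k l where k: "k \<in> K" "b = a \<otimes> k" and l: "l \<in> K" "b' = a \<otimes> l"
    using b b' unfolding kassoc_def by blast
  have ku: "k \<in> Units R" "l \<in> carrier R" using k l K_Units K_carrier by auto
  have c: "a \<in> carrier R" "k \<in> carrier R" "inv b \<in> carrier R" "inv k \<in> carrier R"
    "b \<in> carrier R" "b' \<in> carrier R"
    using a bu ku Units_closed by auto
  have "b \<otimes> (inv k \<otimes> l) = a \<otimes> (k \<otimes> (inv k \<otimes> l))" unfolding k(2) using c ku by (simp add: m_assoc)
  then have "b' = b \<otimes> (inv k \<otimes> l)" using Units_inv_cancel(2)[OF ku(1,2)] l by simp
  then have kl: "inv b \<otimes> b' = inv k \<otimes> l" using Units_inv_cancel(1)[OF bu(1)] c ku by simp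
  have "\<one> \<oplus> inv b \<otimes> (b' \<ominus> b) = \<one> \<oplus> (inv b \<otimes> b' \<ominus> inv b \<otimes> b)" using c by algebra
  also have "\<dots> = \<one> \<oplus> (inv k \<otimes> l \<ominus> \<one>)" using kl bu by simp
  also have "\<dots> = inv k \<otimes> l" using c ku m_closed[of "inv k" l] by algebra
  finally have "\<one> \<oplus> inv b \<otimes> (b' \<ominus> b) \<in> K" using k l by (simp add: K_inv K_mult)
  moreover have "inv b \<otimes> (b' \<ominus> b) \<in> V" using V c by (simp add: V.I_l_closed)
  ultimately have "inv b \<otimes> (b' \<ominus> b) \<in> U" by (simp add: U_def)
  then show ?thesis using scaled_iff[OF bu(1)] c by simp
qed

lemma VM_cong:
  assumes "a \<in> carrier R" "b \<in> carrier R" "a \<ominus> b \<in> V" "r \<in> M"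
  shows "a \<otimes> r = b \<otimes> r"
proof -
  have r: "r \<in> carrier R" using assms M.Icarr by simp
  have "a \<otimes> r = b \<otimes> r \<oplus> (a \<ominus> b) \<otimes> r" using assms(1,2) r by algebra
  then show ?thesis using assms r by (simp add: V_M')
qed

lemma V_eq: "a \<in> carrier R \<Longrightarrow> b \<in> carrier R \<Longrightarrow> a \<ominus> b \<in> V \<longleftrightarrow> V +> a = V +> b"
  by (rule quotient_eq_iff_same_a_r_cos[OF V_ideal])

text \<open>What preserving the relations gives when the relation through a pair is taken with
  \<open>r = x - y\<close>. Bijectivity is a consequence, see \<open>resp_bij\<close>.\<close>

definition resp where
  "resp f \<longleftrightarrow> f \<in> carrier R \<rightarrow> carrier R \<and>
     (\<forall>x\<in>carrier R. \<forall>y\<in>carrier R. kassoc (x \<ominus> y) (f x \<ominus> f y))"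

lemma resp_inj: assumes "resp f" shows "inj_on f (carrier R)"
proof (rule inj_onI)
  fix x y assume x: "x \<in> carrier R" and y: "y \<in> carrier R" and e: "f x = f y"
  have fc: "f y \<in> carrier R" using assms y by (auto simp: resp_def)
  have "kassoc (x \<ominus> y) \<zero>" using assms x y e fc unfolding resp_def by (metis r_right_minus_eq)
  then obtain k where k: "k \<in> K" "\<zero> = (x \<ominus> y) \<otimes> k" unfolding kassoc_def by blast
  have ku: "k \<in> Units R" "k \<in> carrier R" "inv k \<in> carrier R" using k K_Units Units_closed by auto
  have "x \<ominus> y = (x \<ominus> y) \<otimes> (k \<otimes> inv k)" using ku x y by simp
  also have "\<dots> = \<zero> \<otimes> inv k" unfolding k(2) by (rule m_assoc[symmetric]) (use ku x y in auto)
  finally show "x = y" using ku x y by simp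
qed

lemma resp_bij: assumes "resp f" shows "bij_betw f (carrier R) (carrier R)"
proof -
  have "f ` carrier R \<subseteq> carrier R" using assms by (auto simp: resp_def)
  then have "f ` carrier R = carrier R" by (rule endo_inj_surj[OF finite_carrier _ resp_inj[OF assms]])
  then show ?thesis using resp_inj[OF assms] by (simp add: bij_betw_def)
qed

end

section \<open>Normalised maps and their increments\<close>

locale resp_map = pure_pair +
  fixes f
  assumes resp_f: "resp f" and f_zero: "f \<zero> = \<zero>" and f_one: "f \<one> = \<one>"
begin

lemma f_closed: "x \<in> carrier R \<Longrightarrow> f x \<in> carrier R"
  using resp_f by (auto simp: resp_def)

lemma f_kassoc: "x \<in> carrier R \<Longrightarrow> y \<in> carrier R \<Longrightarrow> kassoc (x \<ominus> y) (f x \<ominus> f y)"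
  using resp_f by (auto simp: resp_def)

lemma f_kassoc0: "x \<in> carrier R \<Longrightarrow> kassoc x (f x)"
  using f_kassoc[of x \<zero>] f_zero f_closed by (simp add: a_minus_def)

lemma f_Units: "x \<in> Units R \<Longrightarrow> f x \<in> Units R"
  using f_kassoc0 kassoc_Units by blast

lemma f_M: "x \<in> M \<Longrightarrow> f x \<in> M"
  using f_kassoc0 kassoc_ideal[OF M_ideal] M.Icarr by blast

lemma f_surj: assumes "y \<in> carrier R" obtains x where "x \<in> carrier R" "f x = y"
  using resp_bij[OF resp_f] assms unfolding bij_betw_def by (metis imageE)

lemma f_minus_Units: "x \<in> carrier R \<Longrightarrow> y \<in> carrier R \<Longrightarrow> x \<ominus> y \<in> Units R \<Longrightarrow> f x \<ominus> f y \<in> Units R"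
  using f_kassoc kassoc_Units by blast

lemma f_minus_ideal: "ideal I R \<Longrightarrow> x \<in> carrier R \<Longrightarrow> y \<in> carrier R \<Longrightarrow> x \<ominus> y \<in> I \<Longrightarrow> f x \<ominus> f y \<in> I"
  using f_kassoc kassoc_ideal by blast

lemma f_minus_Units_iff:
  assumes "x \<in> carrier R" "y \<in> carrier R"
  shows "f x \<ominus> f y \<in> Units R \<longleftrightarrow> x \<ominus> y \<in> Units R"
  using f_minus_Units[OF assms] f_minus_ideal[OF M_ideal assms] Units_or_M[of "x \<ominus> y"] not_Units_M assms
  by (meson minus_closed)

definition incr where "incr x r = f (x \<oplus> r) \<ominus> f x"

lemma incr_closed: "x \<in> carrier R \<Longrightarrow> r \<in> carrier R \<Longrightarrow> incr x r \<in> carrier R"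
  by (simp add: incr_def f_closed)

lemma incr_ideal:
  assumes I: "ideal I R" and x: "x \<in> carrier R" and r: "r \<in> I"
  shows "incr x r \<in> I"
proof -
  have rc: "r \<in> carrier R" using I r by (rule ideal.Icarr)
  have "(x \<oplus> r) \<ominus> x = r" using x rc by algebra
  then show ?thesis unfolding incr_def using f_minus_ideal[OF I, of "x \<oplus> r" x] x r rc by simp
qed

text \<open>Shifting \<open>x\<close> and \<open>y\<close> by the same \<open>r\<close> does not
  change \<open>x - y\<close>, so \<open>f (x + r) - f (y + r)\<close> and \<open>f x - f y\<close>
  lie in one orbit; their difference is the difference of the two increments.\<close>

lemma incr_diff_scaled:
  assumes x: "x \<in> carrier R" and y: "y \<in> carrier R" and u: "x \<ominus> y \<in> Units R" and r: "r \<in> carrier R"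
    and V: "incr x r \<ominus> incr y r \<in> V"
  shows "incr x r \<ominus> incr y r \<in> scaled (f x \<ominus> f y)"
proof -
  have c: "f x \<in> carrier R" "f y \<in> carrier R" "f (x \<oplus> r) \<in> carrier R" "f (y \<oplus> r) \<in> carrier R"
    using x y r f_closed by auto
  have e: "incr x r \<ominus> incr y r = (f (x \<oplus> r) \<ominus> f (y \<oplus> r)) \<ominus> (f x \<ominus> f y)"
    unfolding incr_def using c by algebra
  have "(x \<oplus> r) \<ominus> (y \<oplus> r) = x \<ominus> y" using x y r by algebra
  then have "kassoc (x \<ominus> y) (f (x \<oplus> r) \<ominus> f (y \<oplus> r))"
    using f_kassoc[of "x \<oplus> r" "y \<oplus> r"] x y r by simp
  then show ?thesis using V unfolding e by (rule kassoc_diff_scaled[OF u f_kassoc[OF x y]])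
qed

text \<open>For a unit \<open>c\<close> choose \<open>x\<close> with \<open>f x = f y + c\<close>.
  Modulo \<open>M\<close>, the image of \<open>x\<close> is then at distance \<open>c\<close> from
  the images of both \<open>y\<close> and \<open>y + s\<close>, so both increments differ from
  \<open>incr x r\<close> by elements of \<open>c U\<close>. Hence their difference lies in every
  \<open>c U\<close>.\<close>

lemma incr_translate:
  assumes hV: "\<And>x y. x \<in> carrier R \<Longrightarrow> y \<in> carrier R \<Longrightarrow> incr x r \<ominus> incr y r \<in> V"
    and y: "y \<in> carrier R" and s: "s \<in> M" and r: "r \<in> carrier R"
  shows "incr (y \<oplus> s) r = incr y r"
proof -
  have sc: "s \<in> carrier R" using s M.Icarr by simp
  have "incr (y \<oplus> s) r \<ominus> incr y r = \<zero>"
  proof (rule pure_scaled)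
    show "incr (y \<oplus> s) r \<ominus> incr y r \<in> V" using hV y sc by simp
    fix c assume c: "c \<in> Units R"
    have cc: "c \<in> carrier R" using c by auto
    have fy: "f y \<in> carrier R" "f (y \<oplus> s) \<in> carrier R" using f_closed y sc by auto
    obtain x where x: "x \<in> carrier R" "f x = f y \<oplus> c" using f_surj[of "f y \<oplus> c"] fy cc by auto
    have e: "f x \<ominus> f y = c" unfolding x(2) using fy cc by algebra
    then have xy: "x \<ominus> y \<in> Units R" using f_minus_Units_iff[OF x(1) y] c by simp
    have "(x \<ominus> (y \<oplus> s)) \<ominus> (x \<ominus> y) = \<ominus> s" using x y sc by algebra
    then have xys: "x \<ominus> (y \<oplus> s) \<in> Units R" using Units_cong_M[OF xy] x y sc s by simp
    have "(f x \<ominus> f (y \<oplus> s)) \<ominus> c = \<ominus> incr y s" unfolding x(2) incr_def using fy cc by algebra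
    then have M: "(f x \<ominus> f (y \<oplus> s)) \<ominus> c \<in> M" using incr_ideal[OF M_ideal y s] by simp
    have 1: "incr x r \<ominus> incr y r \<in> scaled c"
      using incr_diff_scaled[OF x(1) y xy r hV[OF x(1) y]] e by simp
    have "incr x r \<ominus> incr (y \<oplus> s) r \<in> scaled (f x \<ominus> f (y \<oplus> s))"
      using incr_diff_scaled[OF x(1) _ xys r hV[OF x(1)]] y sc by simp
    then have 2: "incr x r \<ominus> incr (y \<oplus> s) r \<in> scaled c"
      using scaled_cong[OF _ cc M] f_closed[OF x(1)] fy by simp
    have "incr (y \<oplus> s) r \<ominus> incr y r = (incr x r \<ominus> incr y r) \<ominus> (incr x r \<ominus> incr (y \<oplus> s) r)"
      using incr_closed[OF x(1) r] incr_closed[OF y r] incr_closed[OF _ r, of "y \<oplus> s"] y sc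
      by simp algebra
    then show "incr (y \<oplus> s) r \<ominus> incr y r \<in> scaled c" using scaled_minus[OF cc 1 2] by simp
  qed
  then show ?thesis using incr_closed y sc r by simp
qed

lemma incr_add:
  assumes "y \<in> carrier R" "s \<in> carrier R" "r \<in> carrier R"
  shows "incr y (s \<oplus> r) = incr (y \<oplus> s) r \<oplus> incr y s"
proof -
  have "f y \<in> carrier R" "f (y \<oplus> s) \<in> carrier R" "f (y \<oplus> s \<oplus> r) \<in> carrier R" using assms f_closed by auto
  moreover have "y \<oplus> (s \<oplus> r) = y \<oplus> s \<oplus> r" using assms by (simp add: a_assoc)
  ultimately show ?thesis unfolding incr_def by (simp only:) algebra
qed

end

section \<open>From a homomorphism modulo \<open>V\<close> to a homomorphism\<close>

locale lift_map = resp_map +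
  assumes f_add_V: "x \<in> carrier R \<Longrightarrow> y \<in> carrier R \<Longrightarrow> f (x \<oplus> y) \<ominus> (f x \<oplus> f y) \<in> V"
    and f_mult_V: "x \<in> carrier R \<Longrightarrow> y \<in> carrier R \<Longrightarrow> f (x \<otimes> y) \<ominus> f x \<otimes> f y \<in> V"
begin

abbreviation "Q \<equiv> R Quot V"

lemma q_hom: "ring_hom_cring R Q ((+>) V)"
  using V.rcos_ring_hom_cring by (simp add: is_cring)

sublocale q: ring_hom_cring R Q "(+>) V" by (rule q_hom)

lemma q_minus: "a \<in> carrier R \<Longrightarrow> b \<in> carrier R \<Longrightarrow> V +> (a \<ominus> b) = (V +> a) \<ominus>\<^bsub>Q\<^esub> (V +> b)"
  by (simp add: a_minus_def)

lemma q_add: "x \<in> carrier R \<Longrightarrow> y \<in> carrier R \<Longrightarrow> V +> f (x \<oplus> y) = (V +> f x) \<oplus>\<^bsub>Q\<^esub> (V +> f y)"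
  using f_add_V[of x y] V_eq[of "f (x \<oplus> y)" "f x \<oplus> f y"] f_closed by simp

lemma q_mult: "x \<in> carrier R \<Longrightarrow> y \<in> carrier R \<Longrightarrow> V +> f (x \<otimes> y) = (V +> f x) \<otimes>\<^bsub>Q\<^esub> (V +> f y)"
  using f_mult_V[of x y] V_eq[of "f (x \<otimes> y)" "f x \<otimes> f y"] f_closed by simp

lemma q_incr:
  assumes "x \<in> carrier R" "r \<in> carrier R" shows "V +> incr x r = V +> f r"
proof -
  have "V +> f x \<in> carrier Q" "V +> f r \<in> carrier Q" using assms f_closed by auto
  then have "((V +> f x) \<oplus>\<^bsub>Q\<^esub> (V +> f r)) \<ominus>\<^bsub>Q\<^esub> (V +> f x) = V +> f r" by (simp add: a_minus_def q.S.a_ac q.S.r_neg q.S.r_neg1 q.S.r_neg2)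
  then show ?thesis unfolding incr_def using assms f_closed by (simp add: q_minus q_add)
qed

lemma incr_V: "x \<in> carrier R \<Longrightarrow> y \<in> carrier R \<Longrightarrow> r \<in> carrier R \<Longrightarrow> incr x r \<ominus> incr y r \<in> V"
  by (simp add: V_eq incr_closed q_incr)

lemma incr_add_M:
  assumes "y \<in> carrier R" "s \<in> M" "r \<in> M"
  shows "incr y (s \<oplus> r) = incr y r \<oplus> incr y s"
proof -
  have c: "s \<in> carrier R" "r \<in> carrier R" using assms M.Icarr by auto
  then show ?thesis using incr_add[OF assms(1) c] incr_translate[OF incr_V assms(1,2)] by simp
qed

text \<open>Put \<open>u = 1/e\<close> and \<open>r = e s\<close>. The difference
  \<open>f (x + s) - f (x - u)\<close> and the product \<open>(f x - f (x - u)) f (1 + r)\<close>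
  both belong to the orbit of \<open>u + s = u (1 + r)\<close>, and they agree modulo
  \<open>V\<close>. Their difference, divided by \<open>f u\<close>, is the expression claimed to
  lie in \<open>U\<close>.\<close>

lemma incr_mult_unit:
  assumes x: "x \<in> carrier R" and e: "e \<in> Units R" and s: "s \<in> M"
  shows "f e \<otimes> incr x s \<ominus> incr \<one> (e \<otimes> s) \<in> U"
proof -
  define u where "u = inv e"
  define r where "r = e \<otimes> s"
  define c where "c = f x \<ominus> f (x \<ominus> u)"
  have sc: "s \<in> carrier R" and ec: "e \<in> carrier R" using s e M.Icarr by auto
  have u: "u \<in> Units R" "u \<in> carrier R" using e by (auto simp: u_def)
  have r: "r \<in> M" "r \<in> carrier R" using s sc ec by (auto simp: r_def M.I_l_closed)
  have ur: "u \<otimes> r = s" unfolding u_def r_def using Units_inv_cancel e sc by simp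
  have fc: "f x \<in> carrier R" "f (x \<ominus> u) \<in> carrier R" "f (x \<oplus> s) \<in> carrier R" "f u \<in> carrier R"
    "f (\<one> \<oplus> r) \<in> carrier R" "f e \<in> carrier R"
    using f_closed x u sc r ec by auto
  have fuu: "f u \<in> Units R" using f_Units u by simp
  have cc: "c \<in> carrier R" using fc by (simp add: c_def)
  have hr: "incr \<one> r \<in> M" "incr \<one> r \<in> carrier R" using incr_ideal[OF M_ideal one_closed r(1)] M.Icarr by auto
  have hs: "incr x s \<in> M" "incr x s \<in> carrier R" using incr_ideal[OF M_ideal x s] M.Icarr by auto
  have e1: "(x \<oplus> s) \<ominus> (x \<ominus> u) = u \<otimes> (\<one> \<oplus> r)"
  proof -
    have "(x \<oplus> s) \<ominus> (x \<ominus> u) = u \<oplus> u \<otimes> r" unfolding ur using x sc u by algebra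
    then show ?thesis using u r by (simp add: r_distr)
  qed
  have e2: "x \<ominus> (x \<ominus> u) = u" using x u by algebra
  have a: "u \<otimes> (\<one> \<oplus> r) \<in> Units R" using u r Units_add_M[of \<one> r] by simp
  have k1: "kassoc (u \<otimes> (\<one> \<oplus> r)) (f (x \<oplus> s) \<ominus> f (x \<ominus> u))"
    using f_kassoc[of "x \<oplus> s" "x \<ominus> u"] x u sc e1 by simp
  have k2: "kassoc (u \<otimes> (\<one> \<oplus> r)) (c \<otimes> f (\<one> \<oplus> r))"
    using f_kassoc[of x "x \<ominus> u"] f_kassoc0[of "\<one> \<oplus> r"] e2 x u r by (intro kassoc_mult) (auto simp: c_def)
  have f1: "f (\<one> \<oplus> r) = \<one> \<oplus> incr \<one> r" unfolding incr_def f_one using fc(5) by algebra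
  have d: "(f (x \<oplus> s) \<ominus> f (x \<ominus> u)) \<ominus> c \<otimes> f (\<one> \<oplus> r) = incr x s \<ominus> c \<otimes> incr \<one> r"
  proof -
    have "f (x \<oplus> s) \<ominus> f (x \<ominus> u) = incr x s \<oplus> c" unfolding incr_def c_def using fc by algebra
    moreover have "(incr x s \<oplus> c) \<ominus> c \<otimes> (\<one> \<oplus> incr \<one> r) = incr x s \<ominus> c \<otimes> incr \<one> r"
      using cc hr(2) hs(2) by algebra
    ultimately show ?thesis unfolding f1 by simp
  qed
  have qc: "V +> c = V +> f u"
  proof -
    have "f x = f ((x \<ominus> u) \<oplus> u)" using x u by (simp add: a_minus_def a_assoc l_neg)
    then have "V +> f x = (V +> f (x \<ominus> u)) \<oplus>\<^bsub>Q\<^esub> (V +> f u)" using q_add[of "x \<ominus> u" u] x u by simp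
    moreover have "V +> f (x \<ominus> u) \<in> carrier Q" "V +> f u \<in> carrier Q" using fc by auto
    ultimately show ?thesis unfolding c_def using fc
      by (simp add: q_minus a_minus_def q.S.a_ac q.S.r_neg q.S.r_neg1 q.S.r_neg2)
  qed
  then have cu: "c \<ominus> f u \<in> V" using V_eq cc fc by simp
  have "V +> incr x s = V +> (c \<otimes> incr \<one> r)"
    using q_mult[OF u(2) r(2)] qc cc hr fc r by (simp add: q_incr x sc ur)
  then have "incr x s \<ominus> c \<otimes> incr \<one> r \<in> V" using V_eq hs hr cc by simp
  then have "incr x s \<ominus> c \<otimes> incr \<one> r \<in> scaled (c \<otimes> f (\<one> \<oplus> r))"
    using kassoc_diff_scaled[OF a k2 k1] unfolding d by simp
  also have "scaled (c \<otimes> f (\<one> \<oplus> r)) = scaled (f u)"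
  proof (rule scaled_cong)
    have "c \<otimes> f (\<one> \<oplus> r) \<ominus> f u = (c \<ominus> f u) \<oplus> c \<otimes> incr \<one> r"
      unfolding f1 using cc fc hr by algebra
    then show "c \<otimes> f (\<one> \<oplus> r) \<ominus> f u \<in> M" using cu V_in_M hr cc by (simp add: M.I_l_closed)
  qed (use cc fc in auto)
  finally have "incr x s \<ominus> f u \<otimes> incr \<one> r \<in> scaled (f u)"
    using VM_cong[OF cc fc(4) cu hr(1)] by simp
  from scaled_one_div[OF fuu this]
  have i: "inv (f u) \<otimes> (incr x s \<ominus> f u \<otimes> incr \<one> r) \<in> U" .
  have ic: "inv (f u) \<in> carrier R" using fuu by simp
  have "inv (f u) \<otimes> (incr x s \<ominus> f u \<otimes> incr \<one> r) = inv (f u) \<otimes> incr x s \<ominus> inv (f u) \<otimes> (f u \<otimes> incr \<one> r)"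
    using ic hs hr fc by algebra
  also have "inv (f u) \<otimes> (f u \<otimes> incr \<one> r) = incr \<one> r" using Units_inv_cancel fuu hr by simp
  \<comment> \<open>\<open>f e\<close> inverts \<open>f u\<close> only modulo \<open>V\<close>; that
    suffices because \<open>incr x s\<close> lies in \<open>M\<close>, which \<open>V\<close>
    annihilates.\<close>
  also have "inv (f u) \<otimes> incr x s = f e \<otimes> incr x s"
  proof (rule VM_cong[OF ic fc(6) _ hs(1)])
    have "e \<otimes> u = \<one>" using e by (simp add: u_def)
    then have w: "\<one> \<ominus> f e \<otimes> f u \<in> V" using f_mult_V[OF ec u(2)] f_one by simp
    have "inv (f u) \<ominus> f e = inv (f u) \<otimes> \<one> \<ominus> f e \<otimes> (inv (f u) \<otimes> f u)" using fuu fc ic by simp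
    also have "\<dots> = inv (f u) \<otimes> (\<one> \<ominus> f e \<otimes> f u)" using fc ic by algebra
    finally show "inv (f u) \<ominus> f e \<in> V" using w ic by (simp add: V.I_l_closed)
  qed
  finally show ?thesis using i by (simp add: r_def)
qed

text \<open>For \<open>e\<close> in \<open>M\<close> the unit case is applied to
  \<open>1 + e\<close> and to \<open>1\<close>, and the results are subtracted.\<close>

lemma incr_mult:
  assumes x: "x \<in> carrier R" and e: "e \<in> carrier R" and s: "s \<in> M"
  shows "f e \<otimes> incr x s \<ominus> incr \<one> (e \<otimes> s) \<in> U"
proof (cases "e \<in> M")
  case True
  have sc: "s \<in> carrier R" using s M.Icarr by simp
  have e1: "\<one> \<oplus> e \<in> Units R" using Units_add_M True by simp
  have es: "e \<otimes> s \<in> M" using True sc by (simp add: M.I_r_closed)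
  have hs: "incr x s \<in> M" "incr x s \<in> carrier R" using incr_ideal[OF M_ideal x s] M.Icarr by auto
  have h1: "incr \<one> s \<in> carrier R" "incr \<one> (e \<otimes> s) \<in> carrier R" using incr_closed sc e by auto
  have fc: "f e \<in> carrier R" "f (\<one> \<oplus> e) \<in> carrier R" using f_closed e by auto
  have "f (\<one> \<oplus> e) \<otimes> incr x s = (\<one> \<oplus> f e) \<otimes> incr x s"
    using f_add_V[OF one_closed e] f_one fc hs by (intro VM_cong) auto
  moreover have "incr \<one> ((\<one> \<oplus> e) \<otimes> s) = incr \<one> (e \<otimes> s) \<oplus> incr \<one> s"
    using incr_add_M[OF one_closed s es] e sc by (simp add: l_distr)
  ultimately have 1: "(\<one> \<oplus> f e) \<otimes> incr x s \<ominus> (incr \<one> (e \<otimes> s) \<oplus> incr \<one> s) \<in> U"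
    using incr_mult_unit[OF x e1 s] by simp
  have 2: "incr x s \<ominus> incr \<one> s \<in> U"
    using incr_mult_unit[OF x Units_one_closed s] f_one sc hs by simp
  have "f e \<otimes> incr x s \<ominus> incr \<one> (e \<otimes> s) =
     ((\<one> \<oplus> f e) \<otimes> incr x s \<ominus> (incr \<one> (e \<otimes> s) \<oplus> incr \<one> s)) \<ominus> (incr x s \<ominus> incr \<one> s)"
    using fc hs h1 by algebra
  then show ?thesis using U_add[OF 1 U_neg[OF 2]] by (simp add: a_minus_def)
qed (use incr_mult_unit UnitsI assms in blast)

text \<open>The error \<open>B\<close> satisfies \<open>B (d e) s - B d (e s) = f d (B e s)\<close>.
  The left side lies in \<open>U\<close> and \<open>f d\<close> can be any unit, so purity gives
  \<open>B e s = 0\<close>.\<close>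

lemma incr_one_mult:
  assumes e: "e \<in> carrier R" and s: "s \<in> M"
  shows "incr \<one> (e \<otimes> s) = f e \<otimes> incr \<one> s"
proof -
  define B where "B e s = f e \<otimes> incr \<one> s \<ominus> incr \<one> (e \<otimes> s)" for e s
  have sc: "s \<in> carrier R" using s M.Icarr by simp
  have es: "e \<otimes> s \<in> M" using e s by (simp add: M.I_l_closed)
  have BU: "B e s \<in> U" if "e \<in> carrier R" "s \<in> M" for e s
    unfolding B_def by (rule incr_mult[OF one_closed that])
  have h: "incr \<one> s \<in> M" "incr \<one> s \<in> carrier R" "incr \<one> (e \<otimes> s) \<in> carrier R"
    using incr_ideal[OF M_ideal one_closed s] M.Icarr incr_closed[OF one_closed] e sc by auto
  have fe: "f e \<in> carrier R" using f_closed e by simp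
  have "B e s = \<zero>"
  proof (rule pure_mult)
    show "B e s \<in> V" using BU[OF e s] U_V by simp
    fix c assume c: "c \<in> Units R"
    obtain d where d: "d \<in> carrier R" "f d = c" using f_surj c by blast
    have cc: "c \<in> carrier R" "f (d \<otimes> e) \<in> carrier R" "incr \<one> (d \<otimes> (e \<otimes> s)) \<in> carrier R"
      using c d e sc f_closed incr_closed by auto
    have "f (d \<otimes> e) \<otimes> incr \<one> s = (c \<otimes> f e) \<otimes> incr \<one> s"
      using f_mult_V[OF d(1) e] d cc fe h by (intro VM_cong) auto
    then have "B (d \<otimes> e) s \<ominus> B d (e \<otimes> s) =
        ((c \<otimes> f e) \<otimes> incr \<one> s \<ominus> incr \<one> (d \<otimes> (e \<otimes> s))) \<ominus> (c \<otimes> incr \<one> (e \<otimes> s) \<ominus> incr \<one> (d \<otimes> (e \<otimes> s)))"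
      unfolding B_def using d e sc by (simp add: m_assoc)
    also have "\<dots> = c \<otimes> B e s" unfolding B_def using cc fe h by algebra
    finally have "c \<otimes> B e s = B (d \<otimes> e) s \<oplus> \<ominus> B d (e \<otimes> s)" by (simp add: a_minus_def)
    then show "c \<otimes> B e s \<in> U" using BU[OF _ s, of "d \<otimes> e"] BU[OF d(1) es] d e by (simp add: U_add U_neg)
  qed
  then show ?thesis unfolding B_def using fe h by simp
qed

text \<open>With the semilinearity at base point 1 now exact, \<open>incr_mult\<close> says that
  \<open>f d\<close> times the difference of the two increments lies in \<open>U\<close>, for every
  \<open>d\<close>.\<close>

lemma incr_const:
  assumes x: "x \<in> carrier R" and s: "s \<in> M"
  shows "incr x s = incr \<one> s"
proof -
  have sc: "s \<in> carrier R" using s M.Icarr by simp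
  have h: "incr x s \<in> carrier R" "incr \<one> s \<in> carrier R" using incr_closed x sc by auto
  have "incr x s \<ominus> incr \<one> s = \<zero>"
  proof (rule pure_mult)
    show "incr x s \<ominus> incr \<one> s \<in> V" using incr_V x sc by simp
    fix c assume c: "c \<in> Units R"
    obtain d where d: "d \<in> carrier R" "f d = c" using f_surj c by blast
    have "c \<otimes> incr x s \<ominus> c \<otimes> incr \<one> s \<in> U" using incr_mult[OF x d(1) s] incr_one_mult[OF d(1) s] d by simp
    moreover have "c \<otimes> (incr x s \<ominus> incr \<one> s) = c \<otimes> incr x s \<ominus> c \<otimes> incr \<one> s"
      using h Units_closed[OF c] by algebra
    ultimately show "c \<otimes> (incr x s \<ominus> incr \<one> s) \<in> U" by simp
  qed
  then show ?thesis using h by simp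
qed

lemma incr_eq: assumes "x \<in> carrier R" "s \<in> M" shows "incr x s = f s"
proof -
  have "incr x s = incr \<zero> s" using incr_const[OF assms] incr_const[OF zero_closed assms(2)] by metis
  then show ?thesis unfolding incr_def[of \<zero>] using f_zero assms f_closed M.Icarr by (simp add: a_minus_def)
qed

lemma f_add_M:
  assumes "x \<in> carrier R" "s \<in> M" shows "f (x \<oplus> s) = f x \<oplus> f s"
proof -
  have "f x \<in> carrier R" "f (x \<oplus> s) \<in> carrier R" using assms f_closed M.Icarr by auto
  then have "f (x \<oplus> s) = f x \<oplus> incr x s" unfolding incr_def by algebra
  then show ?thesis using incr_eq assms by simp
qed

lemma f_mult_M:
  assumes "e \<in> carrier R" "s \<in> M" shows "f (e \<otimes> s) = f e \<otimes> f s"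
  using incr_one_mult[OF assms] incr_eq[of \<one>] assms by (simp add: M.I_l_closed)

text \<open>Precomposing \<open>g\<close> with the inverse of \<open>f\<close> turns the hypothesis
  into \<open>unif\<close>; the constant term vanishes because \<open>f\<close> fixes 0.\<close>

lemma aff_along_f:
  assumes g: "g \<in> carrier R \<rightarrow> V"
    and gs: "\<And>x y. x \<in> carrier R \<Longrightarrow> y \<in> carrier R \<Longrightarrow> g x \<ominus> g y \<in> scaled (f x \<ominus> f y)"
    and g0: "g \<zero> = \<zero>"
  obtains u where "u \<in> U" "\<And>x. x \<in> carrier R \<Longrightarrow> g x = f x \<otimes> u"
proof -
  define F where "F = inv_into (carrier R) f"
  have bij: "bij_betw f (carrier R) (carrier R)" by (rule resp_bij[OF resp_f])
  have Fc: "F x \<in> carrier R" "f (F x) = x" if "x \<in> carrier R" for x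
    unfolding F_def using bij that by (auto simp: bij_betw_inv_into_right bij_betw_def inv_into_into)
  have Ff: "F (f x) = x" if "x \<in> carrier R" for x
    unfolding F_def using bij that by (simp add: bij_betw_inv_into_left)
  have "unif (\<lambda>x. g (F x))" unfolding unif_def
  proof (intro conjI ballI)
    show "(\<lambda>x. g (F x)) \<in> carrier R \<rightarrow> V" using g Fc by auto
    fix x y assume "x \<in> carrier R" "y \<in> carrier R"
    then show "g (F x) \<ominus> g (F y) \<in> scaled (x \<ominus> y)" using gs[of "F x" "F y"] Fc by simp
  qed
  from unif_imp_aff[OF this] obtain u where u: "u \<in> U"
    "\<And>x. x \<in> carrier R \<Longrightarrow> g (F x) = g (F \<zero>) \<oplus> x \<otimes> u" unfolding aff_def by blast
  have "F \<zero> = \<zero>" using Ff[of \<zero>] f_zero by simp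
  then have "g x = f x \<otimes> u" if x: "x \<in> carrier R" for x
    using u(2)[of "f x"] f_closed[OF x] Ff[OF x] g0 U_carrier[OF u(1)] by simp
  then show thesis using that u(1) by blast
qed

text \<open>For fixed \<open>c\<close> the additivity error \<open>f (x + c) - f x - f c\<close> has
  the form \<open>f x\<close> times some \<open>u c\<close> in \<open>U\<close>. It is symmetric in
  \<open>x\<close> and \<open>c\<close>, so \<open>u c = f c\<close> times \<open>u 1\<close>; thus
  all unit multiples of \<open>u 1\<close> lie in \<open>U\<close>.\<close>

lemma f_add:
  assumes x: "x \<in> carrier R" and y: "y \<in> carrier R"
  shows "f (x \<oplus> y) = f x \<oplus> f y"
proof -
  define g where "g c x = f (x \<oplus> c) \<ominus> (f x \<oplus> f c)" for c x
  have ex: "\<exists>u\<in>U. \<forall>x\<in>carrier R. g c x = f x \<otimes> u" if c: "c \<in> carrier R" for c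
  proof -
    have gV: "g c x \<in> V" if "x \<in> carrier R" for x unfolding g_def using f_add_V that c by simp
    have gs: "g c x \<ominus> g c y \<in> scaled (f x \<ominus> f y)" if x: "x \<in> carrier R" and y: "y \<in> carrier R" for x y
    proof -
      have fc: "f x \<in> carrier R" "f y \<in> carrier R" "f c \<in> carrier R" "f (x \<oplus> c) \<in> carrier R" "f (y \<oplus> c) \<in> carrier R"
        using f_closed x y c by auto
      have e: "g c x \<ominus> g c y = (f (x \<oplus> c) \<ominus> f (y \<oplus> c)) \<ominus> (f x \<ominus> f y)"
        unfolding g_def using fc by algebra
      show ?thesis
      proof (cases "x \<ominus> y \<in> M")
        \<comment> \<open>The target group is zero here, so exact equality is required;
          \<open>f_add_M\<close> supplies it.\<close>
        case True
        define r where "r = x \<ominus> y"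
        have rM: "r \<in> M" "r \<in> carrier R" using True x y by (auto simp: r_def)
        have fr: "f r \<in> carrier R" using f_closed rM by simp
        have "x = y \<oplus> r" "x \<oplus> c = (y \<oplus> c) \<oplus> r" unfolding r_def using x y c by algebra+
        then have ee: "f x = f y \<oplus> f r" "f (x \<oplus> c) = f (y \<oplus> c) \<oplus> f r"
          using f_add_M[OF y rM(1)] f_add_M[OF _ rM(1), of "y \<oplus> c"] y c by auto
        have "g c x \<ominus> g c y = \<zero>" unfolding e ee using fc fr by algebra
        then show ?thesis using scaled_zero[of "f x \<ominus> f y"] fc by simp
      next
        case False
        then have u: "x \<ominus> y \<in> Units R" using x y UnitsI by simp
        have "(x \<oplus> c) \<ominus> (y \<oplus> c) = x \<ominus> y" using x y c by algebra
        then have "kassoc (x \<ominus> y) (f (x \<oplus> c) \<ominus> f (y \<oplus> c))"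
          using f_kassoc[of "x \<oplus> c" "y \<oplus> c"] x y c by simp
        moreover have "(f (x \<oplus> c) \<ominus> f (y \<oplus> c)) \<ominus> (f x \<ominus> f y) \<in> V"
          unfolding e[symmetric] using gV x y by (simp add: V.minus_closed)
        ultimately show ?thesis unfolding e by (rule kassoc_diff_scaled[OF u f_kassoc[OF x y]])
      qed
    qed
    have "g c \<zero> = \<zero>" unfolding g_def using f_zero f_closed c by simp
    then obtain u where "u \<in> U" "\<And>x. x \<in> carrier R \<Longrightarrow> g c x = f x \<otimes> u"
      using aff_along_f[of "g c", OF _ gs] gV by (metis Pi_I)
    then show ?thesis by blast
  qed
  then obtain u where u: "\<And>c. c \<in> carrier R \<Longrightarrow> u c \<in> U"
    "\<And>c x. c \<in> carrier R \<Longrightarrow> x \<in> carrier R \<Longrightarrow> g c x = f x \<otimes> u c" by metis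
  have u1: "u c = f c \<otimes> u \<one>" if c: "c \<in> carrier R" for c
  proof -
    have "f \<one> \<otimes> u c = g c \<one>" using u c by simp
    also have "\<dots> = g \<one> c" unfolding g_def using f_closed c by (simp add: a_comm)
    also have "\<dots> = f c \<otimes> u \<one>" using u c by simp
    finally show ?thesis using f_one U_carrier[OF u(1)[OF c]] by simp
  qed
  have "u \<one> = \<zero>"
  proof (rule pure_mult)
    show "u \<one> \<in> V" using u U_V by simp
    fix c assume c: "c \<in> Units R"
    obtain d where "d \<in> carrier R" "f d = c" using f_surj c by blast
    then show "c \<otimes> u \<one> \<in> U" using u1[of d] u(1)[of d] by simp
  qed
  then have "g y x = \<zero>" using u(2)[OF y x] u1[OF y] f_closed x y by simp
  then show ?thesis unfolding g_def using f_closed x y by simp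
qed

text \<open>Since \<open>f w\<close> is in the orbit of \<open>w\<close>, dividing by it brings
  \<open>f (w x) - f (w y)\<close> into the orbit of \<open>x - y\<close>. The error
  \<open>f (w x) / f w - f x\<close> is therefore \<open>f x\<close> times a fixed \<open>u\<close>,
  and its value at 1 is 0.\<close>

lemma f_mult_Units:
  assumes w: "w \<in> Units R" and x: "x \<in> carrier R"
  shows "f (w \<otimes> x) = f w \<otimes> f x"
proof -
  have wc: "w \<in> carrier R" using w by auto
  have fw: "f w \<in> Units R" "f w \<in> carrier R" "inv (f w) \<in> carrier R" using f_Units[OF w] by auto
  define g where "g x = inv (f w) \<otimes> f (w \<otimes> x) \<ominus> f x" for x
  have ge: "g x = inv (f w) \<otimes> (f (w \<otimes> x) \<ominus> f w \<otimes> f x)" if x: "x \<in> carrier R" for x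
  proof -
    have c: "f x \<in> carrier R" "f (w \<otimes> x) \<in> carrier R" using f_closed wc x by auto
    have "inv (f w) \<otimes> (f (w \<otimes> x) \<ominus> f w \<otimes> f x) = inv (f w) \<otimes> f (w \<otimes> x) \<ominus> inv (f w) \<otimes> (f w \<otimes> f x)"
      using c fw by algebra
    then show ?thesis unfolding g_def using Units_inv_cancel[OF fw(1) c(1)] by simp
  qed
  have gV: "g x \<in> V" if "x \<in> carrier R" for x
    unfolding ge[OF that] using f_mult_V[OF wc that] fw by (simp add: V.I_l_closed)
  have gs: "g x \<ominus> g y \<in> scaled (f x \<ominus> f y)" if x: "x \<in> carrier R" and y: "y \<in> carrier R" for x y
  proof -
    have fc: "f x \<in> carrier R" "f y \<in> carrier R" "f (w \<otimes> x) \<in> carrier R" "f (w \<otimes> y) \<in> carrier R"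
      using f_closed x y wc by auto
    have e: "g x \<ominus> g y = inv (f w) \<otimes> (f (w \<otimes> x) \<ominus> f (w \<otimes> y)) \<ominus> (f x \<ominus> f y)"
      unfolding g_def using fc fw by algebra
    have wxy: "w \<otimes> x \<ominus> w \<otimes> y = w \<otimes> (x \<ominus> y)" using x y wc by algebra
    show ?thesis
    proof (cases "x \<ominus> y \<in> M")
      case True
      define r where "r = x \<ominus> y"
      have rM: "r \<in> M" "r \<in> carrier R" "w \<otimes> r \<in> M" using True x y wc by (auto simp: r_def M.I_l_closed)
      have fr: "f r \<in> carrier R" using f_closed rM by simp
      have "x = y \<oplus> r" "w \<otimes> x = w \<otimes> y \<oplus> w \<otimes> r" unfolding r_def using x y wc by algebra+
      then have ee: "f x = f y \<oplus> f r" "f (w \<otimes> x) = f (w \<otimes> y) \<oplus> f w \<otimes> f r"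
        using f_add_M[OF y rM(1)] f_add_M[OF _ rM(3), of "w \<otimes> y"] f_mult_M[OF wc rM(1)] y wc by auto
      have "f (w \<otimes> x) \<ominus> f (w \<otimes> y) = f w \<otimes> f r" unfolding ee using fc fr fw by algebra
      moreover have "f x \<ominus> f y = f r" unfolding ee using fc fr by algebra
      ultimately have "g x \<ominus> g y = \<zero>" unfolding e using Units_inv_cancel[OF fw(1) fr] fr by simp
      then show ?thesis using scaled_zero[of "f x \<ominus> f y"] fc by simp
    next
      case False
      then have u: "x \<ominus> y \<in> Units R" using x y UnitsI by simp
      have "kassoc (inv w \<otimes> (w \<otimes> (x \<ominus> y))) (inv (f w) \<otimes> (f (w \<otimes> x) \<ominus> f (w \<otimes> y)))"
        using f_kassoc[of "w \<otimes> x" "w \<otimes> y"] wxy x y w wc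
        by (intro kassoc_mult kassoc_inv f_kassoc0) auto
      then have "kassoc (x \<ominus> y) (inv (f w) \<otimes> (f (w \<otimes> x) \<ominus> f (w \<otimes> y)))"
        using Units_inv_cancel[OF w] x y by simp
      moreover have "inv (f w) \<otimes> (f (w \<otimes> x) \<ominus> f (w \<otimes> y)) \<ominus> (f x \<ominus> f y) \<in> V"
        unfolding e[symmetric] using gV x y by (simp add: V.minus_closed)
      ultimately show ?thesis unfolding e by (rule kassoc_diff_scaled[OF u f_kassoc[OF x y]])
    qed
  qed
  have "g \<zero> = \<zero>" unfolding g_def using f_zero wc fw by simp
  then obtain u where u: "u \<in> U" "\<And>x. x \<in> carrier R \<Longrightarrow> g x = f x \<otimes> u"
    using aff_along_f[of g, OF _ gs] gV by (metis Pi_I)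
  have "g \<one> = \<zero>" unfolding g_def using f_one wc fw by simp
  then have "u = \<zero>" using u(2)[of \<one>] f_one U_carrier[OF u(1)] by simp
  then have "inv (f w) \<otimes> f (w \<otimes> x) = f x" using u(2)[OF x] f_closed x wc fw unfolding g_def by simp
  then show ?thesis using Units_inv_cancel(2)[OF fw(1), of "f (w \<otimes> x)"] f_closed x wc by simp
qed

theorem f_ring_hom: "f \<in> ring_hom R R"
proof (rule ring_hom_memI)
  fix x y assume x: "x \<in> carrier R" and y: "y \<in> carrier R"
  show "f (x \<otimes> y) = f x \<otimes> f y"
  proof (cases "x \<in> M")
    case True
    then show ?thesis using f_mult_M[OF y True] x y f_closed by (simp add: m_comm)
  next
    case False
    then show ?thesis using f_mult_Units UnitsI x y by blast
  qed
qed (use f_closed f_add f_one in auto)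

end

section \<open>Additivity modulo the maximal ideal\<close>

context field begin

lemma inv_nonzero:
  assumes "a \<in> carrier R" "a \<noteq> \<zero>"
  shows "inv a \<in> carrier R" "inv a \<noteq> \<zero>" "a \<otimes> inv a = \<one>" "inv a \<otimes> a = \<one>" "inv (inv a) = a"
proof -
  have a: "a \<in> Units R" using assms field_Units by blast
  then show "inv a \<in> carrier R" "a \<otimes> inv a = \<one>" "inv a \<otimes> a = \<one>" "inv (inv a) = a" by auto
  show "inv a \<noteq> \<zero>" using a field_Units Units_inv_Units by blast
qed

lemma inv_eqI:
  assumes "a \<in> carrier R" "b \<in> carrier R" "a \<otimes> b = \<one>"
  shows "inv a = b"
  using assms comm_inv_char by blast

text \<open>With \<open>P = 1/b - a\<close> one has \<open>a - a a b = a b P\<close>, and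
  \<open>a b P (1/a + 1/P) = b (P + a) = 1\<close>. The same product shows that the sum being
  inverted is nonzero.\<close>

lemma hua_identity:
  assumes a: "a \<in> carrier R" "a \<noteq> \<zero>" and b: "b \<in> carrier R" "b \<noteq> \<zero>" and ab: "a \<otimes> b \<noteq> \<one>"
  shows "inv b \<ominus> a \<noteq> \<zero>" "inv a \<oplus> inv (inv b \<ominus> a) \<noteq> \<zero>"
    "inv (inv a \<oplus> inv (inv b \<ominus> a)) = a \<ominus> a \<otimes> a \<otimes> b"
proof -
  note ia = inv_nonzero[OF a] and ib = inv_nonzero[OF b]
  define P where "P = inv b \<ominus> a"
  have Pc: "P \<in> carrier R" using ib a by (simp add: P_def)
  have bP: "b \<otimes> P = \<one> \<ominus> a \<otimes> b"
  proof -
    have "b \<otimes> P = b \<otimes> inv b \<ominus> a \<otimes> b" unfolding P_def using ib(1) a b by algebra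
    then show ?thesis using ib by simp
  qed
  show P0: "inv b \<ominus> a \<noteq> \<zero>"
  proof
    assume "inv b \<ominus> a = \<zero>"
    then have "inv b = a" using ib a by simp
    then show False using ab ib by simp
  qed
  then have iP: "inv P \<in> carrier R" "P \<otimes> inv P = \<one>" using inv_nonzero[OF Pc] by (auto simp: P_def)
  define s where "s = inv a \<oplus> inv P"
  have sc: "s \<in> carrier R" using ia iP by (simp add: s_def)
  have "(a \<ominus> a \<otimes> a \<otimes> b) \<otimes> s = a \<otimes> (\<one> \<ominus> a \<otimes> b) \<otimes> s" using a b sc by algebra
  also have "\<dots> = a \<otimes> (b \<otimes> P) \<otimes> (inv a \<oplus> inv P)" by (simp only: bP s_def)
  also have "\<dots> = b \<otimes> ((a \<otimes> inv a) \<otimes> P \<oplus> a \<otimes> (P \<otimes> inv P))" using a b ia(1) iP(1) Pc by algebra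
  also have "\<dots> = b \<otimes> (P \<oplus> a)" using ia iP a Pc by simp
  also have "\<dots> = b \<otimes> inv b" unfolding P_def using a b ib(1) by algebra
  finally have e: "(a \<ominus> a \<otimes> a \<otimes> b) \<otimes> s = \<one>" using ib by simp
  show "inv a \<oplus> inv (inv b \<ominus> a) \<noteq> \<zero>"
  proof
    assume "inv a \<oplus> inv (inv b \<ominus> a) = \<zero>"
    then have "s = \<zero>" by (simp add: s_def P_def)
    then show False using e a b by simp
  qed
  have "s \<otimes> (a \<ominus> a \<otimes> a \<otimes> b) = \<one>" using e sc a b by (simp add: m_comm)
  then show "inv (inv a \<oplus> inv (inv b \<ominus> a)) = a \<ominus> a \<otimes> a \<otimes> b"
    unfolding s_def[symmetric] P_def[symmetric] using sc a b by (intro inv_eqI) auto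
qed

text \<open>Hua's identity expresses \<open>a - a a b\<close> by sums and inverses only, so
  \<open>h\<close> preserves the triple product \<open>a a b\<close>; ordinary products are
  recovered from it.\<close>

lemma additive_inverse_preserving_hom:
  assumes fin: "finite (carrier R)"
    and h: "h \<in> carrier R \<rightarrow> carrier R" "h \<one> = \<one>"
    and add: "\<And>x y. x \<in> carrier R \<Longrightarrow> y \<in> carrier R \<Longrightarrow> h (x \<oplus> y) = h x \<oplus> h y"
    and inj: "inj_on h (carrier R)"
    and hinv: "\<And>x. x \<in> carrier R \<Longrightarrow> x \<noteq> \<zero> \<Longrightarrow> h (inv x) = inv (h x)"
  shows "h \<in> ring_hom R R"
proof -
  have hc: "h x \<in> carrier R" if "x \<in> carrier R" for x using h that by auto
  have h0: "h \<zero> = \<zero>" using add[of \<zero> \<zero>] hc[of \<zero>] by simp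
  have hneg: "h (\<ominus> x) = \<ominus> h x" if "x \<in> carrier R" for x
    using add[of "\<ominus> x" x] that hc h0 by (metis a_inv_closed l_neg minus_equality)
  have hminus: "h (x \<ominus> y) = h x \<ominus> h y" if "x \<in> carrier R" "y \<in> carrier R" for x y
    using that by (simp add: a_minus_def add hneg)
  have hne: "h x \<noteq> \<zero>" if "x \<in> carrier R" "x \<noteq> \<zero>" for x
    using inj_onD[OF inj, of x \<zero>] h0 that by auto
  have sq: "h (a \<otimes> a \<otimes> b) = h a \<otimes> h a \<otimes> h b" if a: "a \<in> carrier R" and b: "b \<in> carrier R" for a b
  proof (cases "a = \<zero> \<or> b = \<zero>")
    case True then show ?thesis using a b h0 hc[OF a] hc[OF b] by (elim disjE) simp_all
  next
    case False
    then have n: "a \<noteq> \<zero>" "b \<noteq> \<zero>" by auto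
    note ia = inv_nonzero[OF a n(1)] and ib = inv_nonzero[OF b n(2)]
    note ha = hc[OF a] hne[OF a n(1)] and hb = hc[OF b] hne[OF b n(2)]
    show ?thesis
    proof (cases "a \<otimes> b = \<one>")
      \<comment> \<open>Hua's identity would require inverting \<open>1/b - a = 0\<close>; instead
        \<open>h b\<close> is directly the inverse of \<open>h a\<close>.\<close>
      case True
      then have "b = inv a" using inv_eqI a b by simp
      then have "h b = inv (h a)" using hinv a n by simp
      then have "h a \<otimes> h b = \<one>" using inv_nonzero[OF ha] by simp
      then show ?thesis using True a b hc by (simp add: m_assoc)
    next
      case False
      have AB: "h a \<otimes> h b \<noteq> \<one>"
      proof
        assume "h a \<otimes> h b = \<one>"
        then have "h b = inv (h a)" using inv_eqI ha hb by simp
        also have "\<dots> = h (inv a)" using hinv a n by simp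
        finally have "b = inv a" using inj_onD[OF inj] b ia by blast
        then show False using False ia by simp
      qed
      note 1 = hua_identity[OF a n(1) b n(2) False]
      note 2 = hua_identity[OF ha hb AB]
      define P where "P = inv b \<ominus> a"
      have P: "P \<in> carrier R" "P \<noteq> \<zero>" using 1(1) ib a by (auto simp: P_def)
      have hP: "h P = inv (h b) \<ominus> h a" unfolding P_def using hminus[OF ib(1) a] hinv[OF b n(2)] by simp
      have hs: "h (inv a \<oplus> inv P) = inv (h a) \<oplus> inv (h P)"
        using add[OF ia(1) inv_nonzero(1)[OF P]] hinv[OF a n(1)] hinv[OF P] by simp
      have "h (a \<ominus> a \<otimes> a \<otimes> b) = inv (h (inv a \<oplus> inv P))"
        using hinv[OF _ 1(2)] 1(3) ia inv_nonzero[OF P] unfolding P_def by simp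
      also have "\<dots> = h a \<ominus> h a \<otimes> h a \<otimes> h b" unfolding hs hP by (rule 2(3))
      finally have e: "h a \<ominus> h (a \<otimes> a \<otimes> b) = h a \<ominus> h a \<otimes> h a \<otimes> h b" using hminus a b by simp
      have c: "h (a \<otimes> a \<otimes> b) \<in> carrier R" "h a \<otimes> h a \<otimes> h b \<in> carrier R" using hc a b by auto
      have "h (a \<otimes> a \<otimes> b) = h a \<ominus> (h a \<ominus> h (a \<otimes> a \<otimes> b))" using c ha by algebra
      also have "\<dots> = h a \<otimes> h a \<otimes> h b" unfolding e using ha hb by algebra
      finally show ?thesis .
    qed
  qed
  have sq1: "h (a \<otimes> a) = h a \<otimes> h a" if "a \<in> carrier R" for a
    using sq[OF that one_closed] h(2) that hc by simp
  have mult: "h (a \<otimes> b) = h a \<otimes> h b" if a: "a \<in> carrier R" and b: "b \<in> carrier R" for a b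
  proof (cases "\<one> \<oplus> \<one> = \<zero>")
    case True
    \<comment> \<open>In characteristic 2 every element is a square, so \<open>sq\<close> suffices; otherwise polarise it.\<close>
    have "inj_on (\<lambda>c. c \<otimes> c) (carrier R)"
    proof (rule inj_onI)
      fix x y assume x: "x \<in> carrier R" and y: "y \<in> carrier R" and e: "x \<otimes> x = y \<otimes> y"
      have "(x \<ominus> y) \<otimes> (x \<ominus> y) = (x \<otimes> x \<ominus> y \<otimes> y) \<oplus> (\<one> \<oplus> \<one>) \<otimes> (y \<otimes> y \<ominus> x \<otimes> y)"
        using x y by algebra
      then have "(x \<ominus> y) \<otimes> (x \<ominus> y) = \<zero>" using e True x y by simp
      then have "x \<ominus> y = \<zero>" using integral x y by (metis minus_closed)
      then show "x = y" using x y by simp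
    qed
    then have "(\<lambda>c. c \<otimes> c) ` carrier R = carrier R" by (intro endo_inj_surj[OF fin]) auto
    then obtain c where c: "c \<in> carrier R" "a = c \<otimes> c" using a by (metis (no_types, lifting) imageE)
    show ?thesis unfolding c(2) using sq[OF c(1) b] sq1[OF c(1)] by simp
  next
    case False
    have a1: "a \<oplus> \<one> \<in> carrier R" using a by simp
    have c: "h a \<in> carrier R" "h b \<in> carrier R" "h (a \<otimes> b) \<in> carrier R" "h (a \<otimes> a \<otimes> b) \<in> carrier R"
      using hc a b by auto
    have "(a \<oplus> \<one>) \<otimes> (a \<oplus> \<one>) \<otimes> b = a \<otimes> a \<otimes> b \<oplus> (a \<otimes> b \<oplus> (a \<otimes> b \<oplus> b))" using a b by algebra
    then have "h a \<otimes> h a \<otimes> h b \<oplus> (h (a \<otimes> b) \<oplus> (h (a \<otimes> b) \<oplus> h b)) =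
        (h a \<oplus> \<one>) \<otimes> (h a \<oplus> \<one>) \<otimes> h b"
      using sq[OF a1 b] sq[OF a b] a b h(2) by (simp add: add)
    moreover define D where "D = h (a \<otimes> b) \<ominus> h a \<otimes> h b"
    moreover have "(\<one> \<oplus> \<one>) \<otimes> (h (a \<otimes> b) \<ominus> h a \<otimes> h b) =
      (h a \<otimes> h a \<otimes> h b \<oplus> (h (a \<otimes> b) \<oplus> (h (a \<otimes> b) \<oplus> h b))) \<ominus> (h a \<oplus> \<one>) \<otimes> (h a \<oplus> \<one>) \<otimes> h b"
      using c(1-3) by algebra
    ultimately have "(\<one> \<oplus> \<one>) \<otimes> D = \<zero>" "D \<in> carrier R" using c by simp_all
    then have "D = \<zero>" using False integral by blast
    then show ?thesis unfolding D_def using c by simp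
  qed
  show ?thesis by (rule ring_hom_memI) (use hc mult add h in auto)
qed

text \<open>If \<open>e \<mapsto> 1 / (h (c + 1/e) - h c)\<close> is additive, then \<open>h\<close> conjugates the translations of the
  projective line that fix \<open>c\<close> to those fixing \<open>h c\<close>; two such groups generate everything,
  so two base points suffice.\<close>

lemma projective_hom:
  assumes fin: "finite (carrier R)"
    and h: "h \<in> carrier R \<rightarrow> carrier R" "h \<zero> = \<zero>" "h \<one> = \<one>"
    and inj: "inj_on h (carrier R)"
    and psi: "\<And>c e. psi c e = (if e = \<zero> then \<zero> else inv (h (c \<oplus> inv e) \<ominus> h c))"
    and add: "\<And>c x y. c \<in> {\<zero>, \<one>} \<Longrightarrow> x \<in> carrier R \<Longrightarrow> y \<in> carrier R \<Longrightarrow>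
      psi c (x \<oplus> y) = psi c x \<oplus> psi c y"
  shows "h \<in> ring_hom R R"
proof -
  have hc: "h x \<in> carrier R" if "x \<in> carrier R" for x using h that by auto
  have hne: "h x \<noteq> \<zero>" if "x \<in> carrier R" "x \<noteq> \<zero>" for x
    using inj_onD[OF inj, of x \<zero>] h that by auto
  have hn1: "h x \<noteq> \<one>" if "x \<in> carrier R" "x \<noteq> \<one>" for x
    using inj_onD[OF inj, of x \<one>] h that by auto
  have psi0: "psi \<zero> e = inv (h (inv e))" if "e \<in> carrier R" "e \<noteq> \<zero>" for e
    using that inv_nonzero[OF that] h hc by (simp add: psi a_minus_def)
  have h_psi0: "h z = inv (psi \<zero> (inv z))" if "z \<in> carrier R" "z \<noteq> \<zero>" for z
    using psi0[of "inv z"] inv_nonzero[OF that] inv_nonzero[OF hc[OF that(1)] hne[OF that]] by simp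
  have psic: "psi c e \<in> carrier R" if c: "c \<in> carrier R" and e: "e \<in> carrier R" for c e
  proof (cases "e = \<zero>")
    case False
    have i: "inv e \<in> carrier R" "inv e \<noteq> \<zero>" using inv_nonzero[OF e False] by auto
    have "h (c \<oplus> inv e) \<ominus> h c \<noteq> \<zero>"
    proof
      assume "h (c \<oplus> inv e) \<ominus> h c = \<zero>"
      then have "h (c \<oplus> inv e) = h c" using hc i c by simp
      then have "c \<oplus> inv e = c" using inj_onD[OF inj] c i by blast
      then show False using c i by simp
    qed
    then show ?thesis using hc i c by (simp add: psi inv_nonzero)
  qed (simp add: psi)
  have psi_neg: "psi c (\<ominus> x) = \<ominus> psi c x" if c: "c \<in> {\<zero>, \<one>}" and x: "x \<in> carrier R" for c x
  proof -
    have "psi c (\<ominus> x) \<oplus> psi c x = \<zero>" using add[OF c, of "\<ominus> x" x] x by (simp add: l_neg psi)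
    then show ?thesis using psic c x by (intro minus_equality[symmetric]) auto
  qed
  have h_psi1: "h z = \<one> \<oplus> psi \<one> (z \<ominus> \<one>)" if z: "z \<in> carrier R" for z
  proof -
    consider "z = \<zero>" | "z = \<one>" | "z \<noteq> \<zero>" "z \<noteq> \<one>" by blast
    then show ?thesis
    proof cases
      case 1
      have "inv (\<zero> \<ominus> \<one>) = \<ominus> \<one>" 
        by (rule inv_eqI) (simp_all add: a_minus_def l_minus r_minus)
      moreover have "\<zero> \<ominus> \<one> \<noteq> \<zero>" 
        using r_right_minus_eq[of \<zero> \<one>] one_not_zero by auto
      ultimately have "psi \<one> (\<zero> \<ominus> \<one>) = inv (h (\<one> \<oplus> \<ominus> \<one>) \<ominus> h \<one>)" by (simp add: psi)
      also have "\<dots> = inv (\<zero> \<ominus> \<one>)" using h by (simp add: r_neg)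
      also have "\<dots> = \<ominus> \<one>" by fact
      finally show ?thesis using 1 h by (simp add: r_neg)
    next
      case 2
      then show ?thesis using h by (simp add: psi)
    next
      case 3
      note iz = inv_nonzero[OF z 3(1)]
      define w where "w = h z"
      have w: "w \<in> carrier R" "w \<noteq> \<zero>" "w \<noteq> \<one>" using hc hne hn1 z 3 by (auto simp: w_def)
      note iw = inv_nonzero[OF w(1,2)]
      define d where "d = z \<ominus> \<one>"
      have d: "d \<in> carrier R" "d \<noteq> \<zero>" using z 3 by (auto simp: d_def)
      note di = inv_nonzero[OF d]
      \<comment> \<open>\<open>t = z / (z - 1)\<close> links the two base points. At 0, additivity
        at \<open>1/t = 1 - 1/z\<close> gives \<open>h t = 1 / (1 - 1/w)\<close>, that is
        \<open>w / (w - 1)\<close>; at 1, \<open>psi\<close> at \<open>z - 1\<close> is by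
        definition \<open>1 / (h t - 1)\<close>, which is \<open>w - 1\<close>.\<close>
      define t where "t = \<one> \<oplus> inv d"
      have tc: "t \<in> carrier R" using di by (simp add: t_def)
      have tz: "t \<otimes> (\<one> \<ominus> inv z) = \<one>"
      proof -
        have td: "t \<otimes> d = z"
        proof -
          have "t \<otimes> d = d \<oplus> inv d \<otimes> d" unfolding t_def using di d by (simp add: l_distr)
          also have "\<dots> = d \<oplus> \<one>" using di by simp
          also have "\<dots> = z" unfolding d_def using z by algebra
          finally show ?thesis .
        qed
        have "\<one> \<ominus> inv z = d \<otimes> inv z"
        proof -
          have "d \<otimes> inv z = z \<otimes> inv z \<ominus> inv z" unfolding d_def using z iz(1) by algebra
          then show ?thesis using iz by simp
        qed
        then have "t \<otimes> (\<one> \<ominus> inv z) = (t \<otimes> d) \<otimes> inv z" using tc d iz by (simp add: m_assoc)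
        then show ?thesis unfolding td using iz by simp
      qed
      have t0: "t \<noteq> \<zero>" using tz iz by auto
      have it: "inv t = \<one> \<ominus> inv z" by (rule inv_eqI[OF tc _ tz]) (use iz in simp)
      have "psi \<zero> (\<one> \<ominus> inv z) = psi \<zero> \<one> \<oplus> psi \<zero> (\<ominus> (inv z))"
        using add[of \<zero> \<one> "\<ominus> (inv z)"] iz by (simp add: a_minus_def)
      also have "\<dots> = \<one> \<ominus> inv w"
        using psi_neg[of \<zero> "inv z"] psi0[of "inv z"] psi0[of \<one>] iz h by (simp add: a_minus_def w_def)
      finally have ht: "h t = inv (\<one> \<ominus> inv w)" using h_psi0[OF tc t0] it by simp
      define a where "a = inv (\<one> \<ominus> inv w)"
      have "inv w \<noteq> \<one>" using w iw by (metis inv_one)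
      then have n: "\<one> \<ominus> inv w \<in> carrier R" "\<one> \<ominus> inv w \<noteq> \<zero>" using iw by auto
      note ia = inv_nonzero[OF n, folded a_def]
      have "(a \<ominus> \<one>) \<otimes> (w \<ominus> \<one>) = a \<otimes> (w \<ominus> \<one>) \<ominus> (w \<ominus> \<one>)" using ia(1) w(1) by algebra
      also have "\<dots> = a \<otimes> (w \<ominus> w \<otimes> inv w) \<ominus> (w \<ominus> \<one>)" by (simp only: iw(3))
      also have "\<dots> = w \<otimes> (a \<otimes> (\<one> \<ominus> inv w)) \<ominus> (w \<ominus> \<one>)" using iw(1) ia(1) w(1) by algebra
      also have "\<dots> = \<one>" unfolding ia(4) using w(1) by algebra
      finally have "inv (a \<ominus> \<one>) = w \<ominus> \<one>" using ia w by (intro inv_eqI) auto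
      moreover have "psi \<one> d = inv (a \<ominus> \<one>)" using d ht h unfolding psi a_def t_def by simp
      ultimately have "psi \<one> (z \<ominus> \<one>) = w \<ominus> \<one>" by (simp add: d_def)
      moreover have "w = \<one> \<oplus> (w \<ominus> \<one>)" using w(1) by algebra
      ultimately show ?thesis by (simp add: w_def)
    qed
  qed
  \<comment> \<open>At \<open>z = 0\<close> the preceding formula gives the value -1 for
    \<open>psi\<close> at -1, and additivity at base point 1 then cancels both constants in
    it.\<close>
  have hpsi: "h z = psi \<one> z" if z: "z \<in> carrier R" for z
  proof -
    have p: "psi \<one> z \<in> carrier R" "psi \<one> (\<ominus> \<one>) \<in> carrier R" using psic z by auto
    have "\<one> \<oplus> psi \<one> (\<ominus> \<one>) = \<zero>" using h_psi1[of \<zero>] h by (simp add: a_minus_def)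
    moreover have "h z = psi \<one> z \<oplus> (\<one> \<oplus> psi \<one> (\<ominus> \<one>))"
      using h_psi1[OF z] add[of \<one> z "\<ominus> \<one>"] z p by (simp add: a_minus_def a_lcomm)
    ultimately show ?thesis using p by simp
  qed
  have hadd: "h (x \<oplus> y) = h x \<oplus> h y" if "x \<in> carrier R" "y \<in> carrier R" for x y
    using that add[of \<one> x y] by (simp add: hpsi)
  \<comment> \<open>Now \<open>h x\<close> is \<open>psi\<close> at base point 1, that is the
    inverse of \<open>h (1 + 1/x) - h 1\<close>, and \<open>h\<close> is additive.\<close>
  have "h (inv x) = inv (h x)" if x: "x \<in> carrier R" "x \<noteq> \<zero>" for x
  proof -
    note ix = inv_nonzero[OF x]
    have "h x = inv (h (\<one> \<oplus> inv x) \<ominus> h \<one>)" using hpsi[OF x(1)] x by (simp add: psi)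
    also have "h (\<one> \<oplus> inv x) \<ominus> h \<one> = h (inv x)"
      using hadd[OF one_closed ix(1)] h hc[OF ix(1)] by (simp add: a_minus_def a_ac r_neg2 r_neg1 r_neg)
    finally show ?thesis using inv_nonzero[OF hc[OF ix(1)] hne[OF ix(1,2)]] by simp
  qed
  then show ?thesis by (intro additive_inverse_preserving_hom fin h inj hadd)
qed

end

section \<open>The induced map on the residue field is an automorphism\<close>

context resp_map begin

text \<open>In the coordinate \<open>1 / (y - x)\<close> centred at \<open>x\<close> on the
  projective line over the residue field, \<open>f\<close> becomes \<open>psi x\<close>. A scalar in
  \<open>M\<close> is the coordinate of the point at infinity, which \<open>f\<close> is taken to
  fix; hence the value 0.\<close>

definition psi where
  "psi x e = (if e \<in> M then \<zero> else inv (f (x \<oplus> inv e) \<ominus> f x))"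

lemma psi_unit:
  assumes x: "x \<in> carrier R" and e: "e \<in> Units R"
  shows "f (x \<oplus> inv e) \<ominus> f x \<in> Units R"
proof -
  have "inv e \<in> Units R" "inv e \<in> carrier R" using e by auto
  moreover from this have "(x \<oplus> inv e) \<ominus> x = inv e" using x by algebra
  ultimately show ?thesis using f_minus_Units[of "x \<oplus> inv e" x] x by simp
qed

lemma psi_carrier: "x \<in> carrier R \<Longrightarrow> e \<in> carrier R \<Longrightarrow> psi x e \<in> carrier R"
  unfolding psi_def using psi_unit[of x e] UnitsI[of e] by auto

text \<open>Compare \<open>y = x + 1/e\<close> with \<open>x + v\<close>. Their difference is
  \<open>(1/e) (1 - e v)\<close>, so with \<open>d = f y - f x\<close> both
  \<open>f y - f (x + v) = d - incr x v\<close> and \<open>d (1 - e v)\<close> lie in its orbit.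
  Subtracting and dividing by \<open>d\<close> gives the claim.\<close>

lemma psi_incr:
  assumes x: "x \<in> carrier R" and e: "e \<in> carrier R" and v: "v \<in> V"
  shows "e \<otimes> v \<ominus> psi x e \<otimes> incr x v \<in> U"
proof (cases "e \<in> M")
  case True
  have "incr x v \<in> carrier R" using incr_closed x v V_carrier by simp
  then show ?thesis using True v by (simp add: psi_def V_M U_zero a_minus_def)
next
  case False
  then have eu: "e \<in> Units R" using e UnitsI by simp
  define y where "y = x \<oplus> inv e"
  define d where "d = f y \<ominus> f x"
  have i: "inv e \<in> Units R" "inv e \<in> carrier R" using eu by auto
  have vc: "v \<in> carrier R" "v \<in> M" using v V_carrier V_in_M by auto
  have yc: "y \<in> carrier R" using x i by (simp add: y_def)
  have fc: "f x \<in> carrier R" "f y \<in> carrier R" "f (x \<oplus> v) \<in> carrier R" using f_closed x yc vc by auto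
  have hc: "incr x v \<in> carrier R" "incr x v \<in> V" using incr_closed incr_ideal[OF V_ideal] x vc v by auto
  have du: "d \<in> Units R" "d \<in> carrier R" using psi_unit[OF x eu] by (auto simp: d_def y_def)
  have yx: "y \<ominus> x = inv e" unfolding y_def using x i by algebra
  have ev: "e \<otimes> v \<in> V" using e v by (simp add: V.I_l_closed)
  have evc: "e \<otimes> v \<in> carrier R" "e \<otimes> v \<in> M" using V_carrier V_in_M ev by auto
  have "y \<ominus> (x \<oplus> v) = inv e \<ominus> v" unfolding y_def using x i(2) vc(1) by algebra
  also have "\<dots> = inv e \<ominus> inv e \<otimes> (e \<otimes> v)" using Units_inv_cancel[OF eu vc(1)] by simp
  also have "\<dots> = inv e \<otimes> (\<one> \<ominus> e \<otimes> v)" using i evc by algebra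
  finally have k1: "kassoc (inv e \<otimes> (\<one> \<ominus> e \<otimes> v)) (f y \<ominus> f (x \<oplus> v))"
    using f_kassoc[of y "x \<oplus> v"] x yc vc by simp
  have k2: "kassoc (inv e \<otimes> (\<one> \<ominus> e \<otimes> v)) (d \<otimes> (\<one> \<ominus> e \<otimes> v))"
    unfolding d_def using f_kassoc[OF yc x] yx i evc by (intro kassoc_mult kassoc_refl) auto
  have u: "\<one> \<ominus> e \<otimes> v \<in> Units R" using Units_add_M[of \<one> "\<ominus> (e \<otimes> v)"] evc by (simp add: a_minus_def)
  have eq: "(f y \<ominus> f (x \<oplus> v)) \<ominus> d \<otimes> (\<one> \<ominus> e \<otimes> v) = d \<otimes> (e \<otimes> v) \<ominus> incr x v"
  proof -
    have "f y \<ominus> f (x \<oplus> v) = d \<ominus> incr x v" unfolding d_def incr_def using fc by algebra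
    moreover have "(d \<ominus> incr x v) \<ominus> d \<otimes> (\<one> \<ominus> e \<otimes> v) = d \<otimes> (e \<otimes> v) \<ominus> incr x v"
      using du hc(1) evc(1) by algebra
    ultimately show ?thesis by simp
  qed
  have "d \<otimes> (e \<otimes> v) \<ominus> incr x v \<in> V" 
    by (rule V.minus_closed[OF V.I_l_closed[OF ev du(2)] hc(2)])
  then have "d \<otimes> (e \<otimes> v) \<ominus> incr x v \<in> scaled (d \<otimes> (\<one> \<ominus> e \<otimes> v))"
    using kassoc_diff_scaled[OF _ k2 k1] i u unfolding eq by simp
  also have "scaled (d \<otimes> (\<one> \<ominus> e \<otimes> v)) = scaled d"
  proof (rule scaled_cong)
    have "d \<otimes> (\<one> \<ominus> e \<otimes> v) \<ominus> d = \<ominus> (d \<otimes> (e \<otimes> v))" using du evc by algebra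
    then show "d \<otimes> (\<one> \<ominus> e \<otimes> v) \<ominus> d \<in> M" using du evc by (simp add: M.I_l_closed)
  qed (use du u in auto)
  finally have "inv d \<otimes> (d \<otimes> (e \<otimes> v) \<ominus> incr x v) \<in> U" by (rule scaled_one_div[OF du(1)])
  moreover have "inv d \<otimes> (d \<otimes> (e \<otimes> v) \<ominus> incr x v) = inv d \<otimes> (d \<otimes> (e \<otimes> v)) \<ominus> inv d \<otimes> incr x v"
    using du hc(1) evc(1) Units_inv_closed[OF du(1)] by algebra
  ultimately have "e \<otimes> v \<ominus> inv d \<otimes> incr x v \<in> U" using Units_inv_cancel[OF du(1) evc(1)] by simp
  then show ?thesis using False by (simp add: psi_def d_def y_def)
qed

lemma incr_V_surj:
  assumes x: "x \<in> carrier R" and w: "w \<in> V"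
  obtains v where "v \<in> V" "incr x v = w"
proof -
  have "inj_on (incr x) V"
  proof (rule inj_onI)
    fix v v' assume v: "v \<in> V" "v' \<in> V" "incr x v = incr x v'"
    have c: "v \<in> carrier R" "v' \<in> carrier R" using v V_carrier by auto
    then have fc: "f x \<in> carrier R" "f (x \<oplus> v) \<in> carrier R" "f (x \<oplus> v') \<in> carrier R" using f_closed x by auto
    have "f (x \<oplus> v) = incr x v \<oplus> f x" "f (x \<oplus> v') = incr x v' \<oplus> f x" unfolding incr_def using fc by algebra+
    then have "x \<oplus> v = x \<oplus> v'" using v(3) inj_onD[OF resp_inj[OF resp_f]] x c by simp
    then show "v = v'" using x c by simp
  qed
  moreover have "finite V" by (rule finite_subset[OF _ finite_carrier]) (use V_carrier in blast)
  moreover have "incr x ` V \<subseteq> V" using incr_ideal[OF V_ideal x] by auto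
  ultimately have "incr x ` V = V" by (intro endo_inj_surj)
  then show thesis using that w by (metis imageE)
qed

text \<open>In \<open>psi_incr\<close> the term \<open>e v\<close> is additive in \<open>e\<close>.
  If the error \<open>w\<close> of \<open>psi x\<close> were a unit, then \<open>w t\<close> would
  lie in \<open>U\<close> for every \<open>t\<close> in \<open>V\<close>, as each \<open>t\<close>
  is an increment; then \<open>V\<close> would be contained in \<open>U\<close>, which purity
  excludes for \<open>V\<close> nonzero.\<close>

lemma psi_add:
  assumes V: "V \<noteq> {\<zero>}" and x: "x \<in> carrier R" and a: "a \<in> carrier R" and b: "b \<in> carrier R"
  shows "psi x (a \<oplus> b) \<ominus> (psi x a \<oplus> psi x b) \<in> M"
proof (rule ccontr)
  define w where "w = psi x (a \<oplus> b) \<ominus> (psi x a \<oplus> psi x b)"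
  assume "psi x (a \<oplus> b) \<ominus> (psi x a \<oplus> psi x b) \<notin> M"
  moreover have pc: "psi x (a \<oplus> b) \<in> carrier R" "psi x a \<in> carrier R" "psi x b \<in> carrier R"
    using psi_carrier x a b by auto
  ultimately have w: "w \<in> Units R" "w \<in> carrier R" using UnitsI by (auto simp: w_def)
  have wU: "w \<otimes> t \<in> U" if t: "t \<in> V" for t
  proof -
    obtain v where v: "v \<in> V" "incr x v = t" using incr_V_surj[OF x t] .
    have c: "v \<in> carrier R" "t \<in> carrier R" using v t V_carrier by auto
    have "w \<otimes> t = ((a \<otimes> v \<ominus> psi x a \<otimes> t) \<oplus> (b \<otimes> v \<ominus> psi x b \<otimes> t)) \<oplus> \<ominus> ((a \<oplus> b) \<otimes> v \<ominus> psi x (a \<oplus> b) \<otimes> t)"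
      unfolding w_def using pc a b c by algebra
    then show ?thesis
      using psi_incr[OF x a v(1)] psi_incr[OF x b v(1)] psi_incr[OF x _ v(1), of "a \<oplus> b"] a b v(2)
      by (simp add: U_add U_neg)
  qed
  have "t = \<zero>" if t: "t \<in> V" for t
  proof (rule pure_mult[OF t])
    fix c assume c: "c \<in> Units R"
    have cc: "c \<in> carrier R" "inv w \<in> carrier R" "t \<in> carrier R" using c w t V_carrier by auto
    have "w \<otimes> (inv w \<otimes> (c \<otimes> t)) \<in> U" using wU t cc by (simp add: V.I_l_closed)
    then show "c \<otimes> t \<in> U" using Units_inv_cancel[OF w(1)] cc by simp
  qed
  then show False using V V.zero_closed by blast
qed

lemma pi_inv: assumes "u \<in> Units R" shows "inv\<^bsub>F\<^esub> (\<pi> u) = \<pi> (inv u)"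
proof -
  interpret F: field F by (rule field_F)
  interpret h: ring_hom_cring R F "(+>) M" by (rule pi_hom)
  have "\<pi> u \<otimes>\<^bsub>F\<^esub> \<pi> (inv u) = \<pi> (u \<otimes> inv u)" using assms Units_closed by (simp del: Units_r_inv)
  then have "\<pi> u \<otimes>\<^bsub>F\<^esub> \<pi> (inv u) = \<one>\<^bsub>F\<^esub>" using assms by simp
  then show ?thesis using assms Units_closed by (intro F.inv_eqI) auto
qed

text \<open>\<open>f\<close> preserves congruence modulo \<open>M\<close>, so it induces a map of
  the residue field to which \<open>projective_hom\<close> applies; \<open>psi_add\<close> holds at
  every base point, in particular at 0 and 1. The representatives chosen by \<open>r\<close>
  disappear once \<open>phi\<close> is proved.\<close>

theorem residual_hom:
  assumes V: "V \<noteq> {\<zero>}" and x: "x \<in> carrier R" and y: "y \<in> carrier R"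
  shows "f (x \<oplus> y) \<ominus> (f x \<oplus> f y) \<in> M" and "f (x \<otimes> y) \<ominus> f x \<otimes> f y \<in> M"
proof -
  interpret F: field F by (rule field_F)
  interpret h: ring_hom_cring R F "(+>) M" by (rule pi_hom)
  define r where "r C = (SOME x. x \<in> carrier R \<and> \<pi> x = C)" for C
  define \<phi> where "\<phi> C = \<pi> (f (r C))" for C
  have r: "r (\<pi> x) \<in> carrier R" "\<pi> (r (\<pi> x)) = \<pi> x" if "x \<in> carrier R" for x
    using someI[of "\<lambda>y. y \<in> carrier R \<and> \<pi> y = \<pi> x" x] that by (auto simp: r_def)
  have phi: "\<phi> (\<pi> x) = \<pi> (f x)" if x: "x \<in> carrier R" for x
  proof -
    have "r (\<pi> x) \<ominus> x \<in> M" using pi_eq r[OF x] x by blast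
    then have "f (r (\<pi> x)) \<ominus> f x \<in> M" using f_minus_ideal[OF M_ideal] r[OF x] x by blast
    then show ?thesis unfolding \<phi>_def using pi_eq r[OF x] x f_closed by blast
  qed
  define ps where "ps c e = (if e = \<zero>\<^bsub>F\<^esub> then \<zero>\<^bsub>F\<^esub> else inv\<^bsub>F\<^esub> (\<phi> (c \<oplus>\<^bsub>F\<^esub> inv\<^bsub>F\<^esub> e) \<ominus>\<^bsub>F\<^esub> \<phi> c))" for c e
  have ps: "ps (\<pi> x) (\<pi> e) = \<pi> (psi x e)" if x: "x \<in> carrier R" and e: "e \<in> carrier R" for x e
  proof (cases "e \<in> M")
    case True
    then show ?thesis using e by (simp add: ps_def psi_def pi_zero)
  next
    case False
    then have eu: "e \<in> Units R" using e UnitsI by simp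
    have ne: "\<pi> e \<noteq> \<zero>\<^bsub>F\<^esub>" using e False by (simp add: pi_zero)
    have i: "inv e \<in> carrier R" using eu by simp
    have fc: "f (x \<oplus> inv e) \<in> carrier R" "f x \<in> carrier R" using f_closed x i by auto
    have "\<phi> (\<pi> x \<oplus>\<^bsub>F\<^esub> inv\<^bsub>F\<^esub> (\<pi> e)) = \<pi> (f (x \<oplus> inv e))"
      using phi[of "x \<oplus> inv e"] x i pi_inv[OF eu] by simp
    then have "\<phi> (\<pi> x \<oplus>\<^bsub>F\<^esub> inv\<^bsub>F\<^esub> (\<pi> e)) \<ominus>\<^bsub>F\<^esub> \<phi> (\<pi> x) = \<pi> (f (x \<oplus> inv e) \<ominus> f x)"
      using phi[OF x] fc by (simp add: a_minus_def)
    then show ?thesis using ne False pi_inv[OF psi_unit[OF x eu]] by (simp add: ps_def psi_def)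
  qed
  have phi_hom: "\<phi> \<in> ring_hom F F"
  proof (rule F.projective_hom[where psi = ps])
    show "finite (carrier F)" by (rule finite_F)
    show "\<phi> \<in> carrier F \<rightarrow> carrier F" unfolding carrier_F using phi f_closed by auto
    show "\<phi> \<zero>\<^bsub>F\<^esub> = \<zero>\<^bsub>F\<^esub>" using phi[of \<zero>] f_zero by simp
    show "\<phi> \<one>\<^bsub>F\<^esub> = \<one>\<^bsub>F\<^esub>" using phi[of \<one>] f_one by simp
    show "inj_on \<phi> (carrier F)"
    proof (rule inj_onI)
      fix C D assume "C \<in> carrier F" "D \<in> carrier F" and e: "\<phi> C = \<phi> D"
      then obtain x y where x: "x \<in> carrier R" "C = \<pi> x" and y: "y \<in> carrier R" "D = \<pi> y"
        by (auto simp: carrier_F)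
      then have "f x \<ominus> f y \<in> M" using e phi pi_eq f_closed by simp
      then have "x \<ominus> y \<in> M"
        using f_minus_Units_iff[OF x(1) y(1)] UnitsI[of "x \<ominus> y"] not_Units_M x y by auto
      then show "C = D" using x y pi_eq by simp
    qed
    show "ps c e = (if e = \<zero>\<^bsub>F\<^esub> then \<zero>\<^bsub>F\<^esub> else inv\<^bsub>F\<^esub> (\<phi> (c \<oplus>\<^bsub>F\<^esub> inv\<^bsub>F\<^esub> e) \<ominus>\<^bsub>F\<^esub> \<phi> c))" for c e
      by (simp add: ps_def)
    fix c C D assume c: "c \<in> {\<zero>\<^bsub>F\<^esub>, \<one>\<^bsub>F\<^esub>}" and "C \<in> carrier F" "D \<in> carrier F"
    then obtain a b where a: "a \<in> carrier R" "C = \<pi> a" and b: "b \<in> carrier R" "D = \<pi> b"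
      by (auto simp: carrier_F)
    obtain x where x: "x \<in> carrier R" "c = \<pi> x" using c h.hom_zero h.hom_one by (metis insertE singletonD zero_closed one_closed)
    have "\<pi> (psi x (a \<oplus> b)) = \<pi> (psi x a \<oplus> psi x b)"
      by (subst pi_eq) (use psi_add[OF V x(1) a(1) b(1)] psi_carrier x a b in auto)
    then show "ps c (C \<oplus>\<^bsub>F\<^esub> D) = ps c C \<oplus>\<^bsub>F\<^esub> ps c D"
      using ps[OF x(1), of "a \<oplus> b"] ps[OF x(1) a(1)] ps[OF x(1) b(1)] psi_carrier x a b by simp
  qed
  have "\<pi> (f (x \<oplus> y)) = \<pi> (f x \<oplus> f y)"
    using ring_hom_add[OF phi_hom h.hom_closed[OF x] h.hom_closed[OF y]] phi[of "x \<oplus> y"] phi[OF x] phi[OF y] x y f_closed by simp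
  then show "f (x \<oplus> y) \<ominus> (f x \<oplus> f y) \<in> M" by (subst pi_eq[symmetric]) (use f_closed x y in simp_all)
  have "\<pi> (f (x \<otimes> y)) = \<pi> (f x \<otimes> f y)"
    using ring_hom_mult[OF phi_hom h.hom_closed[OF x] h.hom_closed[OF y]] phi[of "x \<otimes> y"] phi[OF x] phi[OF y] x y f_closed by simp
  then show "f (x \<otimes> y) \<ominus> f x \<otimes> f y \<in> M" by (subst pi_eq[symmetric]) (use f_closed x y in simp_all)
qed

end

section \<open>Uniqueness of the lift\<close>

context lift_map begin

text \<open>The difference \<open>d\<close> of the two maps is additive with values in
  \<open>V\<close>, and \<open>d x\<close> lies in \<open>f x\<close> times \<open>U\<close> for
  units \<open>x\<close>. Once \<open>d\<close> vanishes on \<open>M\<close>, all its difference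
  quotients along \<open>f\<close> lie in \<open>U\<close>, so it is \<open>f x\<close> times a
  constant; that constant is \<open>d 1 = 0\<close>.\<close>

theorem hom_unique:
  assumes g: "g \<in> ring_hom R R" "resp g" and V: "\<And>x. x \<in> carrier R \<Longrightarrow> g x \<ominus> f x \<in> V"
    and x: "x \<in> carrier R"
  shows "g x = f x"
proof -
  define d where "d x = g x \<ominus> f x" for x
  have gc: "g x \<in> carrier R" if "x \<in> carrier R" for x using g(1) that by (rule ring_hom_closed)
  have gadd: "g (x \<oplus> y) = g x \<oplus> g y" if "x \<in> carrier R" "y \<in> carrier R" for x y
    using ring_hom_add[OF g(1) that] .
  have gmult: "g (x \<otimes> y) = g x \<otimes> g y" if "x \<in> carrier R" "y \<in> carrier R" for x y
    using ring_hom_mult[OF g(1) that] .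
  have fmult: "f (x \<otimes> y) = f x \<otimes> f y" if "x \<in> carrier R" "y \<in> carrier R" for x y
    using ring_hom_mult[OF f_ring_hom that] .
  have g1: "g \<one> = \<one>" using ring_hom_one[OF g(1)] .
  have g0: "g \<zero> = \<zero>" using gadd[of \<zero> \<zero>] gc[of \<zero>] by simp
  have gk: "kassoc x (g x)" if x: "x \<in> carrier R" for x
  proof -
    have "kassoc (x \<ominus> \<zero>) (g x \<ominus> g \<zero>)" using g(2) x unfolding resp_def by blast
    then show ?thesis using g0 x gc by (simp add: a_minus_def)
  qed
  have dV: "d x \<in> V" if "x \<in> carrier R" for x unfolding d_def by (rule V[OF that])
  have dadd: "d (x \<oplus> y) = d x \<oplus> d y" if "x \<in> carrier R" "y \<in> carrier R" for x y
  proof -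
    have "g x \<in> carrier R" "g y \<in> carrier R" "f x \<in> carrier R" "f y \<in> carrier R" using gc f_closed that by auto
    then show ?thesis unfolding d_def gadd[OF that] f_add[OF that] by algebra
  qed
  have dunit: "d x \<in> scaled (f x)" if x: "x \<in> Units R" for x
    using kassoc_diff_scaled[OF x f_kassoc0 gk V] x by (simp add: d_def Units_closed)
  have d1: "d \<one> = \<zero>" unfolding d_def using g1 f_one by simp
  have dMU: "d r \<in> U" if r: "r \<in> M" for r
  proof -
    have rc: "r \<in> carrier R" using r M.Icarr by simp
    have fr: "f r \<in> M" "f r \<in> carrier R" using f_M r M.Icarr by auto
    have "d (\<one> \<oplus> r) \<in> scaled (f (\<one> \<oplus> r))" using dunit Units_add_M r by simp
    also have "scaled (f (\<one> \<oplus> r)) = scaled \<one>"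
    proof (rule scaled_cong)
      have "f (\<one> \<oplus> r) \<ominus> \<one> = f r" unfolding f_add[OF one_closed rc] f_one using fr by algebra
      then show "f (\<one> \<oplus> r) \<ominus> \<one> \<in> M" using fr by simp
    qed (use f_closed rc in auto)
    also have "d (\<one> \<oplus> r) = d r" using dadd[OF one_closed rc] d1 dV[OF rc] V_carrier by simp
    finally show ?thesis by (simp add: scaled_one)
  qed
  have dM: "d r = \<zero>" if r: "r \<in> M" for r
  proof (rule pure_mult)
    have rc: "r \<in> carrier R" using r M.Icarr by simp
    show "d r \<in> V" using dV rc by simp
    fix c assume c: "c \<in> Units R"
    obtain u where u: "u \<in> carrier R" "f u = c" using f_surj c by blast
    have gr: "g r \<in> M" "g r \<in> carrier R" using kassoc_ideal[OF M_ideal r gk[OF rc]] M.Icarr by auto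
    have cl: "g u \<in> carrier R" "f u \<in> carrier R" "f r \<in> carrier R" using gc f_closed u rc by auto
    \<comment> \<open>Leibniz rule for a difference of two homomorphisms. The first term dies since
      \<open>g r\<close> is in \<open>M\<close>, so \<open>U\<close> contains every unit multiple of
      \<open>d r\<close>.\<close>
    have "d (u \<otimes> r) = d u \<otimes> g r \<oplus> f u \<otimes> d r"
      unfolding d_def gmult[OF u(1) rc] fmult[OF u(1) rc] using cl gr(2) by algebra
    also have "d u \<otimes> g r = \<zero>" using V_M'[OF dV[OF u(1)] gr(1)] .
    finally have "d (u \<otimes> r) = c \<otimes> d r" using u cl V_carrier[OF dV[OF rc]] by simp
    then show "c \<otimes> d r \<in> U" using dMU[of "u \<otimes> r"] u r by (simp add: M.I_l_closed)
  qed
  have ds: "d x \<ominus> d y \<in> scaled (f x \<ominus> f y)" if x: "x \<in> carrier R" and y: "y \<in> carrier R" for x y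
  proof -
    define z where "z = x \<ominus> y"
    have z: "z \<in> carrier R" "x = z \<oplus> y" using x y unfolding z_def by (simp, algebra)
    have cl: "d z \<in> carrier R" "d y \<in> carrier R" "f z \<in> carrier R" "f y \<in> carrier R"
      using dV z y V_carrier f_closed by auto
    have 1: "d x \<ominus> d y = d z" unfolding z(2) dadd[OF z(1) y] using cl by algebra
    have 2: "f x \<ominus> f y = f z" unfolding z(2) f_add[OF z(1) y] using cl by algebra
    show ?thesis unfolding 1 2
    proof (cases "z \<in> M")
      case True
      then show "d z \<in> scaled (f z)" using dM scaled_zero cl by simp
    next
      case False
      then show "d z \<in> scaled (f z)" using dunit UnitsI z by simp
    qed
  qed
  obtain u where u: "u \<in> U" "\<And>x. x \<in> carrier R \<Longrightarrow> d x = f x \<otimes> u"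
    using aff_along_f[of d, OF _ ds dM[OF M.zero_closed]] dV by (metis Pi_I)
  have "u = \<zero>" using u(2)[of \<one>] d1 f_one U_carrier[OF u(1)] by simp
  then have "d x = \<zero>" using u(2)[OF x] f_closed[OF x] by simp
  then show ?thesis unfolding d_def using gc f_closed x by simp
qed

end

section \<open>Descent along the chain of quotients\<close>

lemma (in ideal) carrier_quotient: "carrier (R Quot I) = (\<lambda>x. I +> x) ` carrier R"
  by (auto simp: FactRing_simps)

context finite_local_ring begin

lemma rad_eq: "rad R = M"
  unfolding rad_def
proof (rule the_equality[where P = "\<lambda>M. maximalideal M R", OF maximalideal_M])
  fix N assume N: "maximalideal N R"
  interpret N: maximalideal N R by (rule N)
  have "N \<subseteq> M"
  proof
    fix x assume x: "x \<in> N"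
    show "x \<in> M"
    proof (rule ccontr)
      assume "x \<notin> M"
      then have u: "x \<in> Units R" using x N.Icarr UnitsI by blast
      then have "inv x \<otimes> x \<in> N" using x by (blast intro: N.I_l_closed)
      then show False using u N.one_imp_carrier N.I_notcarr by simp
    qed
  qed
  then show "N = M" using N.I_maximal[OF M_ideal] M.a_subset one_notin_M by blast
qed

lemma I0_eq: "I0 R = {x \<in> M. \<forall>y \<in> M. x \<otimes> y = \<zero>}"
  by (simp add: I0_def rad_eq)

text \<open>Among the \<open>x \<in> M - J\<close>, one with \<open>J + x R\<close> of least cardinality is
  annihilated by \<open>M\<close> modulo \<open>J\<close>.\<close>

lemma exists_annihilated:
  assumes J: "ideal J R" "J \<subseteq> M" "J \<noteq> M"
  shows "\<exists>x\<in>M - J. \<forall>y\<in>M. x \<otimes> y \<in> J"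
proof -
  interpret J: ideal J R by (rule J)
  define A where "A x = {x \<otimes> r \<oplus> j | r j. r \<in> carrier R \<and> j \<in> J}" for x
  have ex: "\<exists>x. x \<in> M - J" using J by blast
  obtain x where x: "x \<in> M - J" and least: "\<And>y. y \<in> M - J \<Longrightarrow> card (A x) \<le> card (A y)"
    using ex_has_least_nat[of "\<lambda>x. x \<in> M - J" _ "\<lambda>x. card (A x)"] ex by blast
  have xc: "x \<in> carrier R" using x M.Icarr by blast
  have "x \<otimes> y \<in> J" if y: "y \<in> M" for y
  proof (rule ccontr)
    assume n: "x \<otimes> y \<notin> J"
    have yc: "y \<in> carrier R" using y M.Icarr by blast
    have xy: "x \<otimes> y \<in> M - J" using n y xc by (simp add: M.I_l_closed)
    have sub: "A (x \<otimes> y) \<subseteq> A x"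
    proof
      fix z assume "z \<in> A (x \<otimes> y)"
      then obtain r j where r: "r \<in> carrier R" "j \<in> J" "z = (x \<otimes> y) \<otimes> r \<oplus> j" by (auto simp: A_def)
      then have "z = x \<otimes> (y \<otimes> r) \<oplus> j" using xc yc by (simp add: m_assoc)
      then show "z \<in> A x" unfolding A_def using r yc by blast
    qed
    have "A x \<subseteq> carrier R" using xc J.Icarr by (auto simp: A_def)
    then have "finite (A x)" using finite_carrier finite_subset by blast
    then have eq: "A (x \<otimes> y) = A x" using sub least[OF xy] by (simp add: card_seteq)
    have "x = x \<otimes> \<one> \<oplus> \<zero>" using xc by simp
    then have "x \<in> A x" unfolding A_def using J.zero_closed by blast
    then obtain r j where r: "r \<in> carrier R" "j \<in> J" "x = (x \<otimes> y) \<otimes> r \<oplus> j"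
      unfolding eq[symmetric] by (auto simp: A_def)
    have jc: "j \<in> carrier R" using r J.Icarr by simp
    \<comment> \<open>The argument of Nakayama's lemma: \<open>x\<close> is a multiple of
      \<open>x y\<close> modulo \<open>J\<close>, so the unit \<open>1 - y r\<close> sends
      \<open>x\<close> into \<open>J\<close>.\<close>
    have "x \<otimes> (\<one> \<ominus> y \<otimes> r) = x \<ominus> (x \<otimes> y) \<otimes> r" using xc yc r(1) by algebra
    also have "\<dots> = ((x \<otimes> y) \<otimes> r \<oplus> j) \<ominus> (x \<otimes> y) \<otimes> r" using r(3) by simp
    also have "\<dots> = j" using xc yc r(1) jc by algebra
    finally have xj: "x \<otimes> (\<one> \<ominus> y \<otimes> r) = j" .
    have u: "\<one> \<ominus> y \<otimes> r \<in> Units R"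
      using Units_add_M[of \<one> "\<ominus> (y \<otimes> r)"] y r by (simp add: a_minus_def M.I_r_closed)
    then have "x = j \<otimes> inv (\<one> \<ominus> y \<otimes> r)" unfolding xj[symmetric]
      using xc Units_closed[OF u] by (simp add: m_assoc)
    then have "x \<in> J" using r u by (simp add: J.I_r_closed)
    then show False using x by blast
  qed
  then show ?thesis using x by blast
qed

end

text \<open>A non-unit generates a proper ideal. By finiteness some proper ideal above it is
  maximal, and locality makes that ideal \<open>rad R\<close>.\<close>

lemma (in cring) finite_local_ring_rad:
  assumes fin: "finite (carrier R)" and loc: "local_ring R"
  shows "finite_local_ring R (rad R)"
proof -
  have max: "maximalideal (rad R) R" unfolding rad_def using loc unfolding local_ring_def by (rule theI')
  have uniq: "N = rad R" if "maximalideal N R" for N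
    using loc max that unfolding local_ring_def by blast
  interpret m: maximalideal "rad R" R by (rule max)
  show ?thesis
  proof (unfold_locales)
    show "finite (carrier R)" by (rule fin)
    show "\<one> \<notin> rad R" using m.one_imp_carrier m.I_notcarr by auto
    fix x assume x: "x \<in> carrier R" and n: "x \<notin> rad R"
    show "x \<in> Units R"
    proof (rule ccontr)
      assume nu: "x \<notin> Units R"
      define A where "A = {J. ideal J R \<and> x \<in> J \<and> \<one> \<notin> J}"
      have "A \<subseteq> Pow (carrier R)" by (auto simp: A_def dest: ideal.Icarr)
      then have fA: "finite A" by (rule finite_subset) (simp add: fin)
      have "\<one> \<notin> PIdl x"
      proof
        assume "\<one> \<in> PIdl x"
        then obtain y where "y \<in> carrier R" "\<one> = y \<otimes> x" by (auto simp: cgenideal_def)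
        then show False using nu x unfolding Units_def by (auto simp: m_comm)
      qed
      then have "PIdl x \<in> A" unfolding A_def using cgenideal_ideal cgenideal_self x by blast
      then obtain N where N: "N \<in> A" "\<And>J. J \<in> A \<Longrightarrow> N \<subseteq> J \<Longrightarrow> N = J"
        using finite_has_maximal[OF fA] by blast
      have "maximalideal N R"
      proof (rule maximalidealI)
        show "ideal N R" "carrier R \<noteq> N" using N by (auto simp: A_def)
        fix J assume J: "ideal J R" "N \<subseteq> J" "J \<subseteq> carrier R"
        show "J = N \<or> J = carrier R"
        proof (cases "\<one> \<in> J")
          case True then show ?thesis using ideal.one_imp_carrier[OF J(1)] by simp
        next
          case False
          then have "J \<in> A" using J N by (auto simp: A_def)
          then show ?thesis using N(2) J by blast
        qed
      qed
      then have "N = rad R" by (rule uniq)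
      then show False using N n by (auto simp: A_def)
    qed
  qed
qed

section \<open>Quotients of a finite local ring\<close>

locale local_quotient = finite_local_ring +
  fixes J
  assumes J_ideal: "ideal J R" and J_sub: "J \<subseteq> M"
begin

sublocale J: ideal J R by (rule J_ideal)

abbreviation "S \<equiv> R Quot J"
abbreviation "q x \<equiv> J +> x"

sublocale q: ring_hom_cring R S "(+>) J"
  using J.rcos_ring_hom_cring by (simp add: is_cring)

lemma q_eq: "a \<in> carrier R \<Longrightarrow> b \<in> carrier R \<Longrightarrow> q a = q b \<longleftrightarrow> a \<ominus> b \<in> J"
  using quotient_eq_iff_same_a_r_cos[OF J_ideal] by blast

lemma q_zero: "a \<in> carrier R \<Longrightarrow> q a = \<zero>\<^bsub>S\<^esub> \<longleftrightarrow> a \<in> J"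
  using q_eq[of a \<zero>] by (simp add: a_minus_def)

lemma q_minus: "a \<in> carrier R \<Longrightarrow> b \<in> carrier R \<Longrightarrow> q (a \<ominus> b) = q a \<ominus>\<^bsub>S\<^esub> q b"
  by (simp add: a_minus_def)

lemma carrier_S: "carrier S = (\<lambda>x. q x) ` carrier R"
  by (rule J.carrier_quotient)

lemma q_image_mem:
  assumes A: "ideal A R" "J \<subseteq> A" and x: "x \<in> carrier R"
  shows "q x \<in> (\<lambda>x. q x) ` A \<longleftrightarrow> x \<in> A"
proof
  interpret A: ideal A R by (rule A)
  assume "q x \<in> (\<lambda>x. q x) ` A"
  then obtain a where a: "a \<in> A" "q x = q a" by blast
  then have ac: "a \<in> carrier R" using A.Icarr by simp
  have "x \<ominus> a \<in> A" using a q_eq x ac A by blast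
  then have "(x \<ominus> a) \<oplus> a \<in> A" using a by simp
  moreover have "(x \<ominus> a) \<oplus> a = x" using x ac by algebra
  ultimately show "x \<in> A" by simp
qed simp

lemma q_Units:
  assumes "u \<in> Units R" shows "q u \<in> Units S" "inv\<^bsub>S\<^esub> (q u) = q (inv u)"
proof -
  have c: "u \<in> carrier R" "inv u \<in> carrier R" using assms by auto
  have "q u \<otimes>\<^bsub>S\<^esub> q (inv u) = q (u \<otimes> inv u)" using c by simp
  then have e: "q u \<otimes>\<^bsub>S\<^esub> q (inv u) = \<one>\<^bsub>S\<^esub>" using assms by simp
  then show "inv\<^bsub>S\<^esub> (q u) = q (inv u)" using c by (intro q.S.comm_inv_char) auto
  have "q (inv u) \<otimes>\<^bsub>S\<^esub> q u = \<one>\<^bsub>S\<^esub>" using e c by (simp add: q.S.m_comm)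
  then show "q u \<in> Units S" unfolding Units_def using e c by auto
qed

lemma quotient_local: "finite_local_ring S ((\<lambda>x. q x) ` M)"
proof (intro finite_local_ring.intro finite_local_ring_axioms.intro)
  show "cring S" by (rule q.S.is_cring)
  show "finite (carrier S)" unfolding carrier_S using finite_carrier by simp
  show "ideal ((\<lambda>x. q x) ` M) S" by (rule ring_ideal_imp_quot_ideal[OF J_ideal M_ideal])
  have "q \<one> \<notin> (\<lambda>x. q x) ` M" using q_image_mem[OF M_ideal J_sub] one_notin_M by blast
  then show "\<one>\<^bsub>S\<^esub> \<notin> (\<lambda>x. q x) ` M" by simp
  fix C assume "C \<in> carrier S" "C \<notin> (\<lambda>x. q x) ` M"
  then obtain x where "x \<in> carrier R" "C = q x" "x \<notin> M" by (auto simp: carrier_S)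
  then show "C \<in> Units S" using q_Units UnitsI by simp
qed

lemma I0_quotient: "I0 S = (\<lambda>x. q x) ` {x \<in> M. \<forall>y\<in>M. x \<otimes> y \<in> J}"
proof -
  interpret S: finite_local_ring S "(\<lambda>x. q x) ` M" by (rule quotient_local)
  have "q x \<otimes>\<^bsub>S\<^esub> q y = \<zero>\<^bsub>S\<^esub> \<longleftrightarrow> x \<otimes> y \<in> J" if "x \<in> M" "y \<in> M" for x y
    using q_zero[of "x \<otimes> y"] that M.Icarr by simp
  then show ?thesis unfolding S.I0_eq by auto
qed

text \<open>The value goes through an arbitrary representative; \<open>lift_q\<close> removes the
  choice for maps that preserve congruence modulo \<open>J\<close>.\<close>

definition lift where "lift f C = q (f (SOME x. x \<in> carrier R \<and> q x = C))"

lemma lift_q: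
  assumes f: "f \<in> carrier R \<rightarrow> carrier R"
    and fJ: "\<And>x y. x \<in> carrier R \<Longrightarrow> y \<in> carrier R \<Longrightarrow> x \<ominus> y \<in> J \<Longrightarrow> f x \<ominus> f y \<in> J"
    and x: "x \<in> carrier R"
  shows "lift f (q x) = q (f x)"
proof -
  define y where "y = (SOME y. y \<in> carrier R \<and> q y = q x)"
  have y: "y \<in> carrier R \<and> q y = q x" unfolding y_def by (rule someI[of _ x]) (use x in simp)
  then have "f y \<ominus> f x \<in> J" using fJ[of y x] q_eq[of y x] x by blast
  then have "q (f y) = q (f x)" using q_eq f x y by blast
  then show ?thesis by (simp add: lift_def y_def)
qed

end

section \<open>The chain of iterated annihilators\<close>

context finite_local_ring begin

lemma annihilator_ideal:
  assumes "ideal J R"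
  shows "ideal {x \<in> M. \<forall>y\<in>M. x \<otimes> y \<in> J} R"
proof -
  interpret J: ideal J R by fact
  show ?thesis
  proof (rule idealI[OF ring_axioms])
    show "subgroup {x \<in> M. \<forall>y\<in>M. x \<otimes> y \<in> J} (add_monoid R)"
    proof (rule add.subgroupI)
      show "{x \<in> M. \<forall>y\<in>M. x \<otimes> y \<in> J} \<subseteq> carrier R" using M.Icarr by blast
      show "{x \<in> M. \<forall>y\<in>M. x \<otimes> y \<in> J} \<noteq> {}"
        using M.zero_closed J.zero_closed M.Icarr by (auto intro!: exI[of _ \<zero>])
    qed (use M.Icarr in \<open>auto simp: l_minus l_distr\<close>)
    fix a x assume a: "a \<in> {x \<in> M. \<forall>y\<in>M. x \<otimes> y \<in> J}" and x: "x \<in> carrier R"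
    have ac: "a \<in> carrier R" using a M.Icarr by blast
    have "x \<otimes> a \<otimes> y \<in> J" if y: "y \<in> M" for y
    proof -
      have "x \<otimes> (a \<otimes> y) \<in> J" using a y x by (simp add: J.I_l_closed)
      then show ?thesis using ac x y M.Icarr by (simp add: m_assoc)
    qed
    then show "x \<otimes> a \<in> {x \<in> M. \<forall>y\<in>M. x \<otimes> y \<in> J}" using a x by (simp add: M.I_l_closed)
    then show "a \<otimes> x \<in> {x \<in> M. \<forall>y\<in>M. x \<otimes> y \<in> J}" using ac x by (simp add: m_comm)
  qed
qed

text \<open>Pulled back to \<open>R\<close>, the ideal \<open>I0\<close> of the quotient consists of
  the elements of \<open>M\<close> whose products with \<open>M\<close> fall into the previous
  member. This description, freed of its hypotheses as \<open>pure_chain_Suc\<close>, replaces the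
  recursive equation from here on.\<close>

lemma pure_chain_step:
  assumes "ideal (pure_chain R k) R" "pure_chain R k \<subseteq> M"
  shows "pure_chain R (Suc k) = {x \<in> M. \<forall>y\<in>M. x \<otimes> y \<in> pure_chain R k}"
proof -
  interpret local_quotient R M "pure_chain R k" 
    by (intro local_quotient.intro local_quotient_axioms.intro finite_local_ring_axioms assms)
  let ?A = "{x \<in> M. \<forall>y\<in>M. x \<otimes> y \<in> pure_chain R k}"
  have sub: "pure_chain R k \<subseteq> ?A"
  proof
    fix x assume x: "x \<in> pure_chain R k"
    have "x \<otimes> y \<in> pure_chain R k" if "y \<in> M" for y
      by (rule J.I_r_closed[OF x M.Icarr[OF that]])
    then show "x \<in> ?A" using x J_sub by blast
  qed
  have "pure_chain R (Suc k) = {x \<in> carrier R. q x \<in> (\<lambda>x. q x) ` ?A}"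
    by (simp only: pure_chain.simps I0_quotient)
  also have "\<dots> = {x \<in> carrier R. x \<in> ?A}"
    by (rule Collect_cong, rule conj_cong[OF refl], rule q_image_mem[OF annihilator_ideal[OF J_ideal] sub])
  also have "\<dots> = ?A" using M.Icarr by auto
  finally show ?thesis .
qed

declare pure_chain.simps(2) [simp del]

lemma pure_chain_ideal: "ideal (pure_chain R k) R \<and> pure_chain R k \<subseteq> M"
proof (induction k)
  case 0
  then show ?case by (simp add: zeroideal)
next
  case (Suc k)
  then have "pure_chain R (Suc k) = {x \<in> M. \<forall>y\<in>M. x \<otimes> y \<in> pure_chain R k}" using pure_chain_step by blast
  then show ?case using annihilator_ideal Suc by auto
qed

lemma pure_chain_Suc: "pure_chain R (Suc k) = {x \<in> M. \<forall>y\<in>M. x \<otimes> y \<in> pure_chain R k}"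
  using pure_chain_step pure_chain_ideal by blast

lemma pure_chain_mono: "pure_chain R k \<subseteq> pure_chain R (Suc k)"
proof
  fix x assume x: "x \<in> pure_chain R k"
  have "x \<otimes> y \<in> pure_chain R k" if "y \<in> M" for y
    using pure_chain_ideal[of k] ideal.I_r_closed[OF _ x M.Icarr[OF that]] by blast
  then show "x \<in> pure_chain R (Suc k)" unfolding pure_chain_Suc using x pure_chain_ideal[of k] by blast
qed

lemma pure_chain_strict:
  assumes "pure_chain R k \<noteq> M" shows "pure_chain R k \<subset> pure_chain R (Suc k)"
proof -
  obtain x where "x \<in> M - pure_chain R k" "\<forall>y\<in>M. x \<otimes> y \<in> pure_chain R k"
    using exists_annihilated pure_chain_ideal[of k] assms by blast
  then have "x \<in> pure_chain R (Suc k)" "x \<notin> pure_chain R k" unfolding pure_chain_Suc by auto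
  then show ?thesis using pure_chain_mono by blast
qed

text \<open>The chain grows strictly below \<open>M\<close>, inside a finite ring. The index found
  here is where the descent begins.\<close>

lemma pure_chain_reaches: "\<exists>n. pure_chain R n = M"
proof (rule ccontr)
  assume n: "\<nexists>n. pure_chain R n = M"
  have fin: "finite (pure_chain R k)" for k
    by (rule finite_subset[OF _ finite_carrier]) (use pure_chain_ideal[of k] M.Icarr in blast)
  have "k \<le> card (pure_chain R k)" for k
  proof (induction k)
    case (Suc k)
    have "card (pure_chain R k) < card (pure_chain R (Suc k))"
      using pure_chain_strict n fin by (intro psubset_card_mono) auto
    then show ?case using Suc by simp
  qed simp
  moreover have "card (pure_chain R k) \<le> card (carrier R)" for k
    by (rule card_mono[OF finite_carrier]) (use pure_chain_ideal[of k] M.Icarr in blast)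
  ultimately show False by (metis Suc_n_not_le_n le_trans)
qed

end

lemma (in pure_pair) resp_iff:
  "resp f \<longleftrightarrow> f \<in> carrier R \<rightarrow> carrier R \<and>
    (\<forall>x\<in>carrier R. \<forall>y\<in>carrier R. \<exists>k\<in>K. f x \<ominus> f y = (x \<ominus> y) \<otimes> k)"
  by (simp add: resp_def kassoc_def)

section \<open>Scheme maps on the quotients, and descent\<close>

locale cyc_ring = finite_local_ring +
  fixes K
  assumes K_subgroup: "subgroup K (units_of R)"
    and K_pure: "strongly_pure R K"
begin

lemma K_Units: "K \<subseteq> Units R"
  using subgroup.subset[OF K_subgroup] by (simp add: units_of_carrier)

lemma K_carrier: "k \<in> K \<Longrightarrow> k \<in> carrier R"
  using K_Units by blast

lemma K_one: "\<one> \<in> K"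
  using subgroup.one_closed[OF K_subgroup] by (simp add: units_of_one)

lemma K_mult: "k \<in> K \<Longrightarrow> l \<in> K \<Longrightarrow> k \<otimes> l \<in> K"
  using subgroup.m_closed[OF K_subgroup] by (simp add: units_of_mult)

lemma K_inv: "k \<in> K \<Longrightarrow> inv k \<in> K"
  using subgroup.m_inv_closed[OF K_subgroup] K_Units by (metis subsetD units_of_inv)

lemma quotient_of_chain: "local_quotient R M (pure_chain R k)"
  using pure_chain_ideal[of k]
  by (intro local_quotient.intro local_quotient_axioms.intro finite_local_ring_axioms) auto

text \<open>Level \<open>k\<close> of strong purity is purity of the image of \<open>K\<close> in
  this quotient, here applied to principal ideals. The maximal ideal kills \<open>V\<close> by the
  description of the next member of the chain.\<close>

lemma pure_pair_quotient:
  "pure_pair (R Quot pure_chain R k) ((\<lambda>x. pure_chain R k +> x) ` M)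
     ((\<lambda>x. pure_chain R k +> x) ` pure_chain R (Suc k)) ((\<lambda>x. pure_chain R k +> x) ` K)"
proof -
  interpret local_quotient R M "pure_chain R k" by (rule quotient_of_chain)
  interpret S: finite_local_ring S "(\<lambda>x. q x) ` M" by (rule quotient_local)
  have sub: "pure_chain R (Suc k) \<subseteq> M" "ideal (pure_chain R (Suc k)) R"
    using pure_chain_ideal[of "Suc k"] by auto
  show ?thesis
  proof (rule pure_pair.intro[OF quotient_local], rule pure_pair_axioms.intro)
    show VI: "ideal ((\<lambda>x. q x) ` pure_chain R (Suc k)) S"
      by (rule ring_ideal_imp_quot_ideal[OF J_ideal sub(2)])
    show "(\<lambda>x. q x) ` pure_chain R (Suc k) \<subseteq> (\<lambda>x. q x) ` M" using sub by blast
    show "r \<otimes>\<^bsub>S\<^esub> v = \<zero>\<^bsub>S\<^esub>"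
      if vr: "v \<in> (\<lambda>x. q x) ` pure_chain R (Suc k)" "r \<in> (\<lambda>x. q x) ` M" for v r
    proof -
      obtain x y where x: "x \<in> pure_chain R (Suc k)" "v = q x" and y: "y \<in> M" "r = q y" using vr by blast
      have c: "x \<in> carrier R" "y \<in> carrier R" using x y sub M.Icarr by auto
      have "x \<otimes> y \<in> pure_chain R k" using x y unfolding pure_chain_Suc by blast
      then have "q (x \<otimes> y) = \<zero>\<^bsub>S\<^esub>" by (subst q_zero) (use c in auto)
      then show ?thesis using x y c by (simp add: q.S.m_comm)
    qed
    show "(\<lambda>x. q x) ` K \<subseteq> Units S" using K_Units q_Units by blast
    show "\<one>\<^bsub>S\<^esub> \<in> (\<lambda>x. q x) ` K" using K_one q.hom_one by (metis imageI)
    show "k \<otimes>\<^bsub>S\<^esub> l \<in> (\<lambda>x. q x) ` K" if kl: "k \<in> (\<lambda>x. q x) ` K" "l \<in> (\<lambda>x. q x) ` K" for k l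
    proof -
      obtain a b where a: "a \<in> K" "k = q a" and b: "b \<in> K" "l = q b" using kl by blast
      then have "k \<otimes>\<^bsub>S\<^esub> l = q (a \<otimes> b)" using K_carrier by simp
      then show ?thesis using K_mult a b by blast
    qed
    show "inv\<^bsub>S\<^esub> k \<in> (\<lambda>x. q x) ` K" if k: "k \<in> (\<lambda>x. q x) ` K" for k
    proof -
      obtain a where a: "a \<in> K" "k = q a" using k by blast
      then have "inv\<^bsub>S\<^esub> k = q (inv a)" using q_Units(2) K_Units by blast
      then show ?thesis using K_inv a by blast
    qed
    fix v assume v: "v \<in> (\<lambda>x. q x) ` pure_chain R (Suc k)"
      and vK: "\<And>c. c \<in> carrier S \<Longrightarrow> \<one>\<^bsub>S\<^esub> \<oplus>\<^bsub>S\<^esub> c \<otimes>\<^bsub>S\<^esub> v \<in> (\<lambda>x. q x) ` K"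
    have vc: "v \<in> carrier S" by (rule ideal.Icarr[OF VI v])
    have "ideal (PIdl\<^bsub>S\<^esub> v) S" by (rule q.S.cgenideal_ideal[OF vc])
    moreover have "\<forall>x\<in>PIdl\<^bsub>S\<^esub> v. \<one>\<^bsub>S\<^esub> \<oplus>\<^bsub>S\<^esub> x \<in> (\<lambda>x. q x) ` K"
      using vK by (auto simp: cgenideal_def)
    ultimately have "PIdl\<^bsub>S\<^esub> v = {\<zero>\<^bsub>S\<^esub>}"
      using K_pure unfolding strongly_pure_def pure_def by blast
    then show "v = \<zero>\<^bsub>S\<^esub>" using q.S.cgenideal_self[OF vc] by simp
  qed
qed

text \<open>The condition \<open>resp\<close> restated for \<open>R\<close> itself: even the bottom
  of the chain is \<open>R Quot {0}\<close>, whose elements are cosets, so \<open>pure_pair\<close>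
  is never entered with \<open>R\<close>.\<close>

definition kresp where
  "kresp f \<longleftrightarrow> f \<in> carrier R \<rightarrow> carrier R \<and>
    (\<forall>x\<in>carrier R. \<forall>y\<in>carrier R. \<exists>k\<in>K. f x \<ominus> f y = (x \<ominus> y) \<otimes> k)"

lemma kresp_closed: "kresp f \<Longrightarrow> x \<in> carrier R \<Longrightarrow> f x \<in> carrier R"
  by (auto simp: kresp_def)

lemma kresp_ideal:
  assumes "kresp f" "ideal I R" "x \<in> carrier R" "y \<in> carrier R" "x \<ominus> y \<in> I"
  shows "f x \<ominus> f y \<in> I"
  using assms K_carrier ideal.I_r_closed unfolding kresp_def by metis

lemma resp_map_quotient:
  assumes f: "kresp f" "f \<zero> = \<zero>" "f \<one> = \<one>"
  shows "resp_map (R Quot pure_chain R k) ((\<lambda>x. pure_chain R k +> x) ` M)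
     ((\<lambda>x. pure_chain R k +> x) ` pure_chain R (Suc k)) ((\<lambda>x. pure_chain R k +> x) ` K)
     (local_quotient.lift R (pure_chain R k) f)"
proof -
  interpret local_quotient R M "pure_chain R k" by (rule quotient_of_chain)
  interpret P: pure_pair S "(\<lambda>x. q x) ` M" "(\<lambda>x. q x) ` pure_chain R (Suc k)" "(\<lambda>x. q x) ` K"
    by (rule pure_pair_quotient)
  have fc: "f \<in> carrier R \<rightarrow> carrier R" using kresp_closed[OF f(1)] by auto
  have lq: "lift f (q x) = q (f x)" if "x \<in> carrier R" for x
    by (rule lift_q[OF fc kresp_ideal[OF f(1) J_ideal] that])
  show ?thesis
  proof (rule resp_map.intro[OF pure_pair_quotient], rule resp_map_axioms.intro)
    show "lift f \<zero>\<^bsub>S\<^esub> = \<zero>\<^bsub>S\<^esub>" using lq[of \<zero>] f by simp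
    show "lift f \<one>\<^bsub>S\<^esub> = \<one>\<^bsub>S\<^esub>" using lq[of \<one>] f by simp
    show "P.resp (lift f)" unfolding P.resp_iff
    proof (intro conjI ballI)
      show "lift f \<in> carrier S \<rightarrow> carrier S" unfolding carrier_S using lq fc by auto
      fix C D assume "C \<in> carrier S" "D \<in> carrier S"
      then obtain x y where x: "x \<in> carrier R" "C = q x" and y: "y \<in> carrier R" "D = q y"
        by (auto simp: carrier_S)
      obtain k where k: "k \<in> K" "f x \<ominus> f y = (x \<ominus> y) \<otimes> k" using f(1) x y unfolding kresp_def by blast
      have "lift f C \<ominus>\<^bsub>S\<^esub> lift f D = q (f x \<ominus> f y)"
        using x y lq kresp_closed[OF f(1)] by (simp add: q_minus)
      also have "\<dots> = (C \<ominus>\<^bsub>S\<^esub> D) \<otimes>\<^bsub>S\<^esub> q k" unfolding k(2) using x y K_carrier[OF k(1)] by (simp add: q_minus)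
      finally show "\<exists>k\<in>(\<lambda>x. q x) ` K. lift f C \<ominus>\<^bsub>S\<^esub> lift f D = (C \<ominus>\<^bsub>S\<^esub> D) \<otimes>\<^bsub>S\<^esub> k" using k by blast
    qed
  qed
qed

lemma lift_chain:
  assumes f: "kresp f" and x: "x \<in> carrier R"
  shows "local_quotient.lift R (pure_chain R k) f (pure_chain R k +> x) = pure_chain R k +> f x"
proof -
  interpret local_quotient R M "pure_chain R k" by (rule quotient_of_chain)
  show ?thesis by (rule lift_q[OF _ kresp_ideal[OF f J_ideal] x]) (use kresp_closed[OF f] in auto)
qed

definition hom_mod where
  "hom_mod I f \<longleftrightarrow> (\<forall>x\<in>carrier R. \<forall>y\<in>carrier R.
     f (x \<oplus> y) \<ominus> (f x \<oplus> f y) \<in> I \<and> f (x \<otimes> y) \<ominus> f x \<otimes> f y \<in> I)"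

lemma lift_map_quotient:
  assumes f: "kresp f" "f \<zero> = \<zero>" "f \<one> = \<one>" and hom: "hom_mod (pure_chain R (Suc k)) f"
  shows "lift_map (R Quot pure_chain R k) ((\<lambda>x. pure_chain R k +> x) ` M)
     ((\<lambda>x. pure_chain R k +> x) ` pure_chain R (Suc k)) ((\<lambda>x. pure_chain R k +> x) ` K)
     (local_quotient.lift R (pure_chain R k) f)"
proof -
  interpret local_quotient R M "pure_chain R k" by (rule quotient_of_chain)
  interpret P: resp_map S "(\<lambda>x. q x) ` M" "(\<lambda>x. q x) ` pure_chain R (Suc k)" "(\<lambda>x. q x) ` K" "lift f"
    by (rule resp_map_quotient[OF f])
  note fc = kresp_closed[OF f(1)]
  have lq: "lift f (q x) = q (f x)" if "x \<in> carrier R" for x by (rule lift_chain[OF f(1) that])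
  show ?thesis
  proof (rule lift_map.intro[OF resp_map_quotient[OF f]], rule lift_map_axioms.intro)
    fix C D assume "C \<in> carrier S" "D \<in> carrier S"
    then obtain x y where x: "x \<in> carrier R" "C = q x" and y: "y \<in> carrier R" "D = q y"
      by (auto simp: carrier_S)
    have "lift f (C \<oplus>\<^bsub>S\<^esub> D) \<ominus>\<^bsub>S\<^esub> (lift f C \<oplus>\<^bsub>S\<^esub> lift f D) = q (f (x \<oplus> y) \<ominus> (f x \<oplus> f y))"
      using lq[of "x \<oplus> y"] lq[OF x(1)] lq[OF y(1)] x y fc by (simp add: q_minus)
    then show "lift f (C \<oplus>\<^bsub>S\<^esub> D) \<ominus>\<^bsub>S\<^esub> (lift f C \<oplus>\<^bsub>S\<^esub> lift f D) \<in> (\<lambda>x. q x) ` pure_chain R (Suc k)"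
      using hom x y unfolding hom_mod_def by blast
    have "lift f (C \<otimes>\<^bsub>S\<^esub> D) \<ominus>\<^bsub>S\<^esub> lift f C \<otimes>\<^bsub>S\<^esub> lift f D = q (f (x \<otimes> y) \<ominus> f x \<otimes> f y)"
      using lq[of "x \<otimes> y"] lq[OF x(1)] lq[OF y(1)] x y fc by (simp add: q_minus)
    then show "lift f (C \<otimes>\<^bsub>S\<^esub> D) \<ominus>\<^bsub>S\<^esub> lift f C \<otimes>\<^bsub>S\<^esub> lift f D \<in> (\<lambda>x. q x) ` pure_chain R (Suc k)"
      using hom x y unfolding hom_mod_def by blast
  qed
qed

text \<open>Being a homomorphism modulo the larger ideal is the hypothesis of
  \<open>lift_map\<close> for the map induced on the quotient by the smaller one;
  \<open>f_ring_hom\<close> there is the conclusion here.\<close>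

lemma hom_mod_descend:
  assumes f: "kresp f" "f \<zero> = \<zero>" "f \<one> = \<one>" and hom: "hom_mod (pure_chain R (Suc k)) f"
  shows "hom_mod (pure_chain R k) f"
proof -
  interpret local_quotient R M "pure_chain R k" by (rule quotient_of_chain)
  interpret P: lift_map S "(\<lambda>x. q x) ` M" "(\<lambda>x. q x) ` pure_chain R (Suc k)" "(\<lambda>x. q x) ` K" "lift f"
    by (rule lift_map_quotient[OF f hom])
  note fc = kresp_closed[OF f(1)]
  have lq: "lift f (q x) = q (f x)" if "x \<in> carrier R" for x by (rule lift_chain[OF f(1) that])
  show ?thesis unfolding hom_mod_def
  proof (intro ballI conjI)
    fix x y assume x: "x \<in> carrier R" and y: "y \<in> carrier R"
    have "q (f (x \<oplus> y)) = q (f x \<oplus> f y)"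
      using ring_hom_add[OF P.f_ring_hom q.hom_closed[OF x] q.hom_closed[OF y]]
        lq[of "x \<oplus> y"] lq[OF x] lq[OF y] x y fc by simp
    then show "f (x \<oplus> y) \<ominus> (f x \<oplus> f y) \<in> pure_chain R k"
      by (subst q_eq[symmetric]) (use fc x y in simp_all)
    have "q (f (x \<otimes> y)) = q (f x \<otimes> f y)"
      using ring_hom_mult[OF P.f_ring_hom q.hom_closed[OF x] q.hom_closed[OF y]]
        lq[of "x \<otimes> y"] lq[OF x] lq[OF y] x y fc by simp
    then show "f (x \<otimes> y) \<ominus> f x \<otimes> f y \<in> pure_chain R k"
      by (subst q_eq[symmetric]) (use fc x y in simp_all)
  qed
qed

text \<open>The instance \<open>k = 0\<close>: since \<open>M\<close> is nonzero, so is its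
  annihilator, and \<open>residual_hom\<close> applies.\<close>

lemma hom_mod_M:
  assumes f: "kresp f" "f \<zero> = \<zero>" "f \<one> = \<one>" and M: "M \<noteq> {\<zero>}"
  shows "hom_mod M f"
proof -
  interpret local_quotient R M "pure_chain R 0" by (rule quotient_of_chain)
  interpret P: resp_map S "(\<lambda>x. q x) ` M" "(\<lambda>x. q x) ` pure_chain R (Suc 0)" "(\<lambda>x. q x) ` K" "lift f"
    by (rule resp_map_quotient[OF f])
  note fc = kresp_closed[OF f(1)]
  have lq: "lift f (q x) = q (f x)" if "x \<in> carrier R" for x by (rule lift_chain[OF f(1) that])
  obtain v where v: "v \<in> pure_chain R (Suc 0)" "v \<notin> pure_chain R 0"
    using pure_chain_strict[of 0] M by auto
  then have "v \<in> carrier R" using pure_chain_ideal M.Icarr by blast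
  then have "q v \<noteq> \<zero>\<^bsub>S\<^esub>" using q_zero v by blast
  then have V: "(\<lambda>x. q x) ` pure_chain R (Suc 0) \<noteq> {\<zero>\<^bsub>S\<^esub>}" using v(1) by blast
  show ?thesis unfolding hom_mod_def
  proof (intro ballI conjI)
    fix x y assume x: "x \<in> carrier R" and y: "y \<in> carrier R"
    note h = P.residual_hom[OF V q.hom_closed[OF x] q.hom_closed[OF y]]
    have "q (f (x \<oplus> y) \<ominus> (f x \<oplus> f y)) \<in> (\<lambda>x. q x) ` M"
      using h(1) lq[of "x \<oplus> y"] lq[OF x] lq[OF y] x y fc by (simp add: q_minus del: pure_chain.simps)
    then show "f (x \<oplus> y) \<ominus> (f x \<oplus> f y) \<in> M"
      by (subst q_image_mem[OF M_ideal J_sub, symmetric]) (use fc x y in simp_all)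
    have "q (f (x \<otimes> y) \<ominus> f x \<otimes> f y) \<in> (\<lambda>x. q x) ` M"
      using h(2) lq[of "x \<otimes> y"] lq[OF x] lq[OF y] x y fc by (simp add: q_minus del: pure_chain.simps)
    then show "f (x \<otimes> y) \<ominus> f x \<otimes> f y \<in> M"
      by (subst q_image_mem[OF M_ideal J_sub, symmetric]) (use fc x y in simp_all)
  qed
qed

theorem kresp_hom:
  assumes f: "kresp f" "f \<zero> = \<zero>" "f \<one> = \<one>" and M: "M \<noteq> {\<zero>}"
  shows "f \<in> ring_hom R R"
proof -
  note fc = kresp_closed[OF f(1)]
  obtain n where n: "pure_chain R n = M" using pure_chain_reaches by blast
  have "hom_mod (pure_chain R n) f \<Longrightarrow> hom_mod (pure_chain R 0) f" for n
    by (induction n) (use hom_mod_descend[OF f] in blast)+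
  then have h: "hom_mod {\<zero>} f" using hom_mod_M[OF f M] n by (metis pure_chain.simps(1))
  show ?thesis
  proof (rule ring_hom_memI)
    fix x y assume x: "x \<in> carrier R" and y: "y \<in> carrier R"
    show "f (x \<oplus> y) = f x \<oplus> f y" "f (x \<otimes> y) = f x \<otimes> f y"
      using h x y fc unfolding hom_mod_def by auto
  qed (use f fc in auto)
qed

text \<open>Agreement modulo \<open>M\<close> is pushed down the chain: \<open>hom_unique\<close> in
  each quotient turns agreement modulo one member into agreement modulo the one below.\<close>

theorem kresp_hom_unique:
  assumes f: "kresp f" "f \<in> ring_hom R R" and g: "kresp g" "g \<in> ring_hom R R"
    and M: "\<And>x. x \<in> carrier R \<Longrightarrow> g x \<ominus> f x \<in> M" and x: "x \<in> carrier R"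
  shows "g x = f x"
proof -
  note fc = kresp_closed[OF f(1)] and gc = kresp_closed[OF g(1)]
  have f1: "f \<one> = \<one>" using ring_hom_one[OF f(2)] .
  have f0: "f \<zero> = \<zero>" using ring_hom_zero[OF f(2)] ring_axioms by simp
  have step: "\<forall>x\<in>carrier R. g x \<ominus> f x \<in> pure_chain R k"
    if V: "\<forall>x\<in>carrier R. g x \<ominus> f x \<in> pure_chain R (Suc k)" for k
  proof
    fix x assume x: "x \<in> carrier R"
    interpret local_quotient R M "pure_chain R k" by (rule quotient_of_chain)
    have "hom_mod (pure_chain R (Suc k)) f" unfolding hom_mod_def
    proof (intro ballI conjI)
      fix x y assume x: "x \<in> carrier R" and y: "y \<in> carrier R"
      have z: "\<zero> \<in> pure_chain R (Suc k)"
        using pure_chain_ideal[of "Suc k"] additive_subgroup.zero_closed ideal.axioms(1) by blast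
      show "f (x \<oplus> y) \<ominus> (f x \<oplus> f y) \<in> pure_chain R (Suc k)"
        using ring_hom_add[OF f(2) x y] fc x y z by (simp add: a_minus_def r_neg)
      show "f (x \<otimes> y) \<ominus> f x \<otimes> f y \<in> pure_chain R (Suc k)"
        using ring_hom_mult[OF f(2) x y] fc x y z by (simp add: a_minus_def r_neg)
    qed
    then interpret P: lift_map S "(\<lambda>x. q x) ` M" "(\<lambda>x. q x) ` pure_chain R (Suc k)" "(\<lambda>x. q x) ` K" "lift f"
      by (rule lift_map_quotient[OF f(1) f0 f1])
    have lf: "lift f (q x) = q (f x)" if "x \<in> carrier R" for x by (rule lift_chain[OF f(1) that])
    have lg: "lift g (q x) = q (g x)" if "x \<in> carrier R" for x by (rule lift_chain[OF g(1) that])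
    have g1: "g \<one> = \<one>" using ring_hom_one[OF g(2)] .
    have g0: "g \<zero> = \<zero>" using ring_hom_zero[OF g(2)] ring_axioms by simp
    interpret G: resp_map S "(\<lambda>x. q x) ` M" "(\<lambda>x. q x) ` pure_chain R (Suc k)" "(\<lambda>x. q x) ` K" "lift g"
      by (rule resp_map_quotient[OF g(1) g0 g1])
    have ghom: "lift g \<in> ring_hom S S"
    proof (rule ring_hom_memI)
      show "lift g \<one>\<^bsub>S\<^esub> = \<one>\<^bsub>S\<^esub>" by (rule G.f_one)
      show "lift g C \<in> carrier S" if "C \<in> carrier S" for C using that by (rule G.f_closed)
      fix C D assume "C \<in> carrier S" "D \<in> carrier S"
      then obtain x y where x: "x \<in> carrier R" "C = q x" and y: "y \<in> carrier R" "D = q y"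
        by (auto simp: carrier_S)
      show "lift g (C \<otimes>\<^bsub>S\<^esub> D) = lift g C \<otimes>\<^bsub>S\<^esub> lift g D"
        using lg[of "x \<otimes> y"] lg[OF x(1)] lg[OF y(1)] x y gc ring_hom_mult[OF g(2) x(1) y(1)] by simp
      show "lift g (C \<oplus>\<^bsub>S\<^esub> D) = lift g C \<oplus>\<^bsub>S\<^esub> lift g D"
        using lg[of "x \<oplus> y"] lg[OF x(1)] lg[OF y(1)] x y gc ring_hom_add[OF g(2) x(1) y(1)] by simp
    qed
    have "lift g C \<ominus>\<^bsub>S\<^esub> lift f C \<in> (\<lambda>x. q x) ` pure_chain R (Suc k)" if C: "C \<in> carrier S" for C
    proof -
      obtain x where x: "x \<in> carrier R" "C = q x" using C by (auto simp: carrier_S)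
      have "lift g C \<ominus>\<^bsub>S\<^esub> lift f C = q (g x \<ominus> f x)" using lf lg x fc gc by (simp add: q_minus)
      then show ?thesis using V x by blast
    qed
    then have "lift g (q x) = lift f (q x)" using x by (intro P.hom_unique ghom G.resp_f) auto
    then have "q (g x) = q (f x)" using lf lg x by simp
    then show "g x \<ominus> f x \<in> pure_chain R k" using q_eq fc gc x by blast
  qed
  obtain n where n: "pure_chain R n = M" using pure_chain_reaches by blast
  have "(\<forall>x\<in>carrier R. g x \<ominus> f x \<in> pure_chain R n) \<Longrightarrow> (\<forall>x\<in>carrier R. g x \<ominus> f x \<in> pure_chain R 0)" for n
    by (induction n) (use step in blast)+
  then have "g x \<ominus> f x \<in> pure_chain R 0" using n M x by metis
  then show ?thesis using fc gc x by simp
qed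

end

section \<open>Automorphisms of the cyclotomic scheme\<close>

text \<open>Each relation is mapped into itself, and injectivity on a finite set makes the inclusion
  an equality. The setting is a general commutative ring, so that it covers the residue
  field.\<close>

lemma (in cring) cyc_autI:
  assumes fin: "finite (carrier R)" and K: "K \<subseteq> carrier R" "\<And>k l. k \<in> K \<Longrightarrow> l \<in> K \<Longrightarrow> k \<otimes> l \<in> K"
    and g: "g \<in> carrier R \<rightarrow> carrier R" "inj_on g (carrier R)"
    and gK: "\<And>x y. x \<in> carrier R \<Longrightarrow> y \<in> carrier R \<Longrightarrow> \<exists>k\<in>K. g x \<ominus> g y = (x \<ominus> y) \<otimes> k"
  shows "g \<in> cyc_aut R K"
proof -
  have "g ` carrier R = carrier R" using g by (intro endo_inj_surj[OF fin]) auto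
  then have bij: "bij_betw g (carrier R) (carrier R)" using g by (simp add: bij_betw_def)
  have "(\<lambda>(x, y). (g x, g y)) ` cyc_rel R K r = cyc_rel R K r" if r: "r \<in> carrier R" for r
  proof (rule endo_inj_surj)
    have sub: "cyc_rel R K r \<subseteq> carrier R \<times> carrier R" by (auto simp: cyc_rel_def)
    then show "finite (cyc_rel R K r)" by (rule finite_subset) (simp add: fin)
    show "inj_on (\<lambda>(x, y). (g x, g y)) (cyc_rel R K r)"
      using sub g(2) by (auto simp: inj_on_def)
    show "(\<lambda>(x, y). (g x, g y)) ` cyc_rel R K r \<subseteq> cyc_rel R K r"
    proof (rule image_subsetI, clarify)
      fix x y assume "(x, y) \<in> cyc_rel R K r"
      then obtain k where x: "x \<in> carrier R" "y \<in> carrier R" and k: "k \<in> K" "y \<ominus> x = r \<otimes> k"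
        by (auto simp: cyc_rel_def)
      obtain l where l: "l \<in> K" "g y \<ominus> g x = (y \<ominus> x) \<otimes> l" using gK x by blast
      have "k \<in> carrier R" "l \<in> carrier R" using k l K by auto
      then have "g y \<ominus> g x = r \<otimes> (k \<otimes> l)" using l k r by (simp add: m_assoc)
      then show "(g x, g y) \<in> cyc_rel R K r" using g x K(2)[OF k(1) l(1)] by (auto simp: cyc_rel_def)
    qed
  qed
  then show ?thesis using bij by (simp add: cyc_aut_def)
qed

context cyc_ring begin

lemma cyc_aut_kresp:
  assumes f: "f \<in> cyc_aut R K"
  shows "kresp f"
proof -
  have fc: "f \<in> carrier R \<rightarrow> carrier R" using f by (auto simp: cyc_aut_def bij_betw_def)
  have "\<exists>k\<in>K. f x \<ominus> f y = (x \<ominus> y) \<otimes> k" if x: "x \<in> carrier R" and y: "y \<in> carrier R" for x y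
  proof -
    \<comment> \<open>The pair lies in its own relation because \<open>K\<close> contains 1; the
      image pair stays in it.\<close>
    have "(y, x) \<in> cyc_rel R K (x \<ominus> y)"
      using x y imageI[OF K_one, of "\<lambda>k. (x \<ominus> y) \<otimes> k"] by (simp add: cyc_rel_def)
    then have "(f y, f x) \<in> (\<lambda>(x, y). (f x, f y)) ` cyc_rel R K (x \<ominus> y)" by force
    then have "(f y, f x) \<in> cyc_rel R K (x \<ominus> y)" using f x y by (simp add: cyc_aut_def)
    then show ?thesis by (auto simp: cyc_rel_def)
  qed
  then show ?thesis using fc by (simp add: kresp_def)
qed

text \<open>\<open>f 1 - f 0\<close> is an element \<open>k\<close> of \<open>K\<close>, because
  \<open>1 - 0 = 1\<close>. Dividing by it after subtracting \<open>f 0\<close> normalises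
  \<open>f\<close> without leaving the class of maps considered.\<close>

lemma cyc_aut_affine:
  assumes f: "f \<in> cyc_aut R K" and M: "M \<noteq> {\<zero>}"
  shows "f \<in> AGammaL1 R"
proof -
  have kf: "kresp f" by (rule cyc_aut_kresp[OF f])
  note fc = kresp_closed[OF kf]
  obtain k where k: "k \<in> K" "f \<one> \<ominus> f \<zero> = (\<one> \<ominus> \<zero>) \<otimes> k" using kf unfolding kresp_def by blast
  have ku: "k \<in> Units R" "k \<in> carrier R" "inv k \<in> carrier R" "inv k \<in> K" using k K_Units K_inv by auto
  define g where "g x = inv k \<otimes> (f x \<ominus> f \<zero>)" for x
  have gc: "g x \<in> carrier R" if "x \<in> carrier R" for x using that fc ku by (simp add: g_def)
  have fg: "f x = k \<otimes> g x \<oplus> f \<zero>" if x: "x \<in> carrier R" for x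
  proof -
    have c: "f x \<in> carrier R" "f \<zero> \<in> carrier R" using fc x by auto
    then have "k \<otimes> g x = f x \<ominus> f \<zero>" unfolding g_def using Units_inv_cancel[OF ku(1)] by simp
    then show ?thesis using c by (simp only:) algebra
  qed
  have kg: "kresp g" unfolding kresp_def
  proof (intro conjI ballI)
    show "g \<in> carrier R \<rightarrow> carrier R" using gc by auto
    fix x y assume x: "x \<in> carrier R" and y: "y \<in> carrier R"
    obtain l where l: "l \<in> K" "f x \<ominus> f y = (x \<ominus> y) \<otimes> l" using kf x y unfolding kresp_def by blast
    have c: "f x \<in> carrier R" "f y \<in> carrier R" "f \<zero> \<in> carrier R" "l \<in> carrier R" using fc x y l K_carrier by auto
    have "g x \<ominus> g y = inv k \<otimes> (f x \<ominus> f y)" unfolding g_def using ku(3) c by algebra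
    also have "\<dots> = (x \<ominus> y) \<otimes> (l \<otimes> inv k)" unfolding l(2) using ku(3) c(4) x y by algebra
    finally show "\<exists>k\<in>K. g x \<ominus> g y = (x \<ominus> y) \<otimes> k" using l ku K_mult by blast
  qed
  have f0: "f \<zero> \<in> carrier R" using fc by simp
  have g0: "g \<zero> = \<zero>" unfolding g_def using f0 ku by (simp add: a_minus_def r_neg)
  have g1: "g \<one> = \<one>" unfolding g_def k(2) using ku by (simp add: a_minus_def)
  have hom: "g \<in> ring_hom R R" by (rule kresp_hom[OF kg g0 g1 M])
  have "inj_on f (carrier R)" using f by (simp add: cyc_aut_def bij_betw_def)
  then have inj: "inj_on g (carrier R)" using fg by (metis inj_onD inj_onI)
  have "g ` carrier R = carrier R" using gc inj by (intro endo_inj_surj[OF finite_carrier]) auto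
  then have "g \<in> ring_iso R R" using hom inj by (simp add: ring_iso_def bij_betw_def)
  then show ?thesis unfolding AGammaL1_def using ku(1) f0 fg by blast
qed

text \<open>\<open>induced_aut\<close> takes literal images of cosets, so \<open>f M = M\<close> is
  required and not just inclusion; finiteness and injectivity provide it.\<close>

lemma image_coset:
  assumes s: "f \<in> ring_hom R R" "kresp f" and inj: "inj_on f (carrier R)" and x: "x \<in> carrier R"
  shows "f ` (M +> x) = M +> f x"
proof -
  have z: "f \<zero> = \<zero>" using ring_hom_zero[OF s(1)] ring_axioms by simp
  have sM: "f m \<in> M" if m: "m \<in> M" for m
  proof -
    have "m \<in> carrier R" using m M.Icarr by simp
    then show ?thesis using kresp_ideal[OF s(2) M_ideal, of m \<zero>] m z kresp_closed[OF s(2)] by (simp add: a_minus_def)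
  qed
  have "inj_on f M" using inj M.a_subset by (rule inj_on_subset)
  moreover have "finite M" using finite_carrier M.a_subset by (rule finite_subset[rotated])
  ultimately have "f ` M = M" using sM by (intro endo_inj_surj) auto
  moreover have "f (m \<oplus> x) = f m \<oplus> f x" if "m \<in> M" for m
    using ring_hom_add[OF s(1) M.Icarr[OF that] x] .
  ultimately show ?thesis unfolding a_r_coset_def' by (auto simp: image_iff) (metis imageE)+
qed

lemma autC_ringD:
  assumes "f \<in> autC_ring R K"
  shows "f \<in> ring_hom R R" "kresp f" "inj_on f (carrier R)"
  using assms cyc_aut_kresp by (auto simp: autC_ring_def ring_iso_def bij_betw_def)

lemma induced_aut_coset:
  "f \<in> autC_ring R K \<Longrightarrow> x \<in> carrier R \<Longrightarrow> induced_aut f (\<pi> x) = \<pi> (f x)"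
  unfolding induced_aut_def using image_coset autC_ringD by blast

lemma res_field_eq: "res_field R = F"
  by (simp add: res_field_def rad_eq)

lemma induced_aut_autC:
  assumes s: "f \<in> autC_ring R K"
  shows "induced_aut f \<in> autC_field R K"
proof -
  interpret F: field F by (rule field_F)
  interpret h: ring_hom_cring R F "(+>) M" by (rule pi_hom)
  note hom = autC_ringD(1)[OF s] and ks = autC_ringD(2)[OF s]
  note sc = kresp_closed[OF ks]
  note ind = induced_aut_coset[OF s]
  have z: "f \<zero> = \<zero>" using ring_hom_zero[OF hom] ring_axioms by simp
  have closed: "induced_aut f \<in> carrier F \<rightarrow> carrier F" unfolding carrier_F using ind sc by auto
  have dif: "\<exists>k\<in>(\<lambda>x. \<pi> x) ` K. induced_aut f C \<ominus>\<^bsub>F\<^esub> induced_aut f D = (C \<ominus>\<^bsub>F\<^esub> D) \<otimes>\<^bsub>F\<^esub> k"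
    if CD: "C \<in> carrier F" "D \<in> carrier F" for C D
  proof -
    obtain x y where x: "x \<in> carrier R" "C = \<pi> x" and y: "y \<in> carrier R" "D = \<pi> y"
      using CD by (auto simp: carrier_F)
    obtain k where k: "k \<in> K" "f x \<ominus> f y = (x \<ominus> y) \<otimes> k" using ks x y unfolding kresp_def by blast
    have "induced_aut f C \<ominus>\<^bsub>F\<^esub> induced_aut f D = \<pi> (f x \<ominus> f y)"
      using x y sc by (simp add: ind a_minus_def)
    also have "\<dots> = (C \<ominus>\<^bsub>F\<^esub> D) \<otimes>\<^bsub>F\<^esub> \<pi> k"
      unfolding k(2) using x y K_carrier[OF k(1)] by (simp add: a_minus_def)
    finally show ?thesis using k(1) by blast
  qed
  \<comment> \<open>The factor relating the two differences is the class of a unit, hence nonzero,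
    and can be cancelled in the residue field.\<close>
  have inj: "inj_on (induced_aut f) (carrier F)"
  proof (rule inj_onI)
    fix C D assume C: "C \<in> carrier F" and D: "D \<in> carrier F" and e: "induced_aut f C = induced_aut f D"
    obtain K' where k: "K' \<in> (\<lambda>x. \<pi> x) ` K" "induced_aut f C \<ominus>\<^bsub>F\<^esub> induced_aut f D = (C \<ominus>\<^bsub>F\<^esub> D) \<otimes>\<^bsub>F\<^esub> K'"
      using dif[OF C D] by blast
    then obtain k where kK: "k \<in> K" "K' = \<pi> k" by blast
    have "induced_aut f D \<in> carrier F" using closed D by blast
    then have "(C \<ominus>\<^bsub>F\<^esub> D) \<otimes>\<^bsub>F\<^esub> K' = \<zero>\<^bsub>F\<^esub>" using k(2) e by (simp add: a_minus_def F.r_neg)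
    moreover have "K' \<in> carrier F" "K' \<noteq> \<zero>\<^bsub>F\<^esub>"
      using kK K_carrier[OF kK(1)] K_Units by (auto simp: pi_zero Units_iff)
    ultimately have "C \<ominus>\<^bsub>F\<^esub> D = \<zero>\<^bsub>F\<^esub>" using F.integral C D by (metis F.minus_closed)
    then show "C = D" using C D by simp
  qed
  have Kc: "(\<lambda>x. \<pi> x) ` K \<subseteq> carrier F" unfolding carrier_F using K_carrier by blast
  have Kmm: "k \<otimes>\<^bsub>F\<^esub> l \<in> (\<lambda>x. \<pi> x) ` K" if kl: "k \<in> (\<lambda>x. \<pi> x) ` K" "l \<in> (\<lambda>x. \<pi> x) ` K" for k l
  proof -
    obtain a b where a: "a \<in> K" "k = \<pi> a" and b: "b \<in> K" "l = \<pi> b" using kl by blast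
    then have "k \<otimes>\<^bsub>F\<^esub> l = \<pi> (a \<otimes> b)" using K_carrier by simp
    then show ?thesis using K_mult a b by blast
  qed
  have aut: "induced_aut f \<in> cyc_aut F ((\<lambda>x. \<pi> x) ` K)"
    by (rule F.cyc_autI[OF finite_F Kc Kmm closed inj dif])
  have "induced_aut f \<in> ring_hom F F"
  proof (rule ring_hom_memI)
    show "induced_aut f C \<in> carrier F" if "C \<in> carrier F" for C using closed that by blast
    show "induced_aut f \<one>\<^bsub>F\<^esub> = \<one>\<^bsub>F\<^esub>" using ind[of \<one>] ring_hom_one[OF hom] by simp
    fix C D assume "C \<in> carrier F" "D \<in> carrier F"
    then obtain x y where x: "x \<in> carrier R" "C = \<pi> x" and y: "y \<in> carrier R" "D = \<pi> y"
      by (auto simp: carrier_F)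
    show "induced_aut f (C \<otimes>\<^bsub>F\<^esub> D) = induced_aut f C \<otimes>\<^bsub>F\<^esub> induced_aut f D"
      using ind[of "x \<otimes> y"] ind[OF x(1)] ind[OF y(1)] x y sc ring_hom_mult[OF hom x(1) y(1)] by simp
    show "induced_aut f (C \<oplus>\<^bsub>F\<^esub> D) = induced_aut f C \<oplus>\<^bsub>F\<^esub> induced_aut f D"
      using ind[of "x \<oplus> y"] ind[OF x(1)] ind[OF y(1)] x y sc ring_hom_add[OF hom x(1) y(1)] by simp
  qed
  moreover have "bij_betw (induced_aut f) (carrier F) (carrier F)"
    using aut by (simp add: cyc_aut_def)
  moreover have "res_map R ` K = (\<lambda>x. \<pi> x) ` K" by (simp add: res_map_def rad_eq)
  ultimately show ?thesis using aut unfolding autC_field_def res_field_eq ring_iso_def by simp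
qed

text \<open>Equal induced maps mean agreement modulo \<open>M\<close>, which
  \<open>kresp_hom_unique\<close> upgrades to equality.\<close>

lemma induced_aut_inj:
  assumes s: "f \<in> autC_ring R K" and t: "g \<in> autC_ring R K"
    and e: "\<And>C. C \<in> carrier F \<Longrightarrow> induced_aut f C = induced_aut g C" and x: "x \<in> carrier R"
  shows "f x = g x"
proof -
  note S = autC_ringD[OF s] and T = autC_ringD[OF t]
  have "f x \<ominus> g x \<in> M" if x: "x \<in> carrier R" for x
  proof -
    have "\<pi> x \<in> carrier F" unfolding carrier_F using x by blast
    then have "\<pi> (f x) = \<pi> (g x)" using e induced_aut_coset[OF s x] induced_aut_coset[OF t x] by metis
    then show ?thesis using pi_eq kresp_closed[OF S(2) x] kresp_closed[OF T(2) x] by blast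
  qed
  then show ?thesis by (rule kresp_hom_unique[OF T(2,1) S(2,1) _ x])
qed

end

text \<open>Injectivity is asserted on the carrier, since membership in \<open>autC_ring\<close>
  does not constrain a map elsewhere.\<close>

theorem theorem6p2:
  fixes R :: "'a ring" and K :: "'a set"
  assumes "cring R" and "finite (carrier R)" and "local_ring R" and "\<not> field R"
    and "subgroup K (units_of R)"
    and "strongly_pure R K"
  shows "cyc_normal R K
    \<and> (\<forall>\<sigma> \<in> autC_ring R K. induced_aut \<sigma> \<in> autC_field R K)
    \<and> (\<forall>\<sigma> \<in> autC_ring R K. \<forall>\<tau> \<in> autC_ring R K. \<forall>C \<in> carrier (res_field R).
          induced_aut (\<sigma> \<circ> \<tau>) C = (induced_aut \<sigma> \<circ> induced_aut \<tau>) C)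
    \<and> (\<forall>\<sigma> \<in> autC_ring R K. \<forall>\<tau> \<in> autC_ring R K.
          (\<forall>C \<in> carrier (res_field R). induced_aut \<sigma> C = induced_aut \<tau> C)
          \<longrightarrow> (\<forall>x \<in> carrier R. \<sigma> x = \<tau> x))"
proof -
  interpret L: finite_local_ring R "rad R"
    by (rule cring.finite_local_ring_rad[OF assms(1-3)])
  interpret cyc_ring R "rad R" K
    by (rule cyc_ring.intro[OF L.finite_local_ring_axioms cyc_ring_axioms.intro[OF assms(5,6)]])
  have "rad R \<noteq> {\<zero>\<^bsub>R\<^esub>}"
  proof
    assume "rad R = {\<zero>\<^bsub>R\<^esub>}"
    then have "Units R = carrier R - {\<zero>\<^bsub>R\<^esub>}" using L.Units_iff by blast
    then show False using cring.cring_fieldI[OF assms(1)] assms(4) by blast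
  qed
  then have "cyc_normal R K" using cyc_aut_affine by (auto simp: cyc_normal_def)
  moreover have "induced_aut (\<sigma> \<circ> \<tau>) C = (induced_aut \<sigma> \<circ> induced_aut \<tau>) C" for \<sigma> \<tau> :: "'a \<Rightarrow> 'a" and C
    by (simp add: induced_aut_def image_comp)
  moreover have "\<sigma> x = \<tau> x"
    if "\<sigma> \<in> autC_ring R K" "\<tau> \<in> autC_ring R K" "\<forall>C\<in>carrier (res_field R). induced_aut \<sigma> C = induced_aut \<tau> C"
      "x \<in> carrier R" for \<sigma> \<tau> x
    using induced_aut_inj[OF that(1,2) _ that(4)] that(3) unfolding res_field_eq by blast
  ultimately show ?thesis using induced_aut_autC by blast
qed

end
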